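(* There exist $2^{\aleph_0}$ pairwise non-isomorphic $2$-generated just-infinite branch pro-$2$ groups.
   Context: A pro-$2$ group is a profinite group (compact, totally disconnected topological group) $G$ such that $G/N$ is a finite $2$-group for every open normal subgroup $N$. "$2$-generated" is meant topologically: some two elements generate a dense subgroup. (For finitely generated profinite groups every abstract homomorphism to a profinite group is continuous, so isomorphism as abstract groups and as topological groups coincide.) A profinite group is just-infinite if it is infinite and its quotient by every nontrivial closed normal subgroup is finite. For a finite set $X$ with $d$ elements, let $X^\ast$ be the set of finite words over $X$, viewed as the rooted $d$-ary tree (root = empty word; level $n$ = words of length $n$). $Aut(X^\ast)$ is the group of rooted tree automorphisms (bijections of $X^\ast$ preserving length and common prefixes), with the profinite topology in which the pointwise stabilizers of the levels form a basis of neighbourhoods of the identity. A subgroup $G\le Aut(X^\ast)$ is level transitive if it acts transitively on each level. For $u\in X^\ast$, $Rist_G(u)$ is the subgroup of elements of $G$ acting trivially outside the subtree $uX^\ast$, and $Rist_G(n)=\langle Rist_G(u) : |u|=n\rangle=\prod_{|u|=n}Rist_G(u)$. A level transitive subgroup $G\le Aut(X^\ast)$ is a branch group if $Rist_G(n)$ has finite index in $G$ for all $n$; a branch profinite group is a profinite group that is isomorphic, as a topological group, to a closed branch subgroup of such an $Aut(X^\ast)$. *)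

theory Defs
  imports
    "HOL-Analysis.Analysis"
    "HOL-Algebra.Bij"
    "HOL-Algebra.Generated_Groups"
    "HOL-Library.Sublist"
    "HOL-Library.Equipollence"
begin

section \<open>Profinite groups\<close>

text \<open>A topological group is a pair of a group \<open>G\<close> and a topology \<open>T\<close> on its carrier.\<close>

definition topological_group :: "('a, 'b) monoid_scheme \<Rightarrow> 'a topology \<Rightarrow> bool" where
  "topological_group G T \<longleftrightarrow>
     group G \<and> topspace T = carrier G \<and>
     continuous_map (prod_topology T T) T (\<lambda>(x, y). x \<otimes>\<^bsub>G\<^esub> y) \<and>
     continuous_map T T (\<lambda>x. inv\<^bsub>G\<^esub> x)"

definition totally_disconnected_space :: "'a topology \<Rightarrow> bool" where
  "totally_disconnected_space T \<longleftrightarrow>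
     (\<forall>C. connectedin T C \<longrightarrow> (\<forall>x \<in> C. \<forall>y \<in> C. x = y))"

text \<open>The Hausdorff property is automatic: in a totally disconnected space points are closed,
  and a topological group with closed points is Hausdorff.\<close>

definition profinite_group :: "('a, 'b) monoid_scheme \<Rightarrow> 'a topology \<Rightarrow> bool" where
  "profinite_group G T \<longleftrightarrow>
     topological_group G T \<and> compact_space T \<and> totally_disconnected_space T"

definition pro_p_group :: "nat \<Rightarrow> ('a, 'b) monoid_scheme \<Rightarrow> 'a topology \<Rightarrow> bool" where
  "pro_p_group p G T \<longleftrightarrow>
     profinite_group G T \<and>
     (\<forall>N. N \<lhd> G \<and> openin T N \<longrightarrow>
        finite (carrier (G Mod N)) \<and> (\<exists>k. order (G Mod N) = p ^ k))"

definition topologically_2_generated :: "('a, 'b) monoid_scheme \<Rightarrow> 'a topology \<Rightarrow> bool" where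
  "topologically_2_generated G T \<longleftrightarrow>
     (\<exists>a \<in> carrier G. \<exists>b \<in> carrier G. T closure_of (generate G {a, b}) = carrier G)"

definition just_infinite :: "('a, 'b) monoid_scheme \<Rightarrow> 'a topology \<Rightarrow> bool" where
  "just_infinite G T \<longleftrightarrow>
     profinite_group G T \<and> infinite (carrier G) \<and>
     (\<forall>N. N \<lhd> G \<and> closedin T N \<and> N \<noteq> {\<one>\<^bsub>G\<^esub>} \<longrightarrow> finite (carrier (G Mod N)))"

definition topologically_isomorphic ::
    "('a, 'c) monoid_scheme \<Rightarrow> 'a topology \<Rightarrow> ('b, 'd) monoid_scheme \<Rightarrow> 'b topology \<Rightarrow> bool" where
  "topologically_isomorphic G T H U \<longleftrightarrow> (\<exists>f \<in> iso G H. homeomorphic_map T U f)"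

section \<open>Automorphisms of rooted regular trees\<close>

text \<open>The vertices of the rooted tree over the alphabet \<open>X\<close> are the words \<open>lists X\<close>.\<close>

definition level :: "'x set \<Rightarrow> nat \<Rightarrow> 'x list set" where
  "level X n = {w \<in> lists X. length w = n}"

text \<open>As in \<^const>\<open>Bij\<close>, automorphisms are extensional, i.e. \<open>undefined\<close> outside \<open>lists X\<close>.\<close>

definition tree_automorphisms :: "'x set \<Rightarrow> ('x list \<Rightarrow> 'x list) set" where
  "tree_automorphisms X =
     {g \<in> Bij (lists X).
        (\<forall>u \<in> lists X. length (g u) = length u) \<and>
        (\<forall>u \<in> lists X. \<forall>v \<in> lists X.
           longest_common_prefix (g u) (g v) = g (longest_common_prefix u v))}"

definition Aut_tree :: "'x set \<Rightarrow> ('x list \<Rightarrow> 'x list) monoid" where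
  "Aut_tree X = BijGroup (lists X)\<lparr>carrier := tree_automorphisms X\<rparr>"

definition level_stabilizer :: "'x set \<Rightarrow> nat \<Rightarrow> ('x list \<Rightarrow> 'x list) set" where
  "level_stabilizer X n = {g \<in> tree_automorphisms X. \<forall>w \<in> level X n. g w = w}"

text \<open>The level stabilizers form a basis of neighbourhoods of the identity, so their cosets form
  a basis of the topology.\<close>

definition Aut_tree_topology :: "'x set \<Rightarrow> ('x list \<Rightarrow> 'x list) topology" where
  "Aut_tree_topology X =
     topology_generated_by
       {g <#\<^bsub>Aut_tree X\<^esub> level_stabilizer X n | g n. g \<in> tree_automorphisms X}"

definition level_transitive :: "'x set \<Rightarrow> ('x list \<Rightarrow> 'x list) set \<Rightarrow> bool" where
  "level_transitive X H \<longleftrightarrow> (\<forall>n. \<forall>u \<in> level X n. \<forall>v \<in> level X n. \<exists>g \<in> H. g u = v)"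

definition Rist :: "'x set \<Rightarrow> ('x list \<Rightarrow> 'x list) set \<Rightarrow> 'x list \<Rightarrow> ('x list \<Rightarrow> 'x list) set" where
  "Rist X H u = {g \<in> H. \<forall>w \<in> lists X. \<not> prefix u w \<longrightarrow> g w = w}"

definition Rist_level :: "'x set \<Rightarrow> ('x list \<Rightarrow> 'x list) set \<Rightarrow> nat \<Rightarrow> ('x list \<Rightarrow> 'x list) set" where
  "Rist_level X H n = generate (Aut_tree X) (\<Union>u \<in> level X n. Rist X H u)"

definition branch_subgroup :: "'x set \<Rightarrow> ('x list \<Rightarrow> 'x list) set \<Rightarrow> bool" where
  "branch_subgroup X H \<longleftrightarrow>
     subgroup H (Aut_tree X) \<and> level_transitive X H \<and>
     (\<forall>n. finite (rcosets\<^bsub>Aut_tree X\<lparr>carrier := H\<rparr>\<^esub> Rist_level X H n))"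

text \<open>Every finite alphabet is in bijection with a finite set of natural numbers, so taking
  \<open>X :: nat set\<close> loses no generality.\<close>

definition branch_profinite_group :: "('a, 'b) monoid_scheme \<Rightarrow> 'a topology \<Rightarrow> bool" where
  "branch_profinite_group G T \<longleftrightarrow>
     profinite_group G T \<and>
     (\<exists>(X :: nat set) H. finite X \<and> branch_subgroup X H \<and> closedin (Aut_tree_topology X) H \<and>
        topologically_isomorphic G T
          (Aut_tree X\<lparr>carrier := H\<rparr>) (subtopology (Aut_tree_topology X) H))"

end

theory Submission
  imports Defs "HOL-Algebra.Sylow" "HOL-Algebra.Multiplicative_Group"
begin

text \<open>Fix a sequence \<open>k\<close> of numbers 3 and 4. Let \<open>G n\<close> be generated by \<open>a n\<close>, the rooted automorphism
  of the binary tree permuting the \<open>d = 2 ^ k n\<close> vertices \<open>x 0, \<dots>, x (d - 1)\<close> of level \<open>k n\<close> in a single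
  cycle, and by \<open>b n\<close>, which has sections \<open>b (n + 1)\<close> at \<open>x 0\<close> and \<open>a (n + 1)\<close> at \<open>x 1\<close> and is trivial
  elsewhere. The conjugates \<open>b_i\<close> of \<open>b n\<close> by powers of \<open>a n\<close> are supported at \<open>x i, x (i + 1)\<close>, and
  \<open>c_i = - b_i + b_(i+1)\<close> is a commutator. As \<open>d \<ge> 8\<close>, the supports of \<open>c_0\<close> and \<open>c_2\<close> only meet in \<open>x 2\<close>,
  so \<open>[c_0, c_2]\<close> lives at this one vertex, where it is \<open>[a (n + 1), - b (n + 1)]\<close>. It follows that the
  second derived subgroup of \<open>G n\<close> is exactly the product of \<open>d\<close> copies of the first derived subgroup
  of \<open>G (n + 1)\<close>.

  Hence all derived subgroups of \<open>G 0\<close> have finite index and are products over levels, which makes the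
  closure \<open>H\<close> of \<open>G 0\<close> a branch group; it is just infinite because a nontrivial normal subgroup
  contains the derived subgroup of the factors at some level. Finally \<open>c_0, \<dots>, c_(d-2)\<close> is a basis of
  the derived subgroup of \<open>G n\<close> modulo squares (independence is visible in the action one level below
  level \<open>k n\<close>), so modulo squares the \<open>(m + 1)\<close>-st closed derived subgroup of \<open>H\<close> has order
  \<open>(2 ^ (2 ^ k m - 1)) ^ 2 ^ (k 0 + \<dots> + k (m - 1))\<close>. These orders determine \<open>k\<close>.\<close>

section \<open>Automorphisms of the binary tree\<close>

text \<open>An isomorphism of two closures need not respect the tree, so the invariant is expressed
  by the topological group alone: closures of derived subgroups and of subgroups of squares.
  Computing it requires knowing such subgroups exactly. The first derived subgroup of
  \<open>G n\<close> merely lies in the product of the \<open>G (n + 1)\<close>, since each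
  \<open>c_i\<close> ties neighbouring factors together; deriving once more makes the factors
  independent, and from there the derived series descends one block at a time. The alphabet stays
  binary and only the block lengths vary, so every group sits in the automorphism group of one tree,
  whose level quotients are 2-groups. Length at least 3 leaves room for the supports. Length at most
  4 makes 16 annihilate all generators, hence the abelianisations finite. Two lengths already give
  as many sequences as there are sets of natural numbers. At the first \<open>m\<close> where two
  sequences differ, both products run over the same level, and \<open>2 ^ 7\<close> is compared with
  \<open>2 ^ 15\<close>. Automorphisms are coinductive trees because \<open>b n\<close> is given by
  an infinite recursion.\<close>

codatatype aut = Node (swap: bool) (left: aut) (right: aut)

definition child :: "aut \<Rightarrow> bool \<Rightarrow> aut" where
  "child g x = (if x then right g else left g)"

lemma child_simps [simp]: "child g True = right g" "child g False = left g"
  by (auto simp: child_def)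

fun act :: "aut \<Rightarrow> bool list \<Rightarrow> bool list" where
  "act g [] = []"
| "act g (x # w) = (x \<noteq> swap g) # act (child g x) w"

fun section_at :: "aut \<Rightarrow> bool list \<Rightarrow> aut" where
  "section_at g [] = g"
| "section_at g (x # w) = section_at (child g x) w"

lemma length_act [simp]: "length (act g w) = length w"
  by (induction w arbitrary: g) auto

lemma act_append: "act g (u @ w) = act g u @ act (section_at g u) w"
  by (induction u arbitrary: g) auto

lemma section_at_append: "section_at g (u @ w) = section_at (section_at g u) w"
  by (induction u arbitrary: g) auto

text \<open>Sums are compositions: \<open>act (g + h) = act g \<circ> act h\<close>.\<close>

instantiation aut :: group_add
begin

primcorec zero_aut :: aut where
  "0 = Node False 0 0"

primcorec plus_aut :: "aut \<Rightarrow> aut \<Rightarrow> aut" where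
  "swap (g + h) = (swap g \<noteq> swap h)"
| "left (g + h) = child g (swap h) + left h"
| "right (g + h) = child g (\<not> swap h) + right h"

primcorec uminus_aut :: "aut \<Rightarrow> aut" where
  "swap (- g) = swap g"
| "left (- g) = - child g (swap g)"
| "right (- g) = - child g (\<not> swap g)"

definition minus_aut :: "aut \<Rightarrow> aut \<Rightarrow> aut" where
  "g - h = g + - (h :: aut)"

instance
proof
  fix f g h :: aut
  show "f + g + h = f + (g + h)"
    by (coinduction arbitrary: f g h) (auto simp: child_def)
  show "0 + f = f"
    by (coinduction arbitrary: f) (auto simp: child_def)
  show "f + 0 = f"
    by (coinduction arbitrary: f) auto
  show "- f + f = 0"
    by (coinduction arbitrary: f) (auto simp: child_def)
  show "f + - g = f - g"
    by (simp add: minus_aut_def)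
qed

end

lemma child_zero [simp]: "child 0 x = 0"
  by (auto simp: child_def)

lemma child_plus: "child (g + h) x = child g (x \<noteq> swap h) + child h x"
  by (auto simp: child_def)

lemma child_uminus: "child (- g) x = - child g (x \<noteq> swap g)"
  by (auto simp: child_def)

lemma act_zero [simp]: "act 0 w = w"
  by (induction w) auto

lemma section_at_zero [simp]: "section_at 0 w = 0"
  by (induction w) auto

lemma act_plus [simp]: "act (g + h) w = act g (act h w)"
  by (induction w arbitrary: g h) (auto simp: child_plus)

lemma act_uminus_act [simp]: "act (- g) (act g w) = w" "act g (act (- g) w) = w"
  by (simp_all flip: act_plus)

lemma section_at_plus: "section_at (g + h) w = section_at g (act h w) + section_at h w"
  by (induction w arbitrary: g h) (auto simp: child_plus)

lemma section_at_uminus: "section_at (- g) w = - section_at g (act (- g) w)"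
proof -
  have "section_at g (act (- g) w) + section_at (- g) w = 0"
    by (simp flip: section_at_plus)
  then show ?thesis
    by (simp add: minus_unique)
qed

lemma act_inj [simp]: "act g u = act g w \<longleftrightarrow> u = w"
  by (metis act_uminus_act(1))

lemma act_uminus_fixed [simp]: "act (- g) w = w \<longleftrightarrow> act g w = w"
  by (metis act_uminus_act)

text \<open>The root swap is visible on a one-letter word and the halves on longer words, so the
  pairs with equal actions form a bisimulation.\<close>

lemma act_eqI:
  assumes "\<And>w. act g w = act h w"
  shows "g = h"
proof -
  have "\<forall>w. act g w = act h w"
    using assms by blast
  then show ?thesis
  proof (coinduction arbitrary: g h)
    case (Eq_aut g h)
    have "swap g = swap h"
      using Eq_aut[THEN spec, of "[False]"] by auto
    moreover have "act (left g) w = act (left h) w" "act (right g) w = act (right h) w" for w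
      using Eq_aut[THEN spec, of "False # w"] Eq_aut[THEN spec, of "True # w"] by auto
    ultimately show ?case
      by auto
  qed
qed

subsection \<open>Agreement on levels\<close>

definition agree :: "nat \<Rightarrow> aut \<Rightarrow> aut \<Rightarrow> bool" where
  "agree n g h \<longleftrightarrow> (\<forall>w. length w = n \<longrightarrow> act g w = act h w)"

lemma agree_refl [simp]: "agree n g g"
  by (simp add: agree_def)

lemma agree_sym: "agree n g h \<Longrightarrow> agree n h g"
  by (simp add: agree_def)

lemma agree_trans: "agree n f g \<Longrightarrow> agree n g h \<Longrightarrow> agree n f h"
  by (simp add: agree_def)

lemma agree_plus: "agree n g g' \<Longrightarrow> agree n h h' \<Longrightarrow> agree n (g + h) (g' + h')"
  by (simp add: agree_def)

lemma agree_uminus: "agree n g h \<Longrightarrow> agree n (- g) (- h)"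
  unfolding agree_def
proof (intro allI impI)
  fix w :: "bool list"
  assume *: "\<forall>w. length w = n \<longrightarrow> act g w = act h w" and "length w = n"
  then have "act h (act (- g) w) = w"
    by (metis act_uminus_act(2) length_act)
  then show "act (- g) w = act (- h) w"
    by (metis act_uminus_act(1))
qed

lemma agree_minus: "agree n g g' \<Longrightarrow> agree n h h' \<Longrightarrow> agree n (g - h) (g' - h')"
  by (metis agree_plus agree_uminus diff_conv_add_uminus)

lemma agree_short: "agree n g h \<Longrightarrow> length w \<le> n \<Longrightarrow> act g w = act h w"
proof -
  assume a: "agree n g h" and l: "length w \<le> n"
  let ?v = "w @ replicate (n - length w) False"
  have "act g ?v = act h ?v"
    using a l unfolding agree_def by simp
  then show ?thesis
    by (simp add: act_append)
qed

lemma agree_mono: "agree n g h \<Longrightarrow> m \<le> n \<Longrightarrow> agree m g h"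
  by (subst agree_def) (auto intro: agree_short)

lemma agree_0 [simp]: "agree 0 g h"
  by (simp add: agree_def)

lemma agree_Suc:
  "agree (Suc n) g h \<longleftrightarrow> swap g = swap h \<and> agree n (left g) (left h) \<and> agree n (right g) (right h)"
proof
  assume *: "agree (Suc n) g h"
  have "swap g = swap h"
    using agree_short[OF *, of "[False]"] by auto
  moreover have "act (left g) w = act (left h) w" "act (right g) w = act (right h) w"
    if "length w = n" for w
    using agree_short[OF *, of "False # w"] agree_short[OF *, of "True # w"] that by auto
  ultimately show "swap g = swap h \<and> agree n (left g) (left h) \<and> agree n (right g) (right h)"
    by (simp add: agree_def)
next
  assume "swap g = swap h \<and> agree n (left g) (left h) \<and> agree n (right g) (right h)"
  then show "agree (Suc n) g h"
    by (auto simp: agree_def length_Suc_conv child_def)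
qed

lemma agree_eqI: "(\<And>n. agree n g h) \<Longrightarrow> g = h"
  by (rule act_eqI) (simp add: agree_def)

lemma agree_section_at:
  "agree (length u + n) g h \<Longrightarrow> agree n (section_at g u) (section_at h u)"
  by (induction u arbitrary: g h) (auto simp: agree_Suc child_def)

text \<open>Splits an equality into a finite part, the permutation of level \<open>n\<close>, and
  the sections below it. Identities between explicitly given elements are checked this way.\<close>

lemma section_at_eqI:
  assumes "agree n g h" and "\<And>w. length w = n \<Longrightarrow> section_at g w = section_at h w"
  shows "g = h"
  using assms
proof (induction n arbitrary: g h)
  case 0
  then show ?case using 0(2)[of "[]"] by simp
next
  case (Suc n)
  have "left g = left h"
  proof (rule Suc.IH)
    show "section_at (left g) w = section_at (left h) w" if "length w = n" for w
      using Suc.prems(2)[of "False # w"] that by simp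
  qed (use Suc.prems(1) in \<open>simp add: agree_Suc\<close>)
  moreover have "right g = right h"
  proof (rule Suc.IH)
    show "section_at (right g) w = section_at (right h) w" if "length w = n" for w
      using Suc.prems(2)[of "True # w"] that by simp
  qed (use Suc.prems(1) in \<open>simp add: agree_Suc\<close>)
  ultimately show ?case
    using Suc.prems(1) by (auto simp: agree_Suc intro: aut.expand)
qed

subsection \<open>Automorphisms supported on a subtree\<close>

fun implant :: "bool list \<Rightarrow> aut \<Rightarrow> aut" where
  "implant [] g = g"
| "implant (x # w) g = (if x then Node False 0 (implant w g) else Node False (implant w g) 0)"

lemma Node_zero [simp]: "Node False 0 0 = 0"
  by (rule aut.expand) simp

lemma implant_zero [simp]: "implant w 0 = 0"
  by (induction w) auto

lemma Node_plus_Node [simp]: "Node False g h + Node False g' h' = Node False (g + g') (h + h')"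
  by (rule aut.expand) simp

lemma uminus_Node_False [simp]: "- Node False g h = Node False (- g) (- h)"
  by (rule aut.expand) simp

lemma implant_plus: "implant w (g + h) = implant w g + implant w h"
  by (induction w) auto

lemma implant_uminus: "implant w (- g) = - implant w g"
  by (induction w) auto

lemma act_implant [simp]: "length w = length u \<Longrightarrow> act (implant u g) w = w"
  by (induction w u rule: list_induct2) (auto simp: child_def)

lemma section_at_implant:
  "length w = length u \<Longrightarrow> section_at (implant u g) w = (if w = u then g else 0)"
  by (induction w u rule: list_induct2) (auto simp: child_def)

lemma act_implant_outside: "\<not> prefix u w \<Longrightarrow> act (implant u g) w = w"
proof (induction u arbitrary: w)
  case (Cons x u)
  then show ?case
    by (cases w) (auto simp: child_def)
qed simp

text \<open>Both sides of \<open>g + implant w x = ... + g\<close> have the same permutation and the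
  same sections at level \<open>length w\<close>. Every later transport of a support from vertex to
  vertex is an instance.\<close>

lemma implant_conj:
  "g + implant w x - g = implant (act g w) (section_at g w + x - section_at g w)"
proof -
  have eq: "g + implant w x = implant (act g w) (section_at g w + x - section_at g w) + g"
    (is "?l = ?r")
  proof (rule section_at_eqI[where n = "length w"])
    show "agree (length w) ?l ?r"
      by (simp add: agree_def)
    show "section_at ?l v = section_at ?r v" if "length v = length w" for v
      using that by (simp add: section_at_plus section_at_implant)
  qed
  show ?thesis
    by (simp only: eq add_diff_cancel)
qed

section \<open>Subgroups, commutators and indices\<close>

text \<open>For \<^class>\<open>group_add\<close>, where addition need not commute, these rules rewrite every group word to
  its reduced form, so \<open>simp only\<close> decides identities of free groups.\<close>

lemmas group_word_simps =
  diff_conv_add_uminus add.assoc minus_add minus_minus minus_add_cancel add_minus_cancel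
  right_minus left_minus add_0_left add_0_right minus_zero

definition is_subgroup :: "'a::group_add set \<Rightarrow> bool" where
  "is_subgroup A \<longleftrightarrow> 0 \<in> A \<and> (\<forall>x\<in>A. \<forall>y\<in>A. x + y \<in> A) \<and> (\<forall>x\<in>A. - x \<in> A)"

lemma is_subgroupD:
  assumes "is_subgroup A"
  shows "0 \<in> A" "x \<in> A \<Longrightarrow> y \<in> A \<Longrightarrow> x + y \<in> A" "x \<in> A \<Longrightarrow> - x \<in> A"
    "x \<in> A \<Longrightarrow> y \<in> A \<Longrightarrow> x - y \<in> A"
  using assms unfolding is_subgroup_def by (auto simp flip: add_uminus_conv_diff)

lemma is_subgroup_cancel_right:
  assumes "is_subgroup A" "y \<in> A"
  shows "x + y \<in> A \<longleftrightarrow> x \<in> A"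
  by (metis assms is_subgroupD(2,4) add_diff_cancel)

text \<open>Words grow only on the left and by one letter, so an induction over the generated
  subgroup has just two steps.\<close>

inductive_set gen :: "'a::group_add set \<Rightarrow> 'a set" for S where
  gen_zero: "0 \<in> gen S"
| gen_add: "s \<in> S \<Longrightarrow> x \<in> gen S \<Longrightarrow> s + x \<in> gen S"
| gen_minus: "s \<in> S \<Longrightarrow> x \<in> gen S \<Longrightarrow> - s + x \<in> gen S"

lemma gen_incl: "s \<in> S \<Longrightarrow> s \<in> gen S"
  using gen_add[OF _ gen_zero] by fastforce

lemma gen_plus: "x \<in> gen S \<Longrightarrow> y \<in> gen S \<Longrightarrow> x + y \<in> gen S"
  by (induction rule: gen.induct) (auto simp: add.assoc intro: gen.intros)

lemma gen_uminus: "x \<in> gen S \<Longrightarrow> - x \<in> gen S"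
proof (induction rule: gen.induct)
  case (gen_add s x)
  then show ?case
    using gen_plus gen.gen_minus[OF gen_add(1) gen_zero] by (metis add.right_neutral minus_add)
next
  case (gen_minus s x)
  then show ?case
    using gen_plus gen_incl by (metis minus_minus minus_add)
qed (simp add: gen_zero)

lemma is_subgroup_gen: "is_subgroup (gen S)"
  by (simp add: is_subgroup_def gen_zero gen_plus gen_uminus)

lemma gen_least:
  assumes "is_subgroup A" "S \<subseteq> A"
  shows "gen S \<subseteq> A"
proof
  fix x assume "x \<in> gen S"
  then show "x \<in> A"
    using assms by (induction rule: gen.induct) (auto intro: is_subgroupD)
qed

lemma hom_on_zero:
  assumes "is_subgroup A" and "\<And>x y. x \<in> A \<Longrightarrow> y \<in> A \<Longrightarrow> f (x + y) = f x + f y"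
  shows "f 0 = (0 :: 'b::group_add)"
proof -
  have "f 0 + f 0 = f 0 + 0"
    using assms(2)[of 0 0] is_subgroupD(1)[OF assms(1)] by simp
  then show ?thesis
    by (simp only: add_left_cancel)
qed

lemma hom_on_uminus:
  assumes "is_subgroup A" and "\<And>x y. x \<in> A \<Longrightarrow> y \<in> A \<Longrightarrow> f (x + y) = f x + f y"
    and "x \<in> A"
  shows "f (- x) = - (f x :: 'b::group_add)"
proof -
  have "f x + f (- x) = 0"
    using assms(2)[of x "- x"] is_subgroupD(3)[OF assms(1,3)] assms(3)
      hom_on_zero[OF assms(1,2)] by simp
  then show ?thesis
    by (simp add: minus_unique)
qed

text \<open>\<open>f\<close> is additive on \<open>A\<close> only, because it will be an isomorphism
  between two closures with arbitrary values elsewhere. This carries derived subgroups and subgroups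
  of squares across it.\<close>

lemma gen_hom_image:
  assumes A: "is_subgroup A" "S \<subseteq> A"
    and hom: "\<And>x y. x \<in> A \<Longrightarrow> y \<in> A \<Longrightarrow> f (x + y) = f x + (f y :: 'b::group_add)"
  shows "f ` gen S = gen (f ` S)"
proof -
  have f0: "f 0 = 0"
    using A(1) hom by (rule hom_on_zero)
  have fm: "f (- x) = - f x" if "x \<in> A" for x
    using A(1) hom that by (rule hom_on_uminus)
  have sub: "gen S \<subseteq> A"
    by (rule gen_least[OF A])
  have "f x \<in> gen (f ` S)" if "x \<in> gen S" for x
    using that
  proof (induction rule: gen.induct)
    case (gen_add s x)
    then show ?case
      using A sub by (subst hom) (auto intro: gen.gen_add)
  next
    case (gen_minus s x)
    have s: "s \<in> A"
      using gen_minus A by auto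
    then have "f (- s + x) = - f s + f x"
      using A sub gen_minus by (subst hom) (auto simp: fm intro: is_subgroupD)
    then show ?case
      using gen_minus by (auto intro: gen.gen_minus)
  qed (simp add: f0 gen_zero)
  moreover have "y \<in> f ` gen S" if "y \<in> gen (f ` S)" for y
    using that
  proof (induction rule: gen.induct)
    case gen_zero
    then show ?case
      using f0 gen.gen_zero by (metis imageI)
  next
    case (gen_add s y)
    then obtain s' x where "s' \<in> S" "s = f s'" "x \<in> gen S" "y = f x"
      by auto
    moreover from this have "f (s' + x) = s + y"
      using A sub by (subst hom) auto
    ultimately show ?case
      by (metis gen.gen_add imageI)
  next
    case (gen_minus s y)
    then obtain s' x where "s' \<in> S" "s = f s'" "x \<in> gen S" "y = f x"
      by auto
    moreover from this have "f (- s' + x) = - s + y"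
      using A sub by (subst hom) (auto simp: fm intro: is_subgroupD)
    ultimately show ?case
      by (metis gen.gen_minus imageI)
  qed
  ultimately show ?thesis
    by auto
qed

section \<open>Commutators, derived subgroups and subgroups generated by squares\<close>

definition comm :: "'a::group_add \<Rightarrow> 'a \<Rightarrow> 'a" where
  "comm x y = x + y - x - y"

definition der :: "'a::group_add set \<Rightarrow> 'a set" where
  "der A = gen {comm x y |x y. x \<in> A \<and> y \<in> A}"

definition squares :: "'a::group_add set \<Rightarrow> 'a set" where
  "squares A = gen {x + x |x. x \<in> A}"

lemma comm_in_der: "x \<in> A \<Longrightarrow> y \<in> A \<Longrightarrow> comm x y \<in> der A"
  unfolding der_def by (rule gen_incl) auto

lemma is_subgroup_der: "is_subgroup (der A)"
  unfolding der_def by (rule is_subgroup_gen)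

lemma is_subgroup_squares: "is_subgroup (squares A)"
  unfolding squares_def by (rule is_subgroup_gen)

lemma der_subset: "is_subgroup A \<Longrightarrow> der A \<subseteq> A"
  unfolding der_def by (rule gen_least) (auto simp: comm_def intro!: is_subgroupD)

lemma squares_subset: "is_subgroup A \<Longrightarrow> squares A \<subseteq> A"
  unfolding squares_def by (rule gen_least) (auto intro: is_subgroupD)

lemma der_mono: "A \<subseteq> B \<Longrightarrow> der A \<subseteq> der B"
  unfolding der_def by (rule gen_least[OF is_subgroup_gen]) (auto intro!: gen_incl)

lemma der_least: "is_subgroup N \<Longrightarrow> (\<And>x y. x \<in> A \<Longrightarrow> y \<in> A \<Longrightarrow> comm x y \<in> N) \<Longrightarrow> der A \<subseteq> N"
  unfolding der_def by (rule gen_least) auto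

lemma conj_conv_comm: "g + x - g = comm g x + x"
  unfolding comm_def by (simp only: group_word_simps)

lemma der_normal:
  assumes "is_subgroup A" "g \<in> A" "x \<in> der A"
  shows "g + x - g \<in> der A"
proof -
  have "comm g x \<in> der A"
    using assms der_subset by (auto intro: comm_in_der)
  then show ?thesis
    unfolding conj_conv_comm using assms(3) is_subgroup_der by (auto intro: is_subgroupD)
qed

lemma comm_minus_commute: "comm y x = - comm x y"
  unfolding comm_def by (simp only: group_word_simps)

lemma comm_plus_left: "comm (x + x') y = (x + comm x' y - x) + comm x y"
  unfolding comm_def by (simp only: group_word_simps)

lemma comm_uminus_left: "comm (- x) y = - x - comm x y + x"
  unfolding comm_def by (simp only: group_word_simps)

text \<open>Since \<open>N\<close> is normalised, \<open>comm_plus_left\<close> and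
  \<open>comm_uminus_left\<close> let a commutator be expanded letter by letter in its first
  argument; \<open>comm_minus_commute\<close> swaps the arguments for a second pass. So the derived
  subgroup is the normal closure of the commutators of generators.\<close>

lemma der_gen_least:
  assumes N: "is_subgroup N" and norm: "\<And>g x. g \<in> gen S \<Longrightarrow> x \<in> N \<Longrightarrow> g + x - g \<in> N"
    and S: "\<And>s t. s \<in> S \<Longrightarrow> t \<in> S \<Longrightarrow> comm s t \<in> N"
  shows "der (gen S) \<subseteq> N"
proof (rule der_least[OF N])
  have step: "comm x y \<in> N"
    if y: "\<And>s. s \<in> S \<Longrightarrow> comm s y \<in> N" and x: "x \<in> gen S" for x y
    using x
  proof (induction rule: gen.induct)
    case gen_zero
    then show ?case
      using N by (simp add: comm_def is_subgroupD)
  next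
    case (gen_add s x)
    have "s + comm x y - s \<in> N"
      using gen_add by (intro norm gen_incl)
    then show ?case
      unfolding comm_plus_left using is_subgroupD(2)[OF N _ y[OF gen_add(1)]] by blast
  next
    case (gen_minus s x)
    have "- s \<in> gen S"
      using gen_minus by (intro gen_uminus gen_incl)
    then have "- s + - comm s y - - s \<in> N" and conj: "- s + comm x y - - s \<in> N"
      using norm[of "- s" "- comm s y"] norm[of "- s" "comm x y"] is_subgroupD(3)[OF N y] gen_minus
      by blast+
    then have "comm (- s) y \<in> N"
      unfolding comm_uminus_left by (simp only: group_word_simps)
    then show ?case
      unfolding comm_plus_left by (rule is_subgroupD(2)[OF N conj])
  qed
  fix x y
  assume x: "x \<in> gen S" and y: "y \<in> gen S"
  have "comm s y \<in> N" if "s \<in> S" for s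
  proof -
    have "comm y s \<in> N"
      using step[OF S[OF _ that] y] .
    then show ?thesis
      unfolding comm_minus_commute[of s y] by (rule is_subgroupD(3)[OF N])
  qed
  then show "comm x y \<in> N"
    using x by (rule step)
qed

subsection \<open>Indices\<close>

text \<open>Only an upper bound: finitely many left translates of \<open>B\<close> cover
  \<open>A\<close>. In this form the notion is monotone in both arguments and passes to
  closures.\<close>

definition finite_index :: "'a::group_add set \<Rightarrow> 'a set \<Rightarrow> bool" where
  "finite_index A B \<longleftrightarrow> (\<exists>F. finite F \<and> (\<forall>x\<in>A. \<exists>f\<in>F. - f + x \<in> B))"

lemma finite_index_trans:
  assumes "finite_index A B" "finite_index B C"
  shows "finite_index A C"
proof -
  obtain F E where F: "finite F" "\<And>x. x \<in> A \<Longrightarrow> \<exists>f\<in>F. - f + x \<in> B"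
    and E: "finite E" "\<And>x. x \<in> B \<Longrightarrow> \<exists>e\<in>E. - e + x \<in> C"
    using assms unfolding finite_index_def by auto
  have "\<exists>g\<in>(\<lambda>(f, e). f + e) ` (F \<times> E). - g + x \<in> C" if x: "x \<in> A" for x
  proof -
    obtain f e where "f \<in> F" "e \<in> E" "- e + (- f + x) \<in> C"
      using F(2)[OF x] E(2) by blast
    moreover have "- (f + e) + x = - e + (- f + x)"
      by (simp only: group_word_simps)
    ultimately show ?thesis
      by force
  qed
  then show ?thesis
    unfolding finite_index_def using F(1) E(1)
    by (intro exI[of _ "(\<lambda>(f, e). f + e) ` (F \<times> E)"]) simp
qed

lemma finite_index_mono:
  assumes "finite_index A B" "A' \<subseteq> A" "B \<subseteq> B'"
  shows "finite_index A' B'"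
proof -
  obtain F where "finite F" "\<And>x. x \<in> A \<Longrightarrow> \<exists>f\<in>F. - f + x \<in> B"
    using assms(1) unfolding finite_index_def by auto
  then show ?thesis
    unfolding finite_index_def using assms(2,3) by (intro exI[of _ F]) (simp, meson subsetD)
qed

lemma finite_index_refl: "0 \<in> A \<Longrightarrow> finite_index A A"
  unfolding finite_index_def by (intro exI[of _ "{0}"]) auto

text \<open>The exact index, by a transversal of left cosets. As a relation it can be established by
  construction, and two computed values are compared through
  \<open>has_index_unique\<close>.\<close>

definition has_index :: "'a::group_add set \<Rightarrow> 'a set \<Rightarrow> nat \<Rightarrow> bool" where
  "has_index A B m \<longleftrightarrow>
     (\<exists>F\<subseteq>A. finite F \<and> card F = m \<and>
        (\<forall>x\<in>A. \<exists>f\<in>F. - f + x \<in> B) \<and> (\<forall>f\<in>F. \<forall>g\<in>F. - f + g \<in> B \<longrightarrow> f = g))"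

lemma has_indexE:
  assumes "has_index A B m"
  obtains F where "F \<subseteq> A" "finite F" "card F = m"
    "\<And>x. x \<in> A \<Longrightarrow> \<exists>f\<in>F. - f + x \<in> B"
    "\<And>f g. f \<in> F \<Longrightarrow> g \<in> F \<Longrightarrow> - f + g \<in> B \<Longrightarrow> f = g"
proof -
  obtain F where *: "F \<subseteq> A \<and> finite F \<and> card F = m \<and>
      (\<forall>x\<in>A. \<exists>f\<in>F. - f + x \<in> B) \<and> (\<forall>f\<in>F. \<forall>g\<in>F. - f + g \<in> B \<longrightarrow> f = g)"
    using assms unfolding has_index_def ..
  show ?thesis
    by (rule that[of F]) (use * in simp_all)
qed

lemma has_indexI:
  assumes "F \<subseteq> A" "finite F" "card F = m"
    "\<And>x. x \<in> A \<Longrightarrow> \<exists>f\<in>F. - f + x \<in> B"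
    "\<And>f g. f \<in> F \<Longrightarrow> g \<in> F \<Longrightarrow> - f + g \<in> B \<Longrightarrow> f = g"
  shows "has_index A B m"
  unfolding has_index_def by (rule exI[of _ F]) (use assms in simp)

text \<open>Sending each representative to one of the same coset in the other transversal is
  injective.\<close>

lemma has_index_le:
  assumes B: "is_subgroup B" and m: "has_index A B m" and m': "has_index A B m'"
  shows "m \<le> m'"
proof -
  from m obtain F where F: "F \<subseteq> A" "finite F" "card F = m"
    "\<And>x. x \<in> A \<Longrightarrow> \<exists>f\<in>F. - f + x \<in> B"
    "\<And>f g. f \<in> F \<Longrightarrow> g \<in> F \<Longrightarrow> - f + g \<in> B \<Longrightarrow> f = g"
    by (rule has_indexE) (rule that)
  from m' obtain F' where F': "F' \<subseteq> A" "finite F'" "card F' = m'"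
    "\<And>x. x \<in> A \<Longrightarrow> \<exists>f\<in>F'. - f + x \<in> B"
    by (rule has_indexE) (rule that)
  define h where "h f = (SOME f'. f' \<in> F' \<and> - f' + f \<in> B)" for f
  have h: "h f \<in> F'" "- h f + f \<in> B" if "f \<in> F" for f
  proof -
    have "\<exists>f'. f' \<in> F' \<and> - f' + f \<in> B"
      using F'(4) F(1) that by blast
    then have "h f \<in> F' \<and> - h f + f \<in> B"
      unfolding h_def by (rule someI_ex)
    then show "h f \<in> F'" "- h f + f \<in> B"
      by auto
  qed
  have "inj_on h F"
  proof (rule inj_onI)
    fix f g assume fg: "f \<in> F" "g \<in> F" "h f = h g"
    have "- (- h f + f) + (- h f + g) \<in> B"
      using h(2)[OF fg(1)] h(2)[OF fg(2)] fg(3) is_subgroupD(2,3)[OF B] by simp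
    then have "- f + g \<in> B"
      by (simp only: group_word_simps)
    then show "f = g"
      using F(5) fg by blast
  qed
  then show ?thesis
    using card_inj_on_le[of h F F'] h(1) F(3) F'(1-3) by auto
qed

lemma has_index_unique:
  "is_subgroup B \<Longrightarrow> has_index A B m \<Longrightarrow> has_index A B m' \<Longrightarrow> m = m'"
  by (simp add: has_index_le order_antisym)

lemma has_index_refl:
  assumes "is_subgroup A"
  shows "has_index A A 1"
  by (rule has_indexI[of "{0}"]) (use assms in \<open>auto intro: is_subgroupD\<close>)

lemma has_index_hom_image:
  assumes A: "is_subgroup A" "B \<subseteq> A" and inj: "inj_on f A"
    and hom: "\<And>x y. x \<in> A \<Longrightarrow> y \<in> A \<Longrightarrow> f (x + y) = f x + (f y :: 'b::group_add)"
    and m: "has_index A B m"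
  shows "has_index (f ` A) (f ` B) m"
proof -
  have f0: "f 0 = 0"
    using A(1) hom by (rule hom_on_zero)
  have fm: "f (- x) = - f x" if "x \<in> A" for x
    using A(1) hom that by (rule hom_on_uminus)
  have fd: "- f x + f y \<in> f ` B \<longleftrightarrow> - x + y \<in> B" if "x \<in> A" "y \<in> A" for x y
  proof -
    have "- f x + f y = f (- x + y)" "- x + y \<in> A"
      using hom[of "- x" y] fm[of x] that is_subgroupD(2,3)[OF A(1)] by simp_all
    then show ?thesis
      using inj A(2) by (simp add: inj_on_image_mem_iff)
  qed
  from m obtain F where F: "F \<subseteq> A" "finite F" "card F = m"
    "\<And>x. x \<in> A \<Longrightarrow> \<exists>f\<in>F. - f + x \<in> B"
    "\<And>f g. f \<in> F \<Longrightarrow> g \<in> F \<Longrightarrow> - f + g \<in> B \<Longrightarrow> f = g"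
    by (rule has_indexE) (rule that)
  show ?thesis
  proof (rule has_indexI[of "f ` F"])
    show "card (f ` F) = m"
      using F(1,3) inj_on_subset[OF inj] by (simp add: card_image)
    show "\<exists>h\<in>f ` F. - h + y \<in> f ` B" if y: "y \<in> f ` A" for y
    proof -
      obtain x where x: "x \<in> A" "y = f x"
        using y by blast
      then obtain g where "g \<in> F" "- g + x \<in> B"
        using F(4) by blast
      then show ?thesis
        using x F(1) fd[of g x] by blast
    qed
    show "h = h'" if h: "h \<in> f ` F" "h' \<in> f ` F" "- h + h' \<in> f ` B" for h h'
    proof -
      obtain g g' where g: "g \<in> F" "h = f g" "g' \<in> F" "h' = f g'"
        using h by blast
      then have "- g + g' \<in> B"
        using fd[of g g'] F(1) h(3) by auto
      then show ?thesis
        using F(5) g by blast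
    qed
  qed (use F(1,2) in auto)
qed

text \<open>A quotient of exponent 2 is abelian. Explicitly, \<open>[x, y]\<close> is a product of
  three squares: those of \<open>x + y\<close>, of \<open>- y - x + y\<close> and of
  \<open>- y\<close>.\<close>

lemma comm_in_squares:
  assumes A: "is_subgroup A" and B: "is_subgroup B" "\<And>x. x \<in> A \<Longrightarrow> x + x \<in> B"
    and "x \<in> A" "y \<in> A"
  shows "comm x y \<in> B"
proof -
  let ?z = "- y - x + y"
  have "comm x y = ((x + y) + (x + y)) + ((?z + ?z) + (- y + - y))"
    unfolding comm_def by (simp only: group_word_simps)
  moreover have "?z \<in> A" "x + y \<in> A" "- y \<in> A"
    by (simp_all only: assms(4,5) is_subgroupD(2,3,4)[OF A])
  ultimately show ?thesis
    by (simp only: B(2) is_subgroupD(2)[OF B(1)])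
qed

text \<open>All squares of \<open>A\<close>, hence all its commutators, fall into \<open>B\<close>.
  Therefore \<open>c\<close> normalises \<open>S\<close> and \<open>c + c\<close> lies in
  \<open>S\<close>, so \<open>S\<close> and its translate by \<open>c\<close> make up a group. If
  \<open>c\<close> is new, a transversal and its translate are disjoint, which doubles the
  index.\<close>

lemma adjoin_element:
  assumes A: "is_subgroup A" "S \<subseteq> A" "c \<in> A"
    and B: "is_subgroup B" "B \<subseteq> S" "\<And>x. x \<in> A \<Longrightarrow> x + x \<in> B"
    and S: "is_subgroup S"
  shows "is_subgroup (S \<union> (+) c ` S)" (is "is_subgroup ?T")
    and "c \<notin> S \<Longrightarrow> has_index S B m \<Longrightarrow> has_index (S \<union> (+) c ` S) B (2 * m)"
proof -
  have norm: "- c + s + c \<in> S" if "s \<in> S" for s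
  proof -
    have "comm (- c) s \<in> S"
      using comm_in_squares[OF A(1) B(1,3)] that A B(2) by (meson is_subgroupD(3) subsetD)
    moreover have "- c + s + c = comm (- c) s + s"
      unfolding comm_def by (simp only: group_word_simps)
    ultimately show ?thesis
      using that S by (simp add: is_subgroupD)
  qed
  have cc: "c + s + c \<in> S" if "s \<in> S" for s
  proof -
    have "c + s + c = (c + c) + (- c + s + c)"
      by (simp only: group_word_simps)
    then show ?thesis
      using norm[OF that] A(3) B S by (metis is_subgroupD(2) subsetD)
  qed
  show "is_subgroup ?T"
    unfolding is_subgroup_def
  proof (intro conjI ballI)
    show "0 \<in> ?T"
      using S by (simp add: is_subgroupD)
    fix x y assume x: "x \<in> ?T" and y: "y \<in> ?T"
    show "x + y \<in> ?T"
    proof (cases "x \<in> S")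
      case xS: True
      show ?thesis
      proof (cases "y \<in> S")
        case True
        then show ?thesis using xS S by (simp add: is_subgroupD)
      next
        case False
        then obtain s where s: "s \<in> S" "y = c + s"
          using y by auto
        have "x + y = c + ((- c + x + c) + s)"
          unfolding s(2) by (simp only: group_word_simps)
        then show ?thesis
          using norm[OF xS] s(1) is_subgroupD(2)[OF S] by blast
      qed
    next
      case False
      then obtain s where s: "s \<in> S" "x = c + s"
        using x by auto
      show ?thesis
      proof (cases "y \<in> S")
        case True
        then show ?thesis using s is_subgroupD(2)[OF S] by (auto simp: add.assoc)
      next
        case False
        then obtain t where t: "t \<in> S" "y = c + t"
          using y by auto
        have "x + y = (c + s + c) + t"
          unfolding s(2) t(2) by (simp only: group_word_simps)
        then show ?thesis
          using cc[OF s(1)] t(1) is_subgroupD(2)[OF S] by simp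
      qed
    qed
    show "- x \<in> ?T"
    proof (cases "x \<in> S")
      case True
      then show ?thesis using S by (simp add: is_subgroupD)
    next
      case False
      then obtain s where s: "s \<in> S" "x = c + s"
        using x by auto
      have "- x = c + - (c + s + c)"
        unfolding s(2) by (simp only: group_word_simps)
      then show ?thesis
        using is_subgroupD(3)[OF S cc[OF s(1)]] by blast
    qed
  qed
  assume c: "c \<notin> S" and m: "has_index S B m"
  from m obtain F where F: "F \<subseteq> S" "finite F" "card F = m"
    "\<And>x. x \<in> S \<Longrightarrow> \<exists>f\<in>F. - f + x \<in> B"
    "\<And>f g. f \<in> F \<Longrightarrow> g \<in> F \<Longrightarrow> - f + g \<in> B \<Longrightarrow> f = g"
    by (rule has_indexE) (rule that)
  have out: "c + s \<notin> S" if "s \<in> S" for s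
    using c S that by (simp add: is_subgroup_cancel_right)
  have c_cancel: "- (c + f) + (c + s) = - f + s" for f s
    by (simp only: group_word_simps)
  have sep: "- f + (c + g) \<notin> B" "- (c + g) + f \<notin> B" if "f \<in> F" "g \<in> F" for f g
  proof -
    have f: "f \<in> S"
      using that F(1) by blast
    show no: "- f + (c + g) \<notin> B"
    proof
      assume "- f + (c + g) \<in> B"
      then have "f + (- f + (c + g)) \<in> S"
        using f B(2) is_subgroupD(2)[OF S] by blast
      then have "c + g \<in> S"
        by (simp only: group_word_simps)
      then show False
        using out that F(1) by blast
    qed
    show "- (c + g) + f \<notin> B"
    proof
      assume "- (c + g) + f \<in> B"
      then have "- (- (c + g) + f) \<in> B"
        by (rule is_subgroupD(3)[OF B(1)])
      then have "- f + (c + g) \<in> B"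
        by (simp only: group_word_simps)
      then show False
        using no by blast
    qed
  qed
  show "has_index (S \<union> (+) c ` S) B (2 * m)"
  proof (rule has_indexI[of "F \<union> (+) c ` F"])
    have "F \<inter> (+) c ` F = {}"
      using F(1) out by auto
    then show "card (F \<union> (+) c ` F) = 2 * m"
      using F(2,3) by (simp add: card_Un_disjoint card_image)
    show "\<exists>f\<in>F \<union> (+) c ` F. - f + x \<in> B" if x: "x \<in> S \<union> (+) c ` S" for x
    proof (cases "x \<in> S")
      case True
      then show ?thesis using F(4) by blast
    next
      case False
      then obtain s where s: "s \<in> S" "x = c + s"
        using x by auto
      then obtain f where "f \<in> F" "- f + s \<in> B"
        using F(4) by blast
      then show ?thesis
        using s c_cancel[of f s] by (intro bexI[of _ "c + f"]) simp_all
    qed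
    show "f = g" if fg: "f \<in> F \<union> (+) c ` F" "g \<in> F \<union> (+) c ` F" "- f + g \<in> B" for f g
    proof -
      consider "f \<in> F" "g \<in> F" | f' where "f' \<in> F" "f = c + f'" "g \<in> F"
        | g' where "f \<in> F" "g' \<in> F" "g = c + g'"
        | f' g' where "f' \<in> F" "f = c + f'" "g' \<in> F" "g = c + g'"
        using fg(1,2) by blast
      then show ?thesis
      proof cases
        case 1
        then show ?thesis using F(5) fg(3) by blast
      next
        case 2
        then show ?thesis using sep(2)[of g f'] fg(3) by simp
      next
        case 3
        then show ?thesis using sep(1)[of f g'] fg(3) by simp
      next
        case 4
        then have "- f' + g' \<in> B"
          using fg(3) c_cancel[of f' g'] by simp
        then show ?thesis using F(5)[of f' g'] 4 by simp
      qed
    qed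
  qed (use F(1,2) in auto)
qed

section \<open>Level products and closures\<close>

text \<open>The direct product of \<open>2 ^ n\<close> copies of \<open>M\<close>, one below each
  vertex of level \<open>n\<close>.\<close>

definition level_prod :: "nat \<Rightarrow> aut set \<Rightarrow> aut set" where
  "level_prod n M = {g. \<forall>w. length w = n \<longrightarrow> act g w = w \<and> section_at g w \<in> M}"

lemma level_prodD:
  assumes "g \<in> level_prod n M" "length w = n"
  shows "act g w = w" "section_at g w \<in> M"
  using assms by (auto simp: level_prod_def)

lemma level_prod_agree: "g \<in> level_prod n M \<Longrightarrow> agree n g 0"
  by (simp add: level_prod_def agree_def)

lemma level_prod_0 [simp]: "level_prod 0 M = M"
  by (auto simp: level_prod_def)

lemma level_prod_Suc:
  "g \<in> level_prod (Suc n) M \<longleftrightarrow>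
     \<not> swap g \<and> left g \<in> level_prod n M \<and> right g \<in> level_prod n M"
proof
  assume g: "g \<in> level_prod (Suc n) M"
  have "\<not> swap g"
    using level_prodD(1)[OF g, of "replicate (Suc n) False"] by simp
  moreover have "act (left g) w = w" "act (right g) w = w"
    "section_at (left g) w \<in> M" "section_at (right g) w \<in> M" if "length w = n" for w
    using level_prodD[OF g, of "False # w"] level_prodD[OF g, of "True # w"] that by auto
  ultimately show "\<not> swap g \<and> left g \<in> level_prod n M \<and> right g \<in> level_prod n M"
    by (simp add: level_prod_def)
next
  assume "\<not> swap g \<and> left g \<in> level_prod n M \<and> right g \<in> level_prod n M"
  then show "g \<in> level_prod (Suc n) M"
    by (auto simp: level_prod_def length_Suc_conv child_def)
qed

lemma level_prod_level_prod: "level_prod m (level_prod n M) = level_prod (m + n) M"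
proof (induction m)
  case (Suc m)
  then show ?case
    by (auto simp: level_prod_Suc)
qed simp

lemma level_prod_mono: "M \<subseteq> N \<Longrightarrow> level_prod n M \<subseteq> level_prod n N"
  by (auto simp: level_prod_def)

lemma section_at_level_prod_plus:
  assumes "h \<in> level_prod n M" "length w = n"
  shows "section_at (g + h) w = section_at g w + section_at h w"
  using assms by (simp add: section_at_plus level_prodD)

lemma section_at_level_prod_uminus:
  assumes "h \<in> level_prod n M" "length w = n"
  shows "section_at (- h) w = - section_at h w"
proof -
  have "act (- h) w = w"
    using level_prodD(1)[OF assms] by simp
  then show ?thesis
    by (simp only: section_at_uminus)
qed

lemma is_subgroup_level_prod:
  assumes "is_subgroup M"
  shows "is_subgroup (level_prod n M)"
  unfolding is_subgroup_def
proof (intro conjI ballI)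
  show "0 \<in> level_prod n M"
    using assms by (simp add: level_prod_def is_subgroupD)
  fix g h assume g: "g \<in> level_prod n M" and h: "h \<in> level_prod n M"
  show "g + h \<in> level_prod n M"
    using assms section_at_level_prod_plus[OF h, of _ g] g h
    by (simp add: level_prod_def is_subgroupD)
  show "- g \<in> level_prod n M"
    using assms section_at_level_prod_uminus[OF g] g
    by (simp add: level_prod_def is_subgroupD)
qed

lemma section_at_comm:
  assumes "g \<in> level_prod n M" "h \<in> level_prod n M" "is_subgroup M" "length w = n"
  shows "section_at (comm g h) w = comm (section_at g w) (section_at h w)"
proof -
  have "- g \<in> level_prod n M" "- h \<in> level_prod n M"
    using assms is_subgroup_level_prod by (blast intro: is_subgroupD)+
  then show ?thesis
    unfolding comm_def using assms
    by (simp add: section_at_level_prod_plus section_at_level_prod_uminus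
        del: add_uminus_conv_diff add: diff_conv_add_uminus)
qed

lemma implant_in_level_prod:
  "0 \<in> M \<Longrightarrow> x \<in> M \<Longrightarrow> length w = n \<Longrightarrow> implant w x \<in> level_prod n M"
  by (auto simp: level_prod_def section_at_implant)

text \<open>An element of the product is the sum of its components. The induction splits off the two
  halves of the tree and looks at the traces \<open>?L\<close> and \<open>?R\<close> of
  \<open>N\<close> on them.\<close>

lemma level_prod_least:
  assumes N: "is_subgroup N" and *: "\<And>w x. length w = n \<Longrightarrow> x \<in> M \<Longrightarrow> implant w x \<in> N"
  shows "level_prod n M \<subseteq> N"
  using assms
proof (induction n arbitrary: N)
  case 0
  then show ?case using "0.prems"(2)[of "[]"] by auto
next
  case (Suc n)
  let ?L = "{g. Node False g 0 \<in> N}" and ?R = "{g. Node False 0 g \<in> N}"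
  have sub: "is_subgroup ?L" "is_subgroup ?R"
    using is_subgroupD(2)[OF Suc.prems(1), of "Node False _ 0" "Node False _ 0"]
      is_subgroupD(2)[OF Suc.prems(1), of "Node False 0 _" "Node False 0 _"]
      is_subgroupD(3)[OF Suc.prems(1), of "Node False _ 0"]
      is_subgroupD(3)[OF Suc.prems(1), of "Node False 0 _"]
      is_subgroupD(1)[OF Suc.prems(1)]
    by (auto simp: is_subgroup_def)
  have L: "level_prod n M \<subseteq> ?L"
    using Suc.prems(2)[of "False # _"] by (intro Suc.IH[OF sub(1)]) simp
  have R: "level_prod n M \<subseteq> ?R"
    using Suc.prems(2)[of "True # _"] by (intro Suc.IH[OF sub(2)]) simp
  show ?case
  proof
    fix g assume "g \<in> level_prod (Suc n) M"
    then have g: "\<not> swap g" "Node False (left g) 0 \<in> N" "Node False 0 (right g) \<in> N"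
      using L R by (auto simp: level_prod_Suc)
    have "g = Node False (left g) 0 + Node False 0 (right g)"
      using g(1) by (simp add: aut.expand)
    then show "g \<in> N"
      using is_subgroupD(2)[OF Suc.prems(1) g(2,3)] by simp
  qed
qed

lemma is_subgroup_implant_vimage:
  assumes "is_subgroup N"
  shows "is_subgroup {x. implant w x \<in> N}"
  using assms by (auto simp: is_subgroup_def implant_plus implant_uminus)

lemma comm_implant: "comm (implant w x) (implant w y) = implant w (comm x y)"
  by (simp only: comm_def diff_conv_add_uminus implant_plus implant_uminus)

text \<open>On the product, sections are homomorphisms, which bounds the derived subgroup from
  above. From below, commutators of elements implanted at a single vertex fill each factor.\<close>

lemma der_level_prod:
  assumes M: "is_subgroup M"
  shows "der (level_prod n M) = level_prod n (der M)"
proof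
  show "der (level_prod n M) \<subseteq> level_prod n (der M)"
  proof (rule der_least)
    show "is_subgroup (level_prod n (der M))"
      by (intro is_subgroup_level_prod is_subgroup_der)
    fix g h assume gh: "g \<in> level_prod n M" "h \<in> level_prod n M"
    then have "comm g h \<in> level_prod n M"
      using M is_subgroup_level_prod[OF M] unfolding comm_def by (blast intro: is_subgroupD)
    then show "comm g h \<in> level_prod n (der M)"
      using gh M by (auto simp: level_prod_def section_at_comm[OF gh M] intro!: comm_in_der)
  qed
  show "level_prod n (der M) \<subseteq> der (level_prod n M)"
  proof (rule level_prod_least[OF is_subgroup_der])
    fix w :: "bool list" and x assume w: "length w = n" and x: "x \<in> der M"
    have "der M \<subseteq> {x. implant w x \<in> der (level_prod n M)}"
    proof (rule der_least[OF is_subgroup_implant_vimage[OF is_subgroup_der]])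
      fix x y assume "x \<in> M" "y \<in> M"
      then have "comm (implant w x) (implant w y) \<in> der (level_prod n M)"
        using M w by (intro comm_in_der implant_in_level_prod) (auto intro: is_subgroupD)
      then show "comm x y \<in> {x. implant w x \<in> der (level_prod n M)}"
        by (simp add: comm_implant)
    qed
    then show "implant w x \<in> der (level_prod n M)"
      using x by blast
  qed
qed

lemma squares_level_prod:
  assumes M: "is_subgroup M"
  shows "squares (level_prod n M) = level_prod n (squares M)"
proof
  show "squares (level_prod n M) \<subseteq> level_prod n (squares M)"
    unfolding squares_def[of "level_prod n M"]
  proof (rule gen_least)
    show "is_subgroup (level_prod n (squares M))"
      by (intro is_subgroup_level_prod is_subgroup_squares)
    have "g + g \<in> level_prod n (squares M)" if "g \<in> level_prod n M" for g
      using that unfolding level_prod_def squares_def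
      by (auto simp: section_at_plus intro!: gen_incl)
    then show "{g + g |g. g \<in> level_prod n M} \<subseteq> level_prod n (squares M)"
      by blast
  qed
  show "level_prod n (squares M) \<subseteq> squares (level_prod n M)"
  proof (rule level_prod_least[OF is_subgroup_squares])
    fix w :: "bool list" and x assume w: "length w = n" and x: "x \<in> squares M"
    have "squares M \<subseteq> {x. implant w x \<in> squares (level_prod n M)}"
      unfolding squares_def[of M]
    proof (rule gen_least[OF is_subgroup_implant_vimage[OF is_subgroup_squares]])
      have "implant w (x + x) \<in> squares (level_prod n M)" if "x \<in> M" for x
        unfolding implant_plus squares_def
        using implant_in_level_prod[OF is_subgroupD(1)[OF M] that w] by (auto intro!: gen_incl)
      then show "{x + x |x. x \<in> M} \<subseteq> {x. implant w x \<in> squares (level_prod n M)}"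
        by blast
    qed
    then show "implant w x \<in> squares (level_prod n M)"
      using x by blast
  qed
qed

lemma finite_index_level_prod:
  assumes "finite_index A B"
  shows "finite_index (level_prod n A) (level_prod n B)"
proof (induction n)
  case (Suc n)
  then obtain F where F: "finite F" "\<And>x. x \<in> level_prod n A \<Longrightarrow> \<exists>f\<in>F. - f + x \<in> level_prod n B"
    unfolding finite_index_def by auto
  have "\<exists>f\<in>(\<lambda>(f, g). Node False f g) ` (F \<times> F). - f + x \<in> level_prod (Suc n) B"
    if x: "x \<in> level_prod (Suc n) A" for x
  proof -
    obtain f g where "f \<in> F" "- f + left x \<in> level_prod n B" "g \<in> F" "- g + right x \<in> level_prod n B"
      using F(2)[of "left x"] F(2)[of "right x"] x by (auto simp: level_prod_Suc)
    then show ?thesis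
      using x by (intro bexI[of _ "Node False f g"]) (auto simp: level_prod_Suc)
  qed
  then show ?case
    unfolding finite_index_def using F(1)
    by (intro exI[of _ "(\<lambda>(f, g). Node False f g) ` (F \<times> F)"]) simp
qed (simp add: assms)

text \<open>Pairs of representatives, one for each half, form a transversal one level deeper, so
  every level squares the index.\<close>

lemma has_index_level_prod:
  assumes "has_index A B m"
  shows "has_index (level_prod n A) (level_prod n B) (m ^ 2 ^ n)"
proof (induction n)
  case (Suc n)
  then obtain F where F: "F \<subseteq> level_prod n A" "finite F" "card F = m ^ 2 ^ n"
    "\<And>x. x \<in> level_prod n A \<Longrightarrow> \<exists>f\<in>F. - f + x \<in> level_prod n B"
    "\<And>f g. f \<in> F \<Longrightarrow> g \<in> F \<Longrightarrow> - f + g \<in> level_prod n B \<Longrightarrow> f = g"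
    by (rule has_indexE) (rule that)
  show ?case
  proof (rule has_indexI[of "(\<lambda>(f, g). Node False f g) ` (F \<times> F)"])
    show "card ((\<lambda>(f, g). Node False f g) ` (F \<times> F)) = m ^ 2 ^ Suc n"
      using F(3) by (subst card_image)
        (auto simp: inj_on_def card_cartesian_product power_mult mult.commute power2_eq_square
          simp flip: power_mult_distrib)
    show "\<exists>f\<in>(\<lambda>(f, g). Node False f g) ` (F \<times> F). - f + x \<in> level_prod (Suc n) B"
      if x: "x \<in> level_prod (Suc n) A" for x
    proof -
      obtain f g where "f \<in> F" "- f + left x \<in> level_prod n B" "g \<in> F" "- g + right x \<in> level_prod n B"
        using F(4)[of "left x"] F(4)[of "right x"] x by (auto simp: level_prod_Suc)
      then show ?thesis
        using x by (intro bexI[of _ "Node False f g"]) (auto simp: level_prod_Suc)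
    qed
    show "f = g" if fg: "f \<in> (\<lambda>(f, g). Node False f g) ` (F \<times> F)"
      "g \<in> (\<lambda>(f, g). Node False f g) ` (F \<times> F)" "- f + g \<in> level_prod (Suc n) B" for f g
    proof -
      obtain f1 f2 g1 g2 where *: "f = Node False f1 f2" "g = Node False g1 g2"
        "f1 \<in> F" "f2 \<in> F" "g1 \<in> F" "g2 \<in> F"
        using fg(1,2) by auto
      then have "- f1 + g1 \<in> level_prod n B" "- f2 + g2 \<in> level_prod n B"
        using fg(3) by (auto simp: level_prod_Suc)
      then show ?thesis
        using F(5)[of f1 g1] F(5)[of f2 g2] * by simp
    qed
    show "(\<lambda>(f, g). Node False f g) ` (F \<times> F) \<subseteq> level_prod (Suc n) A"
      using F(1) by (auto simp: level_prod_Suc)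
  qed (use F(2) in simp)
qed (simp add: assms)

subsection \<open>Closures\<close>

text \<open>The topological closure, expressed through agreement on levels;
  \<open>closure_of_realize\<close> identifies it with the closure in
  \<open>Aut_tree_topology bits\<close>.\<close>

definition cl :: "aut set \<Rightarrow> aut set" where
  "cl S = {g. \<forall>n. \<exists>s\<in>S. agree n g s}"

lemma clI: "(\<And>n. \<exists>s\<in>S. agree n g s) \<Longrightarrow> g \<in> cl S"
  by (simp add: cl_def)

lemma clE:
  assumes "g \<in> cl S"
  obtains s where "s \<in> S" "agree n g s"
  using assms unfolding cl_def by blast

lemma cl_incl: "S \<subseteq> cl S"
  unfolding cl_def using agree_refl by blast

lemma cl_mono: "S \<subseteq> S' \<Longrightarrow> cl S \<subseteq> cl S'"
  unfolding cl_def by (auto dest: bspec) (meson subsetD)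

lemma cl_cl [simp]: "cl (cl S) = cl S"
proof
  show "cl (cl S) \<subseteq> cl S"
  proof (intro subsetI clI)
    fix g n assume "g \<in> cl (cl S)"
    then obtain h where "h \<in> cl S" "agree n g h"
      by (rule clE)
    moreover from this obtain s where "s \<in> S" "agree n h s"
      by (elim clE)
    ultimately show "\<exists>s\<in>S. agree n g s"
      by (meson agree_trans)
  qed
qed (rule cl_incl)

lemma is_subgroup_cl:
  assumes "is_subgroup S"
  shows "is_subgroup (cl S)"
  unfolding is_subgroup_def
proof (intro conjI ballI)
  show "0 \<in> cl S"
    using cl_incl is_subgroupD(1)[OF assms] by blast
  fix x y assume x: "x \<in> cl S" and y: "y \<in> cl S"
  show "x + y \<in> cl S"
  proof (rule clI)
    fix n
    obtain s t where "s \<in> S" "agree n x s" "t \<in> S" "agree n y t"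
      using x y by (meson clE)
    then show "\<exists>s\<in>S. agree n (x + y) s"
      using agree_plus is_subgroupD(2)[OF assms] by blast
  qed
  show "- x \<in> cl S"
  proof (rule clI)
    fix n
    obtain s where "s \<in> S" "agree n x s"
      using x by (rule clE)
    then show "\<exists>s\<in>S. agree n (- x) s"
      using agree_uminus is_subgroupD(3)[OF assms] by blast
  qed
qed

lemma cl_least: "S \<subseteq> A \<Longrightarrow> cl A = A \<Longrightarrow> cl S \<subseteq> A"
  using cl_mono by blast

lemma cl_translate: "cl ((+) c ` S) = (+) c ` cl S"
proof -
  have sub: "(+) c ` cl S \<subseteq> cl ((+) c ` S)" for c S
  proof
    fix y assume "y \<in> (+) c ` cl S"
    then obtain x where x: "x \<in> cl S" "y = c + x"
      by blast
    show "y \<in> cl ((+) c ` S)"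
    proof (rule clI)
      fix n
      obtain s where "s \<in> S" "agree n x s"
        using x(1) by (rule clE)
      then show "\<exists>t\<in>(+) c ` S. agree n y t"
        using x(2) agree_plus[OF agree_refl] by blast
    qed
  qed
  have "(+) (- c) ` (+) c ` S = S" for S :: "aut set"
    by (simp add: image_image)
  then have "(+) (- c) ` cl ((+) c ` S) \<subseteq> cl S"
    using sub[of "- c" "(+) c ` S"] by simp
  then have "(+) c ` (+) (- c) ` cl ((+) c ` S) \<subseteq> (+) c ` cl S"
    by blast
  then show ?thesis
    using sub by (simp add: image_image subset_antisym)
qed

lemma cl_Un: "cl (A \<union> B) = cl A \<union> cl B"
proof
  show "cl (A \<union> B) \<subseteq> cl A \<union> cl B"
  proof (rule ccontr)
    assume "\<not> cl (A \<union> B) \<subseteq> cl A \<union> cl B"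
    then obtain g m n where g: "g \<in> cl (A \<union> B)" "\<forall>s\<in>A. \<not> agree m g s" "\<forall>s\<in>B. \<not> agree n g s"
      unfolding cl_def by blast
    obtain s where "s \<in> A \<union> B" "agree (max m n) g s"
      using g(1) by (rule clE)
    then show False
      using g(2,3) agree_mono[of "max m n" g s] by auto
  qed
qed (simp add: cl_mono)

text \<open>The closure of a finite union of translates of \<open>B\<close> is the union of the same
  translates of \<open>cl B\<close>, so the same \<open>F\<close> serves.\<close>

lemma finite_index_cl:
  assumes "finite_index A B"
  shows "finite_index (cl A) (cl B)"
proof -
  obtain F where F: "finite F" "\<And>x. x \<in> A \<Longrightarrow> \<exists>f\<in>F. - f + x \<in> B"
    using assms unfolding finite_index_def by auto
  have "cl A \<subseteq> cl (\<Union>f\<in>F. (+) f ` B)"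
  proof (rule cl_mono, rule subsetI)
    fix x assume "x \<in> A"
    then obtain f where f: "f \<in> F" "- f + x \<in> B"
      using F(2) by blast
    have "x = f + (- f + x)"
      by (simp only: group_word_simps)
    then show "x \<in> (\<Union>f\<in>F. (+) f ` B)"
      using f by blast
  qed
  also have "cl (\<Union>f\<in>F. (+) f ` B) = (\<Union>f\<in>F. (+) f ` cl B)"
    using F(1)
  proof (induction F rule: finite_induct)
    case empty
    then show ?case by (auto simp: cl_def)
  qed (simp add: cl_Un cl_translate)
  finally have sub: "cl A \<subseteq> (\<Union>f\<in>F. (+) f ` cl B)" .
  have "\<exists>f\<in>F. - f + x \<in> cl B" if x: "x \<in> cl A" for x
  proof -
    obtain f y where "f \<in> F" "y \<in> cl B" "x = f + y"
      using subsetD[OF sub x] by blast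
    then show ?thesis
      by (intro bexI[of _ f]) simp_all
  qed
  then show ?thesis
    unfolding finite_index_def using F(1) by blast
qed

lemma cl_level_prod: "cl (level_prod n M) = level_prod n (cl M)"
proof (induction n)
  case (Suc n)
  show ?case
  proof
    show "cl (level_prod (Suc n) M) \<subseteq> level_prod (Suc n) (cl M)"
    proof
      fix g assume g: "g \<in> cl (level_prod (Suc n) M)"
      have *: "\<exists>s. agree (Suc m) g s \<and> \<not> swap s \<and> left s \<in> level_prod n M \<and> right s \<in> level_prod n M" for m
        using g by (metis clE level_prod_Suc)
      have "\<not> swap g"
        using *[of 0] by (auto simp: agree_Suc)
      moreover have "left g \<in> cl (level_prod n M)" "right g \<in> cl (level_prod n M)"
        using * unfolding agree_Suc cl_def by blast+
      ultimately show "g \<in> level_prod (Suc n) (cl M)"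
        by (simp add: level_prod_Suc Suc.IH)
    qed
    show "level_prod (Suc n) (cl M) \<subseteq> cl (level_prod (Suc n) M)"
    proof (intro subsetI clI)
      fix g m assume "g \<in> level_prod (Suc n) (cl M)"
      then have g: "\<not> swap g" "left g \<in> cl (level_prod n M)" "right g \<in> cl (level_prod n M)"
        by (auto simp: level_prod_Suc Suc.IH)
      obtain s t where "s \<in> level_prod n M" "agree m (left g) s" "t \<in> level_prod n M" "agree m (right g) t"
        using g(2,3) by (meson clE)
      then have "Node False s t \<in> level_prod (Suc n) M" "agree (Suc m) g (Node False s t)"
        using g(1) by (auto simp: level_prod_Suc agree_Suc)
      then show "\<exists>s\<in>level_prod (Suc n) M. agree m g s"
        using agree_mono[of "Suc m" g _ m] by auto
    qed
  qed
qed simp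

lemma comm_in_cl_der:
  assumes "x \<in> cl A" "y \<in> cl A"
  shows "comm x y \<in> cl (der A)"
proof (rule clI)
  fix n
  obtain s t where "s \<in> A" "agree n x s" "t \<in> A" "agree n y t"
    using assms by (meson clE)
  then show "\<exists>z\<in>der A. agree n (comm x y) z"
    by (intro bexI[of _ "comm s t"] comm_in_der) (simp_all add: comm_def agree_plus agree_minus)
qed

lemma double_in_cl_squares:
  assumes "x \<in> cl A"
  shows "x + x \<in> cl (squares A)"
proof (rule clI)
  fix n
  obtain s where "s \<in> A" "agree n x s"
    using assms by (meson clE)
  then show "\<exists>z\<in>squares A. agree n (x + x) z"
    by (intro bexI[of _ "s + s"]) (auto simp: squares_def intro!: agree_plus gen_incl)
qed

text \<open>Commutators are continuous, so the closed derived series of \<open>cl A\<close> can be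
  computed inside the dense subgroup \<open>A\<close>.\<close>

lemma cl_der_cl: "cl (der (cl A)) = cl (der A)"
proof
  show "cl (der (cl A)) \<subseteq> cl (der A)"
    by (rule cl_least[OF _ cl_cl])
      (intro der_least is_subgroup_cl is_subgroup_der comm_in_cl_der)
qed (intro cl_mono der_mono cl_incl)

lemma cl_squares_cl: "cl (squares (cl A)) = cl (squares A)"
proof
  have "squares (cl A) \<subseteq> cl (squares A)"
    unfolding squares_def[of "cl A"]
    by (rule gen_least) (auto intro: is_subgroup_cl is_subgroup_squares double_in_cl_squares)
  then show "cl (squares (cl A)) \<subseteq> cl (squares A)"
    by (rule cl_least[OF _ cl_cl])
  have "squares A \<subseteq> squares (cl A)"
    unfolding squares_def
    by (rule gen_least[OF is_subgroup_gen]) (use cl_incl in \<open>auto intro!: gen_incl\<close>)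
  then show "cl (squares A) \<subseteq> cl (squares (cl A))"
    by (rule cl_mono)
qed

section \<open>The groups\<close>

primrec rot :: "nat \<Rightarrow> aut" where
  "rot 0 = 0"
| "rot (Suc k) = Node True 0 (rot k)"

text \<open>The \<open>k\<close> lowest binary digits of \<open>i\<close>, lowest digit first; \<open>rot k\<close> adds one modulo \<open>2 ^ k\<close>.\<close>

primrec pos :: "nat \<Rightarrow> nat \<Rightarrow> bool list" where
  "pos 0 i = []"
| "pos (Suc k) i = odd i # pos k (i div 2)"

lemma length_pos [simp]: "length (pos k i) = k"
  by (induction k arbitrary: i) auto

lemma act_rot_pos: "act (rot k) (pos k i) = pos k (Suc i)"
proof (induction k arbitrary: i)
  case (Suc k)
  show ?case
  proof (cases "even i")
    case True
    then show ?thesis by auto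
  next
    case False
    then have "Suc i div 2 = Suc (i div 2)"
      by presburger
    with False show ?thesis
      using Suc.IH[of "i div 2"] by simp
  qed
qed simp

lemma section_at_rot: "length w = k \<Longrightarrow> section_at (rot k) w = 0"
  by (induction k arbitrary: w) (auto simp: length_Suc_conv child_def)

lemma pos_eq_iff: "pos k i = pos k j \<longleftrightarrow> i mod 2 ^ k = j mod 2 ^ k"
proof (induction k arbitrary: i j)
  case (Suc k)
  have "i mod 2 ^ Suc k = 2 * ((i div 2) mod 2 ^ k) + i mod 2" for i :: nat
    by (simp add: mod_mult2_eq)
  moreover have "2 * a + i mod 2 = 2 * b + j mod 2 \<longleftrightarrow> odd i = odd j \<and> a = b" for a b :: nat
    unfolding mod_2_eq_odd by (cases "odd i"; cases "odd j"; simp; presburger)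
  ultimately show ?case
    using Suc.IH[of "i div 2" "j div 2"] by (simp del: power_Suc)
qed simp

lemma pos_neq:
  assumes "i < j" "j < i + 2 ^ k"
  shows "pos k i \<noteq> pos k j"
proof
  assume "pos k i = pos k j"
  then have "2 ^ k dvd j - i"
    using assms(1) mod_eq_dvd_iff_nat[of i j "2 ^ k"] by (simp add: pos_eq_iff)
  then show False
    using assms by (simp add: nat_dvd_not_less)
qed

lemma ex_pos:
  assumes "length w = k"
  shows "\<exists>i. w = pos k i"
  using assms
proof (induction k arbitrary: w)
  case (Suc k)
  then obtain x v i where w: "w = x # v" "v = pos k i"
    by (metis length_Suc_conv)
  have "w = pos (Suc k) (2 * i + of_bool x)"
    using w by simp
  then show ?case
    by blast
qed simp

text \<open>\<open>pos\<close> is periodic in its index, which can therefore be pushed past any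
  bound. This serves an induction that starts at vertex 2.\<close>

lemma ex_pos_ge:
  assumes "length w = k"
  shows "\<exists>i\<ge>m. w = pos k i"
proof -
  obtain i where "w = pos k i"
    using ex_pos[OF assms] by blast
  then have "w = pos k (i + m * 2 ^ k)"
    by (simp add: pos_eq_iff)
  moreover have "m \<le> i + m * 2 ^ k"
    by (simp add: trans_le_add2)
  ultimately show ?thesis
    by blast
qed

lemma pos_0: "pos k 0 = replicate k False"
  by (induction k) auto

lemma rot_pos_conj: "rot k + implant (pos k i) x - rot k = implant (pos k (Suc i)) x"
  by (simp add: implant_conj act_rot_pos section_at_rot)

text \<open>The generator \<open>b n\<close> of the introduction is \<open>dir k n\<close>, and \<open>dir_eq\<close> is its recursion. In
  \<open>spine k i x n\<close>, whose right half is \<open>x\<close>, the leftmost path makes \<open>i + 1\<close> steps before it meets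
  \<open>dir k (Suc n)\<close>.\<close>

primcorec spine :: "(nat \<Rightarrow> nat) \<Rightarrow> nat \<Rightarrow> aut \<Rightarrow> nat \<Rightarrow> aut" where
  "swap (spine k i x n) = False"
| "left (spine k i x n) =
     (if i = 0 then spine k (k (Suc n) - 1)
        (implant (replicate (k (Suc n) - 1) False) (rot (k (Suc (Suc n))))) (Suc n)
      else spine k (i - 1) 0 n)"
| "right (spine k i x n) = x"

definition dir :: "(nat \<Rightarrow> nat) \<Rightarrow> nat \<Rightarrow> aut" where
  "dir k n = spine k (k n - 1) (implant (replicate (k n - 1) False) (rot (k (Suc n)))) n"

text \<open>In the case \<open>i = 0\<close> the left half of \<open>spine\<close> is
  \<open>dir k (Suc n)\<close> written out, because \<open>dir\<close> is itself defined from
  \<open>spine\<close>. The equation folds it back.\<close>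

lemma spine_eq:
  "spine k i x n = implant (replicate (Suc i) False) (dir k (Suc n)) + Node False 0 x"
proof (induction i arbitrary: x)
  case 0
  show ?case
    by (rule aut.expand) (simp add: dir_def)
next
  case (Suc i)
  have "left (spine k (Suc i) x n) = implant (replicate (Suc i) False) (dir k (Suc n))"
    using Suc[of 0] by simp
  then show ?case
    by (intro aut.expand) simp
qed

text \<open>These are the conjugates \<open>b_i\<close>. As \<open>pos\<close> is periodic, the
  index runs around the cycle of vertices.\<close>

definition coord :: "(nat \<Rightarrow> nat) \<Rightarrow> nat \<Rightarrow> nat \<Rightarrow> aut" where
  "coord k n i = implant (pos (k n) i) (dir k (Suc n)) + implant (pos (k n) (Suc i)) (rot (k (Suc n)))"

lemma dir_eq: "k n > 0 \<Longrightarrow> dir k n = coord k n 0"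
  by (subst dir_def, subst spine_eq) (cases "k n", simp_all add: coord_def pos_0)

definition Grp :: "(nat \<Rightarrow> nat) \<Rightarrow> nat \<Rightarrow> aut set" where
  "Grp k n = gen {rot (k n), dir k n}"

text \<open>The level at which block \<open>n + m\<close> begins if block \<open>n\<close> begins at
  the root.\<close>

primrec depth :: "(nat \<Rightarrow> nat) \<Rightarrow> nat \<Rightarrow> nat \<Rightarrow> nat" where
  "depth k n 0 = 0"
| "depth k n (Suc m) = k n + depth k (Suc n) m"

lemma is_subgroup_Grp: "is_subgroup (Grp k n)"
  unfolding Grp_def by (rule is_subgroup_gen)

lemma rot_in_Grp: "rot (k n) \<in> Grp k n" and dir_in_Grp: "dir k n \<in> Grp k n"
  unfolding Grp_def by (auto intro: gen_incl)

lemma rot_coord_conj: "rot (k n) + coord k n i - rot (k n) = coord k n (Suc i)"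
proof -
  have "rot (k n) + coord k n i - rot (k n) =
      (rot (k n) + implant (pos (k n) i) (dir k (Suc n)) - rot (k n)) +
      (rot (k n) + implant (pos (k n) (Suc i)) (rot (k (Suc n))) - rot (k n))"
    unfolding coord_def by (simp only: group_word_simps)
  then show ?thesis
    by (simp only: rot_pos_conj coord_def)
qed

lemma coord_in_Grp:
  assumes "k n > 0"
  shows "coord k n i \<in> Grp k n"
proof (induction i)
  case 0
  then show ?case
    using dir_in_Grp[of k n] dir_eq[of k n, OF assms] by simp
next
  case (Suc i)
  then show ?case
    unfolding rot_coord_conj[symmetric]
    by (intro is_subgroupD(2,4)[OF is_subgroup_Grp] rot_in_Grp)
qed

lemma section_at_coord:
  assumes "length w = k n"
  shows "section_at (coord k n i) w =
    (if w = pos (k n) i then dir k (Suc n) else 0) + (if w = pos (k n) (Suc i) then rot (k (Suc n)) else 0)"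
  using assms by (simp add: coord_def section_at_plus section_at_implant)

lemma coord_in_level_prod: "coord k n i \<in> level_prod (k n) (Grp k (Suc n))"
  unfolding coord_def
  by (intro is_subgroupD(2)[OF is_subgroup_level_prod] is_subgroup_Grp implant_in_level_prod
      rot_in_Grp dir_in_Grp is_subgroupD(1)[OF is_subgroup_Grp] length_pos)

lemma section_at_Grp:
  assumes "k n > 0" "x \<in> Grp k n" "length w = k n"
  shows "section_at x w \<in> Grp k (Suc n)"
  using assms(2)[unfolded Grp_def[of k n]] assms(3)
proof (induction arbitrary: w rule: gen.induct)
  case gen_zero
  then show ?case
    by (simp add: is_subgroupD(1)[OF is_subgroup_Grp])
next
  have S: "section_at s w \<in> Grp k (Suc n)" if "s \<in> {rot (k n), dir k n}" "length w = k n" for s w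
    using that level_prodD(2)[OF coord_in_level_prod[of k n] that(2)]
    by (auto simp: section_at_rot is_subgroupD(1)[OF is_subgroup_Grp] dir_eq[of k n, OF assms(1)])
  have S': "section_at (- s) w \<in> Grp k (Suc n)" if "s \<in> {rot (k n), dir k n}" "length w = k n" for s w
    unfolding section_at_uminus using that by (intro is_subgroupD(3)[OF is_subgroup_Grp] S) simp_all
  { case (gen_add s x)
    then show ?case
      unfolding section_at_plus
      by (intro is_subgroupD(2)[OF is_subgroup_Grp] S[OF gen_add.hyps(1)]) simp_all
  next
    case (gen_minus s x)
    then show ?case
      unfolding section_at_plus
      by (intro is_subgroupD(2)[OF is_subgroup_Grp] S'[OF gen_minus.hyps(1)]) simp_all }
qed

text \<open>On level \<open>k n\<close>, \<open>dir k n\<close> is trivial and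
  \<open>rot (k n)\<close> adds one, so the group acts through rotations. This action is abelian,
  which puts all commutators into the level stabiliser.\<close>

lemma act_Grp_pos:
  assumes "k n > 0" "x \<in> Grp k n"
  shows "\<exists>j. \<forall>i. act x (pos (k n) i) = pos (k n) (i + j)"
  using assms(2)[unfolded Grp_def]
proof (induction rule: gen.induct)
  case gen_zero
  show ?case by (intro exI[of _ 0]) simp
next
  have d: "act (dir k n) (pos (k n) i) = pos (k n) i" for i
    by (simp add: dir_eq[of k n, OF assms(1)] level_prodD(1)[OF coord_in_level_prod[of k n]])
  have r: "act (- rot (k n)) (pos (k n) i) = pos (k n) (i + (2 ^ k n - 1))" for i
  proof -
    have "act (rot (k n)) (pos (k n) (i + (2 ^ k n - 1))) = pos (k n) i"
      by (simp add: act_rot_pos pos_eq_iff)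
    then show ?thesis
      by (metis act_uminus_act(1))
  qed
  have S: "\<exists>j. \<forall>i. act s (pos (k n) i) = pos (k n) (i + j)"
    "\<exists>j. \<forall>i. act (- s) (pos (k n) i) = pos (k n) (i + j)" if "s \<in> {rot (k n), dir k n}" for s
  proof -
    have "\<exists>j. \<forall>i. act (rot (k n)) (pos (k n) i) = pos (k n) (i + j)"
      by (rule exI[of _ 1]) (simp add: act_rot_pos)
    moreover have "\<exists>j. \<forall>i. act (- rot (k n)) (pos (k n) i) = pos (k n) (i + j)"
      using r by blast
    moreover have "\<exists>j. \<forall>i. act (dir k n) (pos (k n) i) = pos (k n) (i + j)"
      "\<exists>j. \<forall>i. act (- dir k n) (pos (k n) i) = pos (k n) (i + j)"
      using d by (auto intro!: exI[of _ 0])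
    ultimately show "\<exists>j. \<forall>i. act s (pos (k n) i) = pos (k n) (i + j)"
      "\<exists>j. \<forall>i. act (- s) (pos (k n) i) = pos (k n) (i + j)"
      using that by blast+
  qed
  have plus: "\<exists>j. \<forall>i. act (g + h) (pos (k n) i) = pos (k n) (i + j)"
    if g: "\<exists>j. \<forall>i. act g (pos (k n) i) = pos (k n) (i + j)"
      and h: "\<exists>j. \<forall>i. act h (pos (k n) i) = pos (k n) (i + j)" for g h
  proof -
    obtain j j' where "\<And>i. act g (pos (k n) i) = pos (k n) (i + j)"
      "\<And>i. act h (pos (k n) i) = pos (k n) (i + j')"
      using g h by blast
    then show ?thesis
      by (intro exI[of _ "j' + j"]) (simp add: add.assoc)
  qed
  { case (gen_add s x)
    show ?case
      by (rule plus[OF S(1)[OF gen_add.hyps(1)] gen_add.IH])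
  next
    case (gen_minus s x)
    show ?case
      by (rule plus[OF S(2)[OF gen_minus.hyps(1)] gen_minus.IH]) }
qed

lemma der_Grp_subset:
  assumes "k n > 0"
  shows "der (Grp k n) \<subseteq> level_prod (k n) (Grp k (Suc n))"
proof (rule der_least[OF is_subgroup_level_prod[OF is_subgroup_Grp]])
  fix x y assume xy: "x \<in> Grp k n" "y \<in> Grp k n"
  obtain i j where "\<And>l. act x (pos (k n) l) = pos (k n) (l + i)" "\<And>l. act y (pos (k n) l) = pos (k n) (l + j)"
    using act_Grp_pos assms xy by meson
  then have "act (x + y) w = act (y + x) w" if "length w = k n" for w
    using ex_pos[OF that] by (auto simp: algebra_simps)
  then have "agree (k n) (x + y - (y + x)) (y + x - (y + x))"
    by (intro agree_minus agree_refl) (simp add: agree_def)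
  moreover have "x + y - (y + x) = comm x y"
    unfolding comm_def by (simp only: group_word_simps)
  moreover have "comm x y \<in> Grp k n"
    using xy der_subset[OF is_subgroup_Grp] comm_in_der by blast
  ultimately show "comm x y \<in> level_prod (k n) (Grp k (Suc n))"
    using section_at_Grp[of k n, OF assms] by (simp add: level_prod_def agree_def)
qed

text \<open>At vertex \<open>i + 1\<close> the supports of \<open>b_i\<close> and
  \<open>b_(i+1)\<close> meet, with sections \<open>rot (k (Suc n))\<close> and
  \<open>dir k (Suc n)\<close>: both generators of the next group. So the level stabiliser projects
  onto the whole next group, at every vertex by periodicity.\<close>

lemma lift_section:
  assumes "k n > 0" "g \<in> Grp k (Suc n)"
  shows "\<exists>h \<in> Grp k n. h \<in> level_prod (k n) (Grp k (Suc n)) \<and> section_at h (pos (k n) (Suc i)) = g"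
  using assms(2)[unfolded Grp_def[of k "Suc n"]]
proof (induction rule: gen.induct)
  let ?L = "level_prod (k n) (Grp k (Suc n))"
  note sub = is_subgroup_level_prod[OF is_subgroup_Grp]
  let ?P = "\<lambda>g. \<exists>h \<in> Grp k n. h \<in> ?L \<and> section_at h (pos (k n) (Suc i)) = g"
  have neq: "pos (k n) i \<noteq> pos (k n) (Suc i)" "pos (k n) (Suc i) \<noteq> pos (k n) (Suc (Suc i))"
    using one_less_power[of "2::nat" "k n"] assms(1) by (intro pos_neq; simp)+
  have S: "?P s" if "s \<in> {rot (k (Suc n)), dir k (Suc n)}" for s
  proof -
    have "section_at (coord k n i) (pos (k n) (Suc i)) = rot (k (Suc n))"
      "section_at (coord k n (Suc i)) (pos (k n) (Suc i)) = dir k (Suc n)"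
      using neq by (auto simp: section_at_coord)
    then show ?thesis
      using that coord_in_Grp[of k n, OF assms(1)] coord_in_level_prod[of k n] by auto
  qed
  have plus: "?P (x + y)" if "?P x" "?P y" for x y
  proof -
    obtain g h where "g \<in> Grp k n" "g \<in> ?L" "section_at g (pos (k n) (Suc i)) = x"
      "h \<in> Grp k n" "h \<in> ?L" "section_at h (pos (k n) (Suc i)) = y"
      using \<open>?P x\<close> \<open>?P y\<close> by blast
    then show ?thesis
      by (intro bexI[of _ "g + h"])
        (auto simp: section_at_level_prod_plus intro: is_subgroupD(2)[OF sub] is_subgroupD(2)[OF is_subgroup_Grp])
  qed
  have uminus: "?P (- x)" if P: "?P x" for x
  proof -
    obtain g where "g \<in> Grp k n" "g \<in> ?L" "section_at g (pos (k n) (Suc i)) = x"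
      using P by blast
    then show ?thesis
      by (intro bexI[of _ "- g"])
        (auto simp: section_at_level_prod_uminus intro: is_subgroupD(3)[OF sub] is_subgroupD(3)[OF is_subgroup_Grp])
  qed
  {
    case gen_zero
    show ?case
      using is_subgroupD(1)[OF is_subgroup_Grp] is_subgroupD(1)[OF sub] section_at_zero by metis
  next
    case (gen_add s x)
    show ?case
      by (rule plus[OF S[OF gen_add.hyps(1)] gen_add.IH])
  next
    case (gen_minus s x)
    show ?case
      by (rule plus[OF uminus[OF S[OF gen_minus.hyps(1)]] gen_minus.IH])
  }
qed

lemma is_subgroup_conj_vimage:
  assumes "is_subgroup N"
  shows "is_subgroup {x. g + x - g \<in> N}"
  unfolding is_subgroup_def mem_Collect_eq
proof (intro conjI ballI allI impI; (unfold mem_Collect_eq)?)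
  show "g + 0 - g \<in> N"
    using is_subgroupD(1)[OF assms] by simp
  fix x y assume "g + x - g \<in> N" "g + y - g \<in> N"
  moreover have "g + (x + y) - g = (g + x - g) + (g + y - g)" "g + - x - g = - (g + x - g)"
    by (simp_all only: group_word_simps)
  ultimately show "g + (x + y) - g \<in> N" "g + - x - g \<in> N"
    by (simp_all only: is_subgroupD(2,3)[OF assms])
qed

lemma conj_comm: "g + comm x y - g = comm (g + x - g) (g + y - g)"
  unfolding comm_def by (simp only: group_word_simps)

lemma conj_in_der:
  assumes "\<And>x. x \<in> A \<Longrightarrow> g + x - g \<in> A" "x \<in> der A"
  shows "g + x - g \<in> der A"
proof -
  have "der A \<subseteq> {x. g + x - g \<in> der A}"
    by (rule der_least[OF is_subgroup_conj_vimage[OF is_subgroup_der]])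
      (simp add: conj_comm comm_in_der assms(1))
  then show ?thesis
    using assms(2) by blast
qed

lemma conj_in_squares:
  assumes "\<And>x. x \<in> A \<Longrightarrow> g + x - g \<in> A" "x \<in> squares A"
  shows "g + x - g \<in> squares A"
proof -
  have "squares A \<subseteq> {x. g + x - g \<in> squares A}"
    unfolding squares_def[of A]
  proof (rule gen_least[OF is_subgroup_conj_vimage[OF is_subgroup_gen]])
    have "g + (x + x) - g \<in> gen {x + x |x. x \<in> A}" if "x \<in> A" for x
    proof -
      have "g + (x + x) - g = (g + x - g) + (g + x - g)"
        by (simp only: group_word_simps)
      then show ?thesis
        using assms(1)[OF that] by (auto intro!: gen_incl)
    qed
    then show "{x + x |x. x \<in> A} \<subseteq> {x. g + x - g \<in> gen {x + x |x. x \<in> A}}"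
      by blast
  qed
  then show ?thesis
    using assms(2) by blast
qed

section \<open>The derived series as products over levels, and transitivity\<close>

locale block_lengths =
  fixes k :: "nat \<Rightarrow> nat"
  assumes k_cases: "k n = 3 \<or> k n = 4"
begin

lemma k_pos: "0 < k n"
  using k_cases[of n] by auto

lemma pow_k_ge: "8 \<le> (2::nat) ^ k n"
  using k_cases[of n] by auto

text \<open>These are the \<open>c_i\<close>. Their sections at the vertices \<open>i\<close>,
  \<open>i + 1\<close>, \<open>i + 2\<close> are \<open>- b\<close>, \<open>- a + b\<close> and
  \<open>a\<close>, where \<open>a\<close> and \<open>b\<close> are the generators of the next
  block.\<close>

definition diff_coord :: "nat \<Rightarrow> nat \<Rightarrow> aut" where
  "diff_coord n i = - coord k n i + coord k n (Suc i)"

lemma diff_coord_in_der: "diff_coord n i \<in> der (Grp k n)"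
proof -
  have "diff_coord n i = comm (- coord k n i) (rot (k n))"
    unfolding diff_coord_def rot_coord_conj[of k n i, symmetric] comm_def
    by (simp only: group_word_simps)
  then show ?thesis
    using coord_in_Grp[of k, OF k_pos] is_subgroup_Grp rot_in_Grp
    by (auto intro!: comm_in_der is_subgroupD(3))
qed

lemma diff_coord_in_level_prod: "diff_coord n i \<in> level_prod (k n) (Grp k (Suc n))"
  using diff_coord_in_der der_Grp_subset[of k, OF k_pos] by blast

lemma section_at_diff_coord:
  assumes "length w = k n"
  shows "section_at (diff_coord n i) w = - section_at (coord k n i) w + section_at (coord k n (Suc i)) w"
  unfolding diff_coord_def
  using section_at_level_prod_plus[OF coord_in_level_prod[of k] assms]
    section_at_level_prod_uminus[OF coord_in_level_prod[of k] assms] by simp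

lemma comm_diff_coord:
  "comm (diff_coord n 0) (diff_coord n 2) =
     implant (pos (k n) 2) (comm (rot (k (Suc n))) (- dir k (Suc n)))" (is "?l = ?r")
proof (rule section_at_eqI[where n = "k n"])
  note L = is_subgroup_level_prod[OF is_subgroup_Grp]
  have "?l \<in> level_prod (k n) (Grp k (Suc n))"
    unfolding comm_def using diff_coord_in_level_prod by (intro is_subgroupD(2,4)[OF L])
  moreover have "?r \<in> level_prod (k n) (Grp k (Suc n))"
    unfolding comm_def
    by (intro implant_in_level_prod is_subgroupD[OF is_subgroup_Grp] rot_in_Grp dir_in_Grp length_pos)
  ultimately show "agree (k n) ?l ?r"
    by (meson agree_sym agree_trans level_prod_agree)
  fix w :: "bool list" assume w: "length w = k n"
  \<comment> \<open>The two supports are the vertices 0, 1, 2 and 2, 3, 4. Keeping these apart takes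
    a level with at least five vertices.\<close>
  have "distinct [pos (k n) 0, pos (k n) (Suc 0), pos (k n) 2, pos (k n) 3, pos (k n) 4]"
    by (simp; intro conjI pos_neq) (use pow_k_ge[of n] in simp_all)
  moreover have "section_at ?l w = comm (section_at (diff_coord n 0) w) (section_at (diff_coord n 2) w)"
    by (rule section_at_comm[OF diff_coord_in_level_prod diff_coord_in_level_prod is_subgroup_Grp w])
  ultimately show "section_at ?l w = section_at ?r w"
    using w by (auto simp: section_at_diff_coord section_at_coord section_at_implant comm_def numeral_eq_Suc)
qed

lemma conj_in_der_Grp: "g \<in> Grp k n \<Longrightarrow> x \<in> der (Grp k n) \<Longrightarrow> g + x - g \<in> der (Grp k n)"
  by (rule der_normal[OF is_subgroup_Grp])

text \<open>The elements whose copy at vertex 2 lies in the second derived subgroup form a group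
  \<open>M\<close>. It contains a commutator of the generators by \<open>comm_diff_coord\<close>,
  and it is normalised by the whole next group because sections can be lifted; hence it contains the
  derived subgroup. Powers of \<open>rot (k n)\<close> then reach the other vertices.\<close>

lemma implant_in_der_der:
  assumes x: "x \<in> der (Grp k (Suc n))" and w: "length w = k n"
  shows "implant w x \<in> der (der (Grp k n))"
proof -
  let ?N = "der (der (Grp k n))"
  let ?r = "rot (k (Suc n))" and ?b = "dir k (Suc n)"
  have norm: "g + x - g \<in> ?N" if "g \<in> Grp k n" "x \<in> ?N" for g x
    using conj_in_der[of "der (Grp k n)" g x] conj_in_der_Grp that by blast
  define M where "M = {x. implant (pos (k n) 2) x \<in> ?N}"
  have M: "is_subgroup M"
    unfolding M_def by (rule is_subgroup_implant_vimage[OF is_subgroup_der])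
  have normM: "g + x - g \<in> M" if g: "g \<in> Grp k (Suc n)" and x: "x \<in> M" for g x
  proof -
    obtain h where h: "h \<in> Grp k n" "h \<in> level_prod (k n) (Grp k (Suc n))"
      "section_at h (pos (k n) (Suc 1)) = g"
      using lift_section[of k, OF k_pos g] by blast
    have "h + implant (pos (k n) 2) x - h \<in> ?N"
      using x h(1) norm unfolding M_def by blast
    then show ?thesis
      using level_prodD(1)[OF h(2), of "pos (k n) 2"] h(3)
      by (simp add: implant_conj M_def numeral_2_eq_2)
  qed
  have rb: "comm ?r (- ?b) \<in> M"
    unfolding M_def using comm_diff_coord[of n] comm_in_der[OF diff_coord_in_der diff_coord_in_der]
    by (metis mem_Collect_eq)
  have br: "comm ?b ?r \<in> M"
  proof -
    \<comment> \<open>Conjugation by \<open>?b\<close> turns a commutator with \<open>- ?b\<close>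
      into one with \<open>?b\<close>.\<close>
    have "comm ?b ?r = ?b + comm ?r (- ?b) - ?b"
      unfolding comm_def by (simp only: group_word_simps)
    then show ?thesis
      using normM[OF dir_in_Grp rb] by simp
  qed
  have "der (Grp k (Suc n)) \<subseteq> M"
    unfolding Grp_def
  proof (rule der_gen_least[OF M])
    show "g + x - g \<in> M" if "g \<in> gen {?r, ?b}" "x \<in> M" for g x
      using normM that unfolding Grp_def by blast
    have "comm ?r ?b \<in> M"
      using is_subgroupD(3)[OF M br] comm_minus_commute[of ?r ?b] by simp
    moreover have "comm x x = 0" for x :: aut
      unfolding comm_def by (simp only: group_word_simps)
    ultimately show "comm s t \<in> M" if "s \<in> {?r, ?b}" "t \<in> {?r, ?b}" for s t
      using that br is_subgroupD(1)[OF M] by auto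
  qed
  then have base: "implant (pos (k n) 2) x \<in> ?N"
    using x unfolding M_def by blast
  have "implant (pos (k n) (i + 2)) x \<in> ?N" for i
  proof (induction i)
    case 0
    then show ?case using base by (simp only: add_0)
  next
    case (Suc i)
    then show ?case
      using norm[OF rot_in_Grp] rot_pos_conj[of "k n" "i + 2" x] by fastforce
  qed
  then show ?thesis
    using ex_pos_ge[OF w, of 2] by (metis le_add_diff_inverse2)
qed

lemma der_der_Grp: "der (der (Grp k n)) = level_prod (k n) (der (Grp k (Suc n)))"
proof
  show "der (der (Grp k n)) \<subseteq> level_prod (k n) (der (Grp k (Suc n)))"
    using der_mono[OF der_Grp_subset[of k, OF k_pos]] der_level_prod[OF is_subgroup_Grp] by blast
  show "level_prod (k n) (der (Grp k (Suc n))) \<subseteq> der (der (Grp k n))"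
    using implant_in_der_der by (intro level_prod_least[OF is_subgroup_der])
qed

lemma funpow_der_level_prod:
  "is_subgroup A \<Longrightarrow> (der ^^ m) (level_prod n A) = level_prod n ((der ^^ m) A)"
proof (induction m)
  case (Suc m)
  have "is_subgroup ((der ^^ m) A)"
    using Suc.prems is_subgroup_der by (cases m) auto
  then show ?case
    using Suc by (simp add: der_level_prod)
qed simp

text \<open>After the first derivation, each further one descends by exactly one block via
  \<open>der_der_Grp\<close>, since \<open>der\<close> commutes with products over levels.\<close>

lemma funpow_der_Grp:
  "(der ^^ Suc m) (Grp k n) = level_prod (depth k n m) (der (Grp k (n + m)))"
proof (induction m arbitrary: n)
  case (Suc m)
  have "(der ^^ Suc (Suc m)) (Grp k n) = (der ^^ m) (der (der (Grp k n)))"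
    by (simp add: funpow_Suc_right del: funpow.simps)
  also have "\<dots> = level_prod (k n) ((der ^^ m) (der (Grp k (Suc n))))"
    by (simp add: der_der_Grp funpow_der_level_prod is_subgroup_der)
  also have "(der ^^ m) (der (Grp k (Suc n))) = (der ^^ Suc m) (Grp k (Suc n))"
    by (simp add: funpow_Suc_right del: funpow.simps)
  also have "\<dots> = level_prod (depth k (Suc n) m) (der (Grp k (n + Suc m)))"
    using Suc[of "Suc n"] by simp
  finally show ?case
    by (simp add: level_prod_level_prod)
qed simp

lemma section_at_Grp_depth:
  "x \<in> Grp k n \<Longrightarrow> length w = depth k n m \<Longrightarrow> section_at x w \<in> Grp k (n + m)"
proof (induction m arbitrary: n x w)
  case (Suc m)
  have w: "w = take (k n) w @ drop (k n) w" "length (take (k n) w) = k n"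
    using Suc.prems(2) by auto
  have "section_at (section_at x (take (k n) w)) (drop (k n) w) \<in> Grp k (Suc n + m)"
    using Suc.prems section_at_Grp[of k, OF k_pos Suc.prems(1) w(2)] by (intro Suc.IH) auto
  then show ?case
    using section_at_append[of x "take (k n) w" "drop (k n) w"] w(1) by simp
qed simp

text \<open>Rotations bring both words to the form vertex 1 followed by a tail. The tails are
  matched by induction, using an element of the next group lifted to vertex 1.\<close>

lemma Grp_transitive:
  "length u = depth k n m \<Longrightarrow> length v = depth k n m \<Longrightarrow> \<exists>g \<in> Grp k n. act g u = v"
proof (induction m arbitrary: n u v)
  case 0
  then show ?case
    using is_subgroupD(1)[OF is_subgroup_Grp] by (intro bexI[of _ 0]) auto
next
  case (Suc m)
  have to1: "\<exists>g \<in> Grp k n. \<exists>u'. length u' = depth k (Suc n) m \<and> act g u = pos (k n) 1 @ u'"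
    if "length u = depth k n (Suc m)" for u
  proof -
    have rotI: "\<exists>g \<in> Grp k n. act g (pos (k n) i) = pos (k n) (i + j)" for i j
    proof (induction j)
      case 0
      then show ?case
        using is_subgroupD(1)[OF is_subgroup_Grp] by (intro bexI[of _ 0]) auto
    next
      case (Suc j)
      then obtain g where "g \<in> Grp k n" "act g (pos (k n) i) = pos (k n) (i + j)"
        by blast
      then show ?case
        using is_subgroupD(2)[OF is_subgroup_Grp rot_in_Grp]
        by (intro bexI[of _ "rot (k n) + g"]) (auto simp: act_rot_pos)
    qed
    have l: "length (take (k n) u) = k n"
      using that by simp
    obtain i where i: "take (k n) u = pos (k n) i"
      using ex_pos[OF l] by blast
    \<comment> \<open>Rotation by \<open>i - 1\<close>, with a full turn added since
      \<open>i\<close> may be 0.\<close>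
    obtain g where g: "g \<in> Grp k n" "act g (pos (k n) 1) = pos (k n) (1 + (i + 2 ^ k n - 1))"
      using rotI by blast
    moreover have "pos (k n) (1 + (i + 2 ^ k n - 1)) = pos (k n) i"
      by (simp add: pos_eq_iff)
    ultimately have "act (- g) (take (k n) u) = pos (k n) 1"
      using i by (metis act_uminus_act(1))
    then have "act (- g) u = pos (k n) 1 @ act (section_at (- g) (take (k n) u)) (drop (k n) u)"
      using act_append[of "- g" "take (k n) u" "drop (k n) u"] by simp
    then show ?thesis
      using is_subgroupD(3)[OF is_subgroup_Grp g(1)] that by (intro bexI[of _ "- g"] exI conjI) auto
  qed
  obtain g u' where g: "g \<in> Grp k n" "length u' = depth k (Suc n) m" "act g u = pos (k n) 1 @ u'"
    using to1[OF Suc.prems(1)] by blast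
  obtain h v' where h: "h \<in> Grp k n" "length v' = depth k (Suc n) m" "act h v = pos (k n) 1 @ v'"
    using to1[OF Suc.prems(2)] by blast
  obtain f where f: "f \<in> Grp k (Suc n)" "act f u' = v'"
    using Suc.IH[OF g(2) h(2)] by blast
  obtain e where e: "e \<in> Grp k n" "e \<in> level_prod (k n) (Grp k (Suc n))"
    "section_at e (pos (k n) (Suc 0)) = f"
    using lift_section[of k, OF k_pos f(1)] by blast
  have "act (e + g) u = act h v"
    using g(3) h(3) f(2) e(3) level_prodD(1)[OF e(2), of "pos (k n) 1"]
    by (simp add: act_append)
  then have "act (- h + (e + g)) u = v"
    by (simp only: act_plus[of "- h"] act_uminus_act)
  moreover have "- h + (e + g) \<in> Grp k n"
    using is_subgroup_Grp g(1) h(1) e(1) by (intro is_subgroupD(2,3))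
  ultimately show ?case
    by blast
qed

lemma depth_ge: "m \<le> depth k n m"
proof (induction m arbitrary: n)
  case (Suc m)
  then show ?case
    using Suc[of "Suc n"] k_pos[of n] by (simp add: Suc_le_eq add_strict_increasing)
qed simp

end

section \<open>Generators of finite order and finite index of the derived subgroups\<close>

lemma gen_singleton_subset:
  assumes U: "finite U" "0 \<in> U" and step: "(+) x ` U \<subseteq> U"
  shows "gen {x} \<subseteq> U"
proof
  fix y assume "y \<in> gen {x}"
  \<comment> \<open>Translation is injective, so it permutes the finite set \<open>U\<close>; this
    covers the inverse steps of \<open>gen\<close>.\<close>
  have eq: "(+) x ` U = U"
    using U(1) step by (simp add: card_image card_subset_eq)
  from \<open>y \<in> gen {x}\<close> show "y \<in> U"
  proof (induction rule: gen.induct)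
    case (gen_minus s y)
    then obtain u where "u \<in> U" "y = x + u"
      using eq by blast
    then show ?case
      using gen_minus by simp
  qed (use U step in auto)
qed

definition multiple :: "nat \<Rightarrow> 'a::group_add \<Rightarrow> 'a" where
  "multiple m x = ((+) x ^^ m) 0"

lemma multiple_simps [simp]: "multiple 0 x = 0" "multiple (Suc m) x = x + multiple m x"
  by (simp_all add: multiple_def)

lemma multiple_plus: "multiple (m + n) x = multiple m x + multiple n x"
  by (induction m) (auto simp: add.assoc)

lemma multiple_double: "multiple (2 * m) x = multiple m (x + x)"
  by (induction m) (auto simp: add.assoc)

lemma multiple_commute:
  assumes "x + y = y + x"
  shows "multiple m x + y = y + multiple m (x :: 'a :: group_add)"
proof (induction m)
  case (Suc m)
  have "x + multiple m x + y = x + (y + multiple m x)"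
    using Suc by (simp add: add.assoc)
  also have "\<dots> = y + (x + multiple m x)"
    by (simp only: assms flip: add.assoc)
  finally show ?case
    by simp
qed simp

lemma multiple_add_commuting:
  assumes "x + y = y + x"
  shows "multiple m (x + y) = multiple m x + multiple m (y :: 'a :: group_add)"
proof (induction m)
  case (Suc m)
  have "x + y + (multiple m x + multiple m y) = x + (y + multiple m x) + multiple m y"
    by (simp add: add.assoc)
  also have "\<dots> = x + (multiple m x + y) + multiple m y"
    using multiple_commute[OF assms] by simp
  finally show ?case
    using Suc by (simp add: add.assoc)
qed simp

lemma finite_gen_singleton:
  assumes "multiple (Suc m) x = 0"
  shows "finite (gen {x})"
proof -
  have "gen {x} \<subseteq> (\<lambda>i. multiple i x) ` {..m}"
  proof (rule gen_singleton_subset)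
    show "0 \<in> (\<lambda>i. multiple i x) ` {..m}"
      by (rule image_eqI[of _ _ 0]) auto
    show "(+) x ` (\<lambda>i. multiple i x) ` {..m} \<subseteq> (\<lambda>i. multiple i x) ` {..m}"
    proof
      fix y assume "y \<in> (+) x ` (\<lambda>i. multiple i x) ` {..m}"
      then obtain i where i: "i \<le> m" "y = multiple (Suc i) x"
        by auto
      show "y \<in> (\<lambda>i. multiple i x) ` {..m}"
      proof (cases "i = m")
        case True
        then have "y = multiple 0 x"
          using i(2) assms by simp
        then show ?thesis by blast
      next
        case False
        then have "Suc i \<in> {..m}"
          using i(1) by simp
        then show ?thesis
          unfolding i(2) by (rule imageI)
      qed
    qed
  qed simp
  then show ?thesis
    by (rule finite_subset) simp
qed

text \<open>Modulo commutators every word can be sorted into \<open>p + q\<close> with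
  \<open>p\<close> from \<open>gen {x}\<close> and \<open>q\<close> from \<open>gen {y}\<close>,
  which leaves finitely many representatives.\<close>

lemma finite_index_der_gen:
  fixes x y :: "'a :: group_add"
  assumes "finite (gen {x})" "finite (gen {y})"
  shows "finite_index (gen {x, y}) (der (gen {x, y}))"
proof -
  let ?A = "gen {x, y}"
  have sub: "gen {x} \<subseteq> ?A" "gen {y} \<subseteq> ?A"
    by (rule gen_least[OF is_subgroup_gen]; auto intro: gen_incl)+
  have "\<exists>f\<in>(\<lambda>(p, q). p + q) ` (gen {x} \<times> gen {y}). - f + g \<in> der ?A" if "g \<in> ?A" for g
  proof -
    have "\<exists>p\<in>gen {x}. \<exists>q\<in>gen {y}. - (p + q) + g \<in> der ?A"
      using that
    proof (induction rule: gen.induct)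
      case gen_zero
      show ?case
        by (intro bexI[of _ 0]) (auto simp: gen.gen_zero is_subgroupD(1)[OF is_subgroup_der])
    next
      have step: "\<exists>p\<in>gen {x}. \<exists>q\<in>gen {y}. - (p + q) + (s + g) \<in> der ?A"
        if s: "s \<in> gen {x} \<or> s \<in> gen {y}"
          and g: "\<exists>p\<in>gen {x}. \<exists>q\<in>gen {y}. - (p + q) + g \<in> der ?A" for s g
      proof -
        obtain p q where pq: "p \<in> gen {x}" "q \<in> gen {y}" "- (p + q) + g \<in> der ?A"
          using g by blast
        show ?thesis
        proof (cases "s \<in> gen {x}")
          case True
          have "- (s + p + q) + (s + g) = - (p + q) + g"
            by (simp only: group_word_simps)
          then show ?thesis
            using pq True gen_plus by metis
        next
          case False
          then have s: "s \<in> gen {y}"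
            using s by blast
          have inA: "p \<in> ?A" "q \<in> ?A" "s \<in> ?A"
            using sub pq s by auto
          have "- q + comm (- s) (- p) - - q \<in> der ?A"
            using inA by (intro der_normal[OF is_subgroup_gen] comm_in_der) (auto intro: gen_uminus)
          moreover have "- (p + (s + q)) + (s + g) = (- q + comm (- s) (- p) - - q) + (- (p + q) + g)"
            unfolding comm_def by (simp only: group_word_simps)
          ultimately have "- (p + (s + q)) + (s + g) \<in> der ?A"
            using pq(3) is_subgroupD(2)[OF is_subgroup_der] by simp
          then show ?thesis
            using pq(1) gen_plus[OF s pq(2)] by blast
        qed
      qed
      {
        case (gen_add s g)
        then show ?case
          by (intro step) (auto intro: gen_incl)
      next
        case (gen_minus s g)
        then show ?case
          by (intro step) (auto intro: gen_incl gen_uminus)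
      }
    qed
    then show ?thesis
      by force
  qed
  then show ?thesis
    unfolding finite_index_def using assms
    by (intro exI[of _ "(\<lambda>(p, q). p + q) ` (gen {x} \<times> gen {y})"]) simp
qed

lemma multiple_implant: "multiple m (implant w x) = implant w (multiple m x)"
  by (induction m) (simp_all add: implant_plus)

lemma multiple_rot: "multiple (2 ^ k) (rot k) = 0"
proof (induction k)
  case (Suc k)
  have "rot (Suc k) + rot (Suc k) = Node False (rot k) (rot k)"
    by (rule aut.expand) simp
  moreover have "multiple m (Node False g g) = Node False (multiple m g) (multiple m g)" for m g
    by (induction m) simp_all
  ultimately show ?case
    using Suc by (simp add: multiple_double)
qed simp

lemma agree_implant_deeper: "agree n g h \<Longrightarrow> agree (length w + n) (implant w g) (implant w h)"
  by (induction w) (auto simp: agree_Suc)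

context block_lengths
begin

lemma multiple_16_rot: "multiple 16 (rot (k n)) = 0"
proof -
  consider "k n = 3" | "k n = 4"
    using k_cases by blast
  then show ?thesis
  proof cases
    case 1
    then have "multiple 8 (rot (k n)) = 0"
      using multiple_rot[of 3] by simp
    then show ?thesis
      using multiple_plus[of 8 8 "rot (k n)"] by simp
  next
    case 2
    then show ?thesis
      using multiple_rot[of 4] by simp
  qed
qed

lemma implants_commute:
  assumes "length u = length v" "u \<noteq> v"
  shows "implant u x + implant v y = implant v y + implant u x"
  by (rule section_at_eqI[where n = "length u"])
    (use assms in \<open>auto simp: agree_def section_at_plus section_at_implant\<close>)

text \<open>The two components of \<open>dir k n\<close> commute and 16 kills \<open>rot\<close>,
  being a multiple of \<open>2 ^ 3\<close> and \<open>2 ^ 4\<close>. So the sixteenfold of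
  \<open>dir k n\<close> is that of \<open>dir k (Suc n)\<close> placed one block lower, and nothing
  remains on any finite level.\<close>

lemma multiple_16_dir: "multiple 16 (dir k n) = 0"
proof -
  have "agree N (multiple 16 (dir k n)) 0" for N
  proof (induction N arbitrary: n)
    case (Suc N)
    have neq: "pos (k n) 0 \<noteq> pos (k n) (Suc 0)"
      by (rule pos_neq) (use pow_k_ge[of n] in simp_all)
    have "multiple 16 (dir k n) = implant (pos (k n) 0) (multiple 16 (dir k (Suc n)))"
      unfolding dir_eq[of k n, OF k_pos] coord_def
      by (subst multiple_add_commuting) (simp_all only: implants_commute[OF _ neq] length_pos
          multiple_implant multiple_16_rot implant_zero add_0_right)
    moreover have "agree (length (pos (k n) 0) + N)
        (implant (pos (k n) 0) (multiple 16 (dir k (Suc n)))) (implant (pos (k n) 0) 0)"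
      by (rule agree_implant_deeper[OF Suc])
    ultimately show ?case
      using k_pos[of n] by (auto elim!: agree_mono)
  qed simp
  then show ?thesis
    by (rule agree_eqI)
qed

lemma finite_index_Grp_der: "finite_index (Grp k n) (der (Grp k n))"
  unfolding Grp_def using multiple_16_rot multiple_16_dir
  by (intro finite_index_der_gen finite_gen_singleton[of 15]) simp_all

text \<open>Past the first step, consecutive derived subgroups compare, at each vertex of a level,
  \<open>der (Grp k j)\<close> with the product of the \<open>der (Grp k (Suc j))\<close>. The
  former lies in the product of the \<open>Grp k (Suc j)\<close>, where the latter has finite index
  because abelianisations are finite.\<close>

lemma finite_index_Grp_funpow_der: "finite_index (Grp k n) ((der ^^ m) (Grp k n))"
proof (induction m)
  case 0
  then show ?case
    using is_subgroupD(1)[OF is_subgroup_Grp] by (auto intro: finite_index_refl)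
next
  case (Suc m)
  show ?case
  proof (cases m)
    case 0
    then show ?thesis using finite_index_Grp_der by simp
  next
    case (Suc m')
    have "(der ^^ Suc (Suc m')) (Grp k n) = level_prod (depth k n m') (der (der (Grp k (n + m'))))"
      using funpow_der_Grp[of m' n] by (simp add: der_level_prod is_subgroup_der)
    also have "\<dots> = level_prod (depth k n m') (level_prod (k (n + m')) (der (Grp k (Suc (n + m')))))"
      by (simp only: der_der_Grp)
    finally have *: "(der ^^ Suc (Suc m')) (Grp k n) =
      level_prod (depth k n m') (level_prod (k (n + m')) (der (Grp k (Suc (n + m')))))" .
    have "der (Grp k (n + m')) \<subseteq> level_prod (k (n + m')) (Grp k (Suc (n + m')))"
      using der_Grp_subset[of k, OF k_pos] .
    then have "finite_index (der (Grp k (n + m'))) (level_prod (k (n + m')) (der (Grp k (Suc (n + m')))))"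
      by (rule finite_index_mono[OF finite_index_level_prod[OF finite_index_Grp_der] _ order_refl])
    then have "finite_index ((der ^^ m) (Grp k n)) ((der ^^ Suc m) (Grp k n))"
      unfolding Suc * funpow_der_Grp[of m' n] by (rule finite_index_level_prod)
    then show ?thesis
      by (rule finite_index_trans[OF Suc.IH])
  qed
qed

subsection \<open>Normal subgroups\<close>

lemma funpow_der_subset: "(der ^^ m) (Grp k n) \<subseteq> Grp k n"
proof (induction m)
  case (Suc m)
  have "is_subgroup ((der ^^ m) (Grp k n))"
    using is_subgroup_der is_subgroup_Grp by (cases m) auto
  then show ?case
    using Suc der_subset by fastforce
qed simp

lemma implant_der_in_Grp:
  assumes "length w = depth k 0 m" "x \<in> der (Grp k m)"
  shows "implant w x \<in> Grp k 0"
proof -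
  have "implant w x \<in> level_prod (depth k 0 m) (der (Grp k m))"
    using assms is_subgroupD(1)[OF is_subgroup_der] by (intro implant_in_level_prod)
  then show ?thesis
    using funpow_der_Grp[of m 0] funpow_der_subset[of "Suc m" 0] by auto
qed

text \<open>If \<open>g\<close> moves \<open>u\<close>, then \<open>[- [g, x'], y'] = [x', y']\<close> for \<open>x', y'\<close> supported below \<open>u\<close>, since
  the conjugate of \<open>x'\<close> by \<open>g\<close> is supported below another vertex.\<close>

lemma normal_subgroup_contains:
  assumes N: "is_subgroup N" and norm: "\<And>h x. h \<in> Grp k 0 \<Longrightarrow> x \<in> N \<Longrightarrow> h + x - h \<in> N"
    and g: "g \<in> N" "length u = depth k 0 m" "act g u \<noteq> u"
  shows "(der ^^ Suc (Suc m)) (Grp k 0) \<subseteq> N"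
proof -
  let ?K = "der (Grp k m)"
  have commN: "comm x y \<in> N" if "x \<in> N" "y \<in> Grp k 0" for x y
  proof -
    have "comm x y = x + (y + - x - y)"
      unfolding comm_def by (simp only: group_word_simps)
    then show ?thesis
      using is_subgroupD(2)[OF N that(1) norm[OF that(2) is_subgroupD(3)[OF N that(1)]]] by (simp only:)
  qed
  have at_u: "implant u (comm x y) \<in> N" if x: "x \<in> ?K" and y: "y \<in> ?K" for x y
  proof -
    have X: "implant u x \<in> Grp k 0" and Y: "implant u y \<in> Grp k 0"
      using implant_der_in_Grp g(2) x y by auto
    have "- comm g (implant u x) \<in> N"
      using is_subgroupD(3)[OF N] commN[OF g(1) X] by blast
    then have "comm (- comm g (implant u x)) (implant u y) \<in> N"
      using commN Y by blast
    moreover have "comm (- comm g (implant u x)) (implant u y) = implant u (comm x y)"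
    proof -
      have c: "comm g (implant u x) =
          implant (act g u) (section_at g u + x - section_at g u) - implant u x"
        by (simp only: comm_def implant_conj)
      define z where "z = section_at g u + x - section_at g u"
      have com: "implant u a + implant (act g u) b = implant (act g u) b + implant u a" for a b
        using g(3) by (intro implants_commute) auto
      have "comm (- (implant (act g u) z - implant u x)) (implant u y) = comm (implant u x) (implant u y)"
      proof -
        have "comm (- (b - a)) d = comm a d" if ab: "d + b = b + d" for a b d :: aut
        proof -
          have "- b + d + b = d"
            using ab by (metis add.assoc minus_add_cancel)
          moreover have "comm (- (b - a)) d = a + (- b + d + b) - a - d"
            unfolding comm_def by (simp only: group_word_simps)
          ultimately show ?thesis
            unfolding comm_def by simp
        qed
        then show ?thesis
          using com by blast
      qed
      then show ?thesis
        by (simp only: c z_def comm_implant)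
    qed
    ultimately show ?thesis
      by simp
  qed
  \<comment> \<open>Transitivity moves the result from \<open>u\<close> to \<open>w\<close>. Both
    elements are first conjugated by \<open>- f\<close>, because transport by \<open>h\<close> will
    conjugate them by its section \<open>f\<close>.\<close>
  have at_w: "implant w (comm x y) \<in> N" if w: "length w = depth k 0 m" and xy: "x \<in> ?K" "y \<in> ?K" for w x y
  proof -
    obtain h where h: "h \<in> Grp k 0" "act h u = w"
      using Grp_transitive[OF g(2) w] by blast
    define f where "f = section_at h u"
    have f: "f \<in> Grp k m"
      using section_at_Grp_depth[OF h(1) g(2)] by (simp add: f_def)
    have "- f + x - - f \<in> ?K" "- f + y - - f \<in> ?K"
      using conj_in_der_Grp[OF is_subgroupD(3)[OF is_subgroup_Grp f]] xy by blast+
    then have "h + implant u (comm (- f + x - - f) (- f + y - - f)) - h \<in> N"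
      by (intro norm h(1) at_u)
    moreover have "f + comm (- f + x - - f) (- f + y - - f) - f = comm x y"
      unfolding comm_def by (simp only: group_word_simps)
    ultimately show ?thesis
      by (simp only: implant_conj h(2) f_def[symmetric])
  qed
  have "(der ^^ Suc (Suc m)) (Grp k 0) = level_prod (depth k 0 m) (der ?K)"
    using funpow_der_Grp[of m 0] by (simp add: der_level_prod is_subgroup_der)
  also have "\<dots> \<subseteq> N"
  proof (rule level_prod_least[OF N])
    fix w :: "bool list" and x assume w: "length w = depth k 0 m" and x: "x \<in> der ?K"
    have "der ?K \<subseteq> {x. implant w x \<in> N}"
      using at_w[OF w] by (intro der_least is_subgroup_implant_vimage N) simp
    then show "implant w x \<in> N"
      using x by blast
  qed
  finally show ?thesis .
qed

text \<open>A nonzero \<open>g\<close> moves some word, hence some vertex of a level where a block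
  begins. So \<open>N\<close> contains a derived subgroup of the dense group and, being closed, also
  its closure.\<close>

lemma finite_index_normal_subgroup:
  assumes N: "is_subgroup N" "cl N = N" "g \<in> N" "g \<noteq> 0"
    and norm: "\<And>h x. h \<in> Grp k 0 \<Longrightarrow> x \<in> N \<Longrightarrow> h + x - h \<in> N"
  shows "finite_index (cl (Grp k 0)) N"
proof -
  obtain w where w: "act g w \<noteq> act 0 w"
    using act_eqI[of g 0] N(4) by blast
  let ?d = "depth k 0 (length w)"
  obtain u where u: "length u = ?d" "act g u \<noteq> u"
  proof -
    have "\<not> agree ?d g 0"
      using agree_short[of ?d g 0 w] depth_ge[of "length w" 0] w by auto
    then show ?thesis
      using that by (auto simp: agree_def)
  qed
  have "(der ^^ Suc (Suc (length w))) (Grp k 0) \<subseteq> N"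
    by (rule normal_subgroup_contains[OF N(1) norm N(3) u])
  then have "cl ((der ^^ Suc (Suc (length w))) (Grp k 0)) \<subseteq> N"
    using N(2) by (rule cl_least)
  then show ?thesis
    by (rule finite_index_mono[OF finite_index_cl[OF finite_index_Grp_funpow_der] order_refl])
qed

text \<open>\<open>R\<close> will be the rigid stabiliser of level \<open>m\<close>. Block
  \<open>m\<close> begins at level \<open>m\<close> or deeper, so each factor of the closed derived
  subgroup number \<open>m + 1\<close> lives below a vertex of level \<open>m\<close> and is caught
  by \<open>R\<close>.\<close>

lemma finite_index_rigid:
  assumes R: "is_subgroup R"
    and *: "\<And>u x. length u = m \<Longrightarrow> implant u x \<in> cl (Grp k 0) \<Longrightarrow> implant u x \<in> R"
  shows "finite_index (cl (Grp k 0)) R"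
proof -
  have eq: "cl ((der ^^ Suc m) (Grp k 0)) = level_prod (depth k 0 m) (cl (der (Grp k m)))"
    using funpow_der_Grp[of m 0] by (simp add: cl_level_prod)
  have "level_prod (depth k 0 m) (cl (der (Grp k m))) \<subseteq> R"
  proof (rule level_prod_least[OF R])
    fix w :: "bool list" and x
    assume w: "length w = depth k 0 m" and x: "x \<in> cl (der (Grp k m))"
    have split: "implant (u @ v) x = implant u (implant v x)" for u v x
      by (induction u) simp_all
    have "implant w x \<in> level_prod (depth k 0 m) (cl (der (Grp k m)))"
      using w x is_subgroupD(1)[OF is_subgroup_cl[OF is_subgroup_der]] by (intro implant_in_level_prod)
    then have "implant w x \<in> cl (Grp k 0)"
      using eq cl_mono[OF funpow_der_subset[of "Suc m" 0]] by blast
    then show "implant w x \<in> R"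
      using *[of "take m w" "implant (drop m w) x"] split[of "take m w" "drop m w" x]
        w depth_ge[of m 0] by simp
  qed
  then show ?thesis
    unfolding eq[symmetric]
    by (rule finite_index_mono[OF finite_index_cl[OF finite_index_Grp_funpow_der] order_refl])
qed

end

section \<open>The derived subgroup of one block modulo squares\<close>

lemma conj_normal_gen:
  assumes X: "\<And>s x. s \<in> S \<Longrightarrow> x \<in> X \<Longrightarrow> s + x - s \<in> gen X \<and> - s + x + s \<in> gen X"
    and g: "g \<in> gen S" and x: "x \<in> gen X"
  shows "g + x - g \<in> gen X"
  using g x
proof (induction arbitrary: x rule: gen.induct)
  case (gen_add s g)
  have "gen X \<subseteq> {x. s + x - s \<in> gen X}"
    using X[OF gen_add.hyps(1)] by (intro gen_least is_subgroup_conj_vimage is_subgroup_gen) auto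
  then have "s + (g + x - g) - s \<in> gen X"
    using gen_add.IH[OF gen_add.prems] by blast
  moreover have "s + (g + x - g) - s = s + g + x - (s + g)"
    by (simp only: group_word_simps)
  ultimately show ?case
    by (simp only:)
next
  case (gen_minus s g)
  have "gen X \<subseteq> {x. - s + x - - s \<in> gen X}"
    using X[OF gen_minus.hyps(1)] by (intro gen_least is_subgroup_conj_vimage is_subgroup_gen) auto
  then have "- s + (g + x - g) - - s \<in> gen X"
    using gen_minus.IH[OF gen_minus.prems] by blast
  moreover have "- s + (g + x - g) - - s = - s + g + x - (- s + g)"
    by (simp only: group_word_simps)
  ultimately show ?case
    by (simp only:)
qed simp

context block_lengths
begin

definition tower_base :: "nat \<Rightarrow> aut set" where
  "tower_base n = cl (squares (der (Grp k n)))"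

text \<open>Adjoining \<open>c_0, c_1, \<dots>\<close> one by one to the squares doubles the group each time, and the last
  step reaches the whole derived subgroup.\<close>

primrec tower :: "nat \<Rightarrow> nat \<Rightarrow> aut set" where
  "tower n 0 = tower_base n"
| "tower n (Suc j) = tower n j \<union> (+) (diff_coord n j) ` tower n j"

lemma is_subgroup_cl_der_Grp: "is_subgroup (cl (der (Grp k n)))"
  by (intro is_subgroup_cl is_subgroup_der)

lemma is_subgroup_tower_base: "is_subgroup (tower_base n)"
  unfolding tower_base_def by (intro is_subgroup_cl is_subgroup_squares)

lemma double_in_tower_base: "x \<in> cl (der (Grp k n)) \<Longrightarrow> x + x \<in> tower_base n"
  unfolding tower_base_def by (rule double_in_cl_squares)

lemma cl_tower: "cl (tower n j) = tower n j"
  by (induction j) (auto simp: tower_base_def cl_Un cl_translate)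

lemma tower_invariants:
  "is_subgroup (tower n j) \<and> tower_base n \<subseteq> tower n j \<and> tower n j \<subseteq> cl (der (Grp k n))"
proof (induction j)
  case 0
  have "tower_base n \<subseteq> cl (der (Grp k n))"
    unfolding tower_base_def by (intro cl_mono squares_subset is_subgroup_der)
  then show ?case
    using is_subgroup_tower_base by simp
next
  case (Suc j)
  have c: "diff_coord n j \<in> cl (der (Grp k n))"
    using diff_coord_in_der cl_incl by blast
  have "is_subgroup (tower n j \<union> (+) (diff_coord n j) ` tower n j)"
    using Suc by (intro adjoin_element(1)[OF is_subgroup_cl_der_Grp[of n] _ c
          is_subgroup_tower_base[of n] _ double_in_tower_base]) auto
  then have "is_subgroup (tower n (Suc j))"
    by simp
  moreover have "(+) (diff_coord n j) ` tower n j \<subseteq> cl (der (Grp k n))"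
    using Suc is_subgroupD(2)[OF is_subgroup_cl_der_Grp c] by auto
  ultimately show ?case
    using Suc by auto
qed

text \<open>The kernel of a homomorphism from the level stabiliser to the group of order 2: the root
  swap of the section at one vertex. Squares vanish under all of these, so they are coordinates in
  which the \<open>c_j\<close> can be tested for independence.\<close>

definition unswapped :: "nat \<Rightarrow> nat \<Rightarrow> aut set" where
  "unswapped n i = {x \<in> level_prod (k n) UNIV. \<not> swap (section_at x (pos (k n) i))}"

lemma is_subgroup_unswapped: "is_subgroup (unswapped n i)"
proof -
  have L: "is_subgroup (level_prod (k n) UNIV)"
    by (intro is_subgroup_level_prod) (simp add: is_subgroup_def)
  have uminus: "swap (- g) = swap g" for g :: aut
    by simp
  show ?thesis
    unfolding is_subgroup_def unswapped_def
    using is_subgroupD[OF L]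
    by (auto simp: section_at_level_prod_plus section_at_level_prod_uminus)
qed

lemma cl_unswapped: "cl (unswapped n i) \<subseteq> unswapped n i"
proof
  fix x assume x: "x \<in> cl (unswapped n i)"
  obtain s where s: "s \<in> unswapped n i" "agree (k n + 1) x s"
    using x by (rule clE)
  have "agree (k n) x s"
    using s(2) by (rule agree_mono) simp
  then have "x \<in> level_prod (k n) UNIV"
    using s(1) by (simp add: unswapped_def level_prod_def agree_def)
  moreover have "agree 1 (section_at x (pos (k n) i)) (section_at s (pos (k n) i))"
    using s(2) by (intro agree_section_at) simp
  ultimately show "x \<in> unswapped n i"
    using s(1) by (simp add: unswapped_def agree_Suc)
qed

lemma tower_base_unswapped: "tower_base n \<subseteq> unswapped n i"
proof -
  have "x + x \<in> unswapped n i" if "x \<in> der (Grp k n)" for x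
  proof -
    have "x \<in> level_prod (k n) UNIV"
      using that der_Grp_subset[of k n, OF k_pos] level_prod_mono[of _ UNIV] by blast
    moreover from this have "x + x \<in> level_prod (k n) UNIV"
      by (intro is_subgroupD(2) is_subgroup_level_prod) (simp add: is_subgroup_def)
    ultimately show ?thesis
      by (simp add: unswapped_def section_at_level_prod_plus)
  qed
  then have "squares (der (Grp k n)) \<subseteq> unswapped n i"
    unfolding squares_def by (intro gen_least is_subgroup_unswapped) auto
  then show ?thesis
    unfolding tower_base_def using cl_mono cl_unswapped by blast
qed

lemma swap_rot: "swap (rot (k n))"
  using k_pos[of n] by (cases "k n") auto

lemma swap_dir: "\<not> swap (dir k n)"
  by (simp add: dir_def)

lemma diff_coord_unswapped:
  assumes "j + 3 \<le> i" "i \<le> 2 ^ k n"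
  shows "diff_coord n j \<in> unswapped n i"
proof -
  have "diff_coord n j \<in> level_prod (k n) UNIV"
    using diff_coord_in_level_prod[of n j] level_prod_mono[of _ UNIV] by blast
  moreover have "pos (k n) (Suc j) \<noteq> pos (k n) i" "pos (k n) (Suc (Suc j)) \<noteq> pos (k n) i"
    using assms by (intro pos_neq; simp)+
  ultimately show ?thesis
    using swap_dir[of "Suc n"]
    by (auto simp: unswapped_def section_at_diff_coord section_at_coord)
qed

lemma diff_coord_swapped:
  assumes "j + 2 \<le> 2 ^ k n"
  shows "diff_coord n j \<notin> unswapped n (j + 2)"
proof -
  have "pos (k n) j \<noteq> pos (k n) (Suc (Suc j))" "pos (k n) (Suc j) \<noteq> pos (k n) (Suc (Suc j))"
    using pow_k_ge[of n] by (intro pos_neq; simp)+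
  then show ?thesis
    using swap_rot[of "Suc n"]
    by (auto simp: unswapped_def section_at_diff_coord section_at_coord)
qed

text \<open>A triangular pattern: \<open>c_j\<close> swaps exactly below the vertices
  \<open>j + 1\<close> and \<open>j + 2\<close>. So \<open>tower n j\<close>, built from
  \<open>c_0\<close> to \<open>c_(j-1)\<close>, never swaps below vertex \<open>j + 2\<close>, while
  \<open>c_j\<close> does. The bound on \<open>i\<close> includes \<open>2 ^ k n\<close>, which is
  vertex 0 again and detects the last basis element.\<close>

lemma tower_unswapped: "j + 2 \<le> i \<Longrightarrow> i \<le> 2 ^ k n \<Longrightarrow> tower n j \<subseteq> unswapped n i"
proof (induction j)
  case 0
  then show ?case using tower_base_unswapped by simp
next
  case (Suc j)
  then show ?case
    using diff_coord_unswapped[of j i n] is_subgroupD(2)[OF is_subgroup_unswapped] by auto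
qed

lemma has_index_tower:
  "j < 2 ^ k n \<Longrightarrow> has_index (tower n j) (tower_base n) (2 ^ j)"
proof (induction j)
  case 0
  then show ?case
    using has_index_refl[OF is_subgroup_tower_base] by simp
next
  case (Suc j)
  have "diff_coord n j \<notin> tower n j"
    using tower_unswapped[of j "j + 2" n] diff_coord_swapped[of j n] Suc.prems by auto
  moreover have "diff_coord n j \<in> cl (der (Grp k n))"
    using diff_coord_in_der cl_incl by blast
  ultimately have "has_index (tower n j \<union> (+) (diff_coord n j) ` tower n j) (tower_base n) (2 * 2 ^ j)"
    using tower_invariants[of n j] Suc
    by (intro adjoin_element(2)[OF is_subgroup_cl_der_Grp _ _ is_subgroup_tower_base _ double_in_tower_base]) auto
  then show ?case
    by simp
qed

text \<open>Sums of consecutive \<open>c_i\<close> telescope to \<open>- b_0 + b_j\<close>. Once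
  around the cycle they cancel, so the last \<open>c_i\<close> is the negative of the sum of the
  others.\<close>

lemma diff_coord_in_tower: "diff_coord n i \<in> tower n (2 ^ k n - 1)"
proof -
  \<comment> \<open>This \<open>d\<close> is the last index of the cycle, one less than the number
    of vertices.\<close>
  define d where "d = (2::nat) ^ k n - 1"
  have d: "2 ^ k n = Suc d"
    by (simp add: d_def)
  note T = conjunct1[OF tower_invariants[of n d]]
  have mono: "tower n j \<subseteq> tower n (j + l)" for j l
    by (induction l) auto
  have small: "diff_coord n j \<in> tower n d" if "j < d" for j
  proof -
    have "diff_coord n j + 0 \<in> tower n (Suc j)"
      using is_subgroupD(1)[OF conjunct1[OF tower_invariants[of n j]]] by (auto simp del: add_0_right)
    then show ?thesis
      using mono[of "Suc j" "d - Suc j"] that by auto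
  qed
  have telescope: "- coord k n 0 + coord k n j \<in> tower n d" if "j \<le> d" for j
    using that
  proof (induction j)
    case 0
    then show ?case using is_subgroupD(1)[OF T] by simp
  next
    case (Suc j)
    have "- coord k n 0 + coord k n (Suc j) = (- coord k n 0 + coord k n j) + diff_coord n j"
      unfolding diff_coord_def by (simp only: group_word_simps)
    then show ?case
      using is_subgroupD(2)[OF T] Suc small[of j] by simp
  qed
  have "pos (k n) (i mod Suc d) = pos (k n) i" "pos (k n) (Suc (i mod Suc d)) = pos (k n) (Suc i)" for i
    by (simp_all add: pos_eq_iff d mod_Suc_eq)
  then have period: "coord k n (i mod Suc d) = coord k n i" for i
    by (simp only: coord_def)
  have "diff_coord n (i mod Suc d) = diff_coord n i"
    using period[of i] period[of "Suc i"] period[of "Suc (i mod Suc d)"]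
    by (simp only: diff_coord_def mod_Suc_eq)
  moreover have "diff_coord n d \<in> tower n d"
  proof -
    have "diff_coord n d = - (- coord k n 0 + coord k n d)"
      unfolding diff_coord_def using period[of "Suc d"] by (simp add: minus_add)
    then show ?thesis
      using is_subgroupD(3)[OF T telescope[of d]] by simp
  qed
  moreover have "i mod Suc d < d \<or> i mod Suc d = d"
    by (simp flip: less_Suc_eq)
  ultimately show ?thesis
    unfolding d_def[symmetric] using small[of "i mod Suc d"] by auto
qed

text \<open>The \<open>c_i\<close> and the closed squares generate a group normalised by both
  generators: \<open>rot (k n)\<close> shifts the index, and \<open>dir k n\<close> alters
  \<open>c_i\<close> by a commutator of two elements of the product of next groups. That commutator
  lies in the second derived subgroup, hence among the squares. As the commutator of the two
  generators is in this group, so is the derived subgroup.\<close>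

lemma tower_top: "tower n (2 ^ k n - 1) = cl (der (Grp k n))"
proof
  let ?T = "tower n (2 ^ k n - 1)"
  show "?T \<subseteq> cl (der (Grp k n))"
    using tower_invariants by blast
  let ?X = "range (diff_coord n) \<union> tower_base n"
  have norm_base: "g + x - g \<in> tower_base n" if g: "g \<in> Grp k n" and x: "x \<in> tower_base n" for g x
    unfolding tower_base_def
  proof (rule clI)
    fix N
    obtain s where s: "s \<in> squares (der (Grp k n))" "agree N x s"
      using x unfolding tower_base_def by (rule clE)
    have "g + s - g \<in> squares (der (Grp k n))"
      by (rule conj_in_squares[OF conj_in_der_Grp[OF g] s(1)])
    then show "\<exists>t\<in>squares (der (Grp k n)). agree N (g + x - g) t"
      using s(2) by (intro bexI[of _ "g + s - g"] agree_minus agree_plus agree_refl)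
  qed
  have commB: "comm g x \<in> tower_base n"
    if "g \<in> level_prod (k n) (Grp k (Suc n))" "x \<in> level_prod (k n) (Grp k (Suc n))" for g x
  proof -
    have "comm g x \<in> der (der (Grp k n))"
      using comm_in_der[OF that] by (simp only: der_der_Grp der_level_prod[OF is_subgroup_Grp])
    moreover have "der (der (Grp k n)) \<subseteq> squares (der (Grp k n))"
      by (intro der_least is_subgroup_squares comm_in_squares[OF is_subgroup_der])
        (auto simp: squares_def intro!: gen_incl)
    ultimately show ?thesis
      unfolding tower_base_def using cl_incl by blast
  qed
  have dirL: "dir k n \<in> level_prod (k n) (Grp k (Suc n))"
    using coord_in_level_prod[of k n 0] dir_eq[of k n, OF k_pos] by simp
  have "s + x - s \<in> gen ?X \<and> - s + x + s \<in> gen ?X"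
    if s: "s \<in> {rot (k n), dir k n}" and x: "x \<in> ?X" for s x
  proof (cases "x \<in> tower_base n")
    case True
    have "s \<in> Grp k n" "- s \<in> Grp k n"
      using s rot_in_Grp dir_in_Grp is_subgroupD(3)[OF is_subgroup_Grp] by auto
    then have "s + x - s \<in> tower_base n" "- s + x - - s \<in> tower_base n"
      using norm_base True by blast+
    then show ?thesis
      by (auto intro!: gen_incl)
  next
    case False
    then obtain i where i: "x = diff_coord n i"
      using x by blast
    show ?thesis
    proof (cases "s = rot (k n)")
      case True
      have conj: "rot (k n) + diff_coord n i - rot (k n) = diff_coord n (Suc i)" for i
      proof -
        have "rot (k n) + diff_coord n i - rot (k n) =
            - (rot (k n) + coord k n i - rot (k n)) + (rot (k n) + coord k n (Suc i) - rot (k n))"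
          unfolding diff_coord_def by (simp only: group_word_simps)
        then show ?thesis
          by (simp only: rot_coord_conj diff_coord_def)
      qed
      have "coord k n (i + 2 ^ k n) = coord k n i" for i
      proof -
        have "pos (k n) (j + 2 ^ k n) = pos (k n) j" for j
          by (simp add: pos_eq_iff)
        from this[of i] this[of "Suc i"] show ?thesis
          by (simp only: coord_def add_Suc)
      qed
      then have "diff_coord n (i + 2 ^ k n) = diff_coord n i"
        unfolding diff_coord_def by (metis add_Suc)
      moreover have "Suc (i + (2 ^ k n - 1)) = i + 2 ^ k n"
        by simp
      ultimately have "rot (k n) + diff_coord n (i + (2 ^ k n - 1)) - rot (k n) = diff_coord n i"
        using conj[of "i + (2 ^ k n - 1)"] by simp
      then have "- rot (k n) + diff_coord n i + rot (k n) = diff_coord n (i + (2 ^ k n - 1))"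
        by (metis add.assoc diff_add_cancel minus_add_cancel)
      then show ?thesis
        using conj[of i] unfolding i True by (auto intro!: gen_incl)
    next
      case False
      then have s: "s = dir k n"
        using s by simp
      have "- dir k n \<in> level_prod (k n) (Grp k (Suc n))"
        by (rule is_subgroupD(3)[OF is_subgroup_level_prod[OF is_subgroup_Grp] dirL])
      then have "comm s x \<in> gen ?X" "comm (- s) x \<in> gen ?X" "x \<in> gen ?X"
        unfolding s i using commB dirL diff_coord_in_level_prod by (auto intro!: gen_incl)
      then have "comm s x + x \<in> gen ?X" "comm (- s) x + x \<in> gen ?X"
        by (auto intro: gen_plus)
      moreover have "comm s x + x = s + x - s" "comm (- s) x + x = - s + x + s"
        unfolding comm_def by (simp_all only: group_word_simps)
      ultimately show ?thesis
        by (simp only:)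
    qed
  qed
  then have norm: "g + x - g \<in> gen ?X" if "g \<in> Grp k n" "x \<in> gen ?X" for g x
    using that unfolding Grp_def by (rule conj_normal_gen)
  have rb: "comm (rot (k n)) (dir k n) \<in> gen ?X"
  proof -
    \<comment> \<open>As \<open>dir k n\<close> is \<open>b_0\<close>, the left side cancels to
      \<open>b_1 - b_0\<close>, and \<open>b_1\<close> is the conjugate of \<open>b_0\<close> by the
      rotation.\<close>
    have "dir k n + diff_coord n 0 - dir k n = comm (rot (k n)) (dir k n)"
      unfolding diff_coord_def comm_def rot_coord_conj[of k n 0, symmetric] dir_eq[of k n, OF k_pos]
      by (simp only: group_word_simps)
    moreover have "dir k n + diff_coord n 0 - dir k n \<in> gen ?X"
      by (intro norm dir_in_Grp gen_incl) simp
    ultimately show ?thesis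
      by simp
  qed
  have "der (Grp k n) \<subseteq> gen ?X"
    unfolding Grp_def
  proof (rule der_gen_least[OF is_subgroup_gen])
    show "g + x - g \<in> gen ?X" if "g \<in> gen {rot (k n), dir k n}" "x \<in> gen ?X" for g x
      using norm that unfolding Grp_def by blast
    have "comm (dir k n) (rot (k n)) \<in> gen ?X"
      using gen_uminus[OF rb] comm_minus_commute[of "dir k n" "rot (k n)"] by simp
    moreover have "comm x x = 0" for x :: aut
      unfolding comm_def by (simp only: group_word_simps)
    ultimately show "comm s t \<in> gen ?X" if "s \<in> {rot (k n), dir k n}" "t \<in> {rot (k n), dir k n}" for s t
      using that rb gen.gen_zero by auto
  qed
  also have "gen ?X \<subseteq> ?T"
    using diff_coord_in_tower tower_invariants by (intro gen_least) blast+
  finally show "cl (der (Grp k n)) \<subseteq> ?T"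
    using cl_tower by (rule cl_least)
qed

lemma has_index_squares:
  "has_index (cl (der (Grp k n))) (cl (squares (der (Grp k n)))) (2 ^ (2 ^ k n - 1))"
proof -
  have "has_index (tower n (2 ^ k n - 1)) (tower_base n) (2 ^ (2 ^ k n - 1))"
    by (rule has_index_tower) simp
  then show ?thesis
    by (simp only: tower_top tower_base_def)
qed

lemma funpow_cl_der: "((\<lambda>A. cl (der A)) ^^ m) (cl (Grp k 0)) = cl ((der ^^ m) (Grp k 0))"
  by (induction m) (simp_all add: cl_der_cl)

text \<open>Squares and closures both commute with products over a level, so the index at a single
  vertex is raised to the number of vertices.\<close>

theorem has_index_derived_squares:
  fixes m
  defines "A \<equiv> ((\<lambda>A. cl (der A)) ^^ Suc m) (cl (Grp k 0))"
  shows "has_index A (cl (squares A)) ((2 ^ (2 ^ k m - 1)) ^ 2 ^ depth k 0 m)"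
proof -
  have A: "A = cl (level_prod (depth k 0 m) (der (Grp k m)))"
    unfolding A_def funpow_cl_der funpow_der_Grp by simp
  have "cl (squares A) = level_prod (depth k 0 m) (cl (squares (der (Grp k m))))"
    unfolding A cl_squares_cl by (simp add: squares_level_prod is_subgroup_der cl_level_prod)
  then show ?thesis
    unfolding A cl_level_prod using has_index_level_prod[OF has_index_squares] by simp
qed

end

section \<open>Recovering the sequence from the topological group\<close>

lemma depth_cong: "(\<And>i. i < m \<Longrightarrow> k (n + i) = k' (n + i)) \<Longrightarrow> depth k n m = depth k' n m"
proof (induction m arbitrary: n)
  case (Suc m)
  have "depth k (Suc n) m = depth k' (Suc n) m"
    using Suc.prems[of "Suc _"] by (intro Suc.IH) simp
  then show ?case
    using Suc.prems[of 0] by simp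
qed simp

text \<open>A bijection compatible with sums and closures carries the closed derived series, and the
  closed subgroups of squares in it, to those of the other group. So it preserves their
  indices.\<close>

theorem no_iso:
  assumes k: "block_lengths k" "block_lengths k'" "k \<noteq> k'"
    and bij: "bij_betw f (cl (Grp k 0)) (cl (Grp k' 0))"
    and hom: "\<And>x y. x \<in> cl (Grp k 0) \<Longrightarrow> y \<in> cl (Grp k 0) \<Longrightarrow> f (x + y) = f x + f y"
    and cont: "\<And>S. S \<subseteq> cl (Grp k 0) \<Longrightarrow> f ` cl S = cl (f ` S)"
  shows False
proof -
  let ?H = "cl (Grp k 0)" and ?H' = "cl (Grp k' 0)"
  let ?D = "\<lambda>A. cl (der A)"
  have H: "is_subgroup ?H"
    by (intro is_subgroup_cl is_subgroup_Grp)
  have img: "f ` gen X = gen (f ` X)" if "X \<subseteq> ?H" for X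
    using H that hom by (rule gen_hom_image)
  have f_der: "f ` der A = der (f ` A)" if A: "is_subgroup A" "A \<subseteq> ?H" for A
  proof -
    have fm: "f (- x) = - f x" if "x \<in> ?H" for x
      using hom_on_uminus[OF H hom that] .
    have fc: "f (comm x y) = comm (f x) (f y)" if "x \<in> A" "y \<in> A" for x y
    proof -
      have "x \<in> ?H" "y \<in> ?H" "- x \<in> ?H" "- y \<in> ?H"
        using A that is_subgroupD(3)[OF H] by auto
      then show ?thesis
        unfolding comm_def diff_conv_add_uminus
        by (simp only: hom fm is_subgroupD(2)[OF H])
    qed
    have "f ` {comm x y |x y. x \<in> A \<and> y \<in> A} = {comm x y |x y. x \<in> f ` A \<and> y \<in> f ` A}"
    proof (intro equalityI subsetI)
      fix z assume "z \<in> f ` {comm x y |x y. x \<in> A \<and> y \<in> A}"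
      then obtain x y where "x \<in> A" "y \<in> A" "z = f (comm x y)"
        by blast
      then show "z \<in> {comm x y |x y. x \<in> f ` A \<and> y \<in> f ` A}"
        using fc by blast
    next
      fix z assume "z \<in> {comm x y |x y. x \<in> f ` A \<and> y \<in> f ` A}"
      then obtain x y where "x \<in> A" "y \<in> A" "z = comm (f x) (f y)"
        by blast
      then show "z \<in> f ` {comm x y |x y. x \<in> A \<and> y \<in> A}"
        using fc[symmetric] by blast
    qed
    moreover have "{comm x y |x y. x \<in> A \<and> y \<in> A} \<subseteq> ?H"
      using A is_subgroupD(2,4)[OF H] by (auto simp: comm_def subset_iff)
    ultimately show ?thesis
      unfolding der_def by (simp only: img)
  qed
  have f_sq: "f ` squares A = squares (f ` A)" if A: "A \<subseteq> ?H" for A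
  proof -
    have fd: "f (x + x) = f x + f x" if "x \<in> A" for x
      using hom A that by blast
    have "f ` {x + x |x. x \<in> A} = {x + x |x. x \<in> f ` A}"
    proof (intro equalityI subsetI)
      fix z assume "z \<in> f ` {x + x |x. x \<in> A}"
      then show "z \<in> {x + x |x. x \<in> f ` A}"
        using fd by blast
    next
      fix z assume "z \<in> {x + x |x. x \<in> f ` A}"
      then obtain x where "x \<in> A" "z = f x + f x"
        by blast
      then show "z \<in> f ` {x + x |x. x \<in> A}"
        using fd[symmetric] by blast
    qed
    moreover have "{x + x |x. x \<in> A} \<subseteq> ?H"
      using A is_subgroupD(2)[OF H] by auto
    ultimately show ?thesis
      unfolding squares_def by (simp only: img)
  qed
  have D: "is_subgroup ((?D ^^ m) ?H) \<and> (?D ^^ m) ?H \<subseteq> ?H \<and> f ` (?D ^^ m) ?H = (?D ^^ m) ?H'" for m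
  proof (induction m)
    case 0
    then show ?case
      using H bij by (simp add: bij_betw_def)
  next
    case (Suc m)
    let ?A = "(?D ^^ m) ?H"
    have sub: "der ?A \<subseteq> ?H"
      using Suc der_subset by blast
    moreover have "cl (der ?A) \<subseteq> ?H"
      by (rule cl_least[OF sub cl_cl])
    ultimately show ?case
      using Suc f_der[of ?A] cont[OF sub] by (simp add: is_subgroup_cl is_subgroup_der)
  qed
  have "\<exists>m. k m \<noteq> k' m"
    using k(3) by (simp add: fun_eq_iff)
  \<comment> \<open>At the first difference all earlier blocks coincide, so both indices belong to
    the same level and the outer exponents cancel.\<close>
  then obtain m where m: "k m \<noteq> k' m" "\<And>i. i < m \<Longrightarrow> k i = k' i"
    by (subst (asm) exists_least_iff) blast
  let ?A = "(?D ^^ Suc m) ?H" and ?A' = "(?D ^^ Suc m) ?H'"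
  have A: "is_subgroup ?A" "?A \<subseteq> ?H" "f ` ?A = ?A'"
    using D[of "Suc m"] by blast+
  have sq: "squares ?A \<subseteq> ?A"
    by (rule squares_subset[OF A(1)])
  have "cl ?A = ?A"
    by simp
  then have clsq: "cl (squares ?A) \<subseteq> ?A"
    using sq by (intro cl_least)
  have f_clsq: "f ` cl (squares ?A) = cl (squares ?A')"
  proof -
    have "squares ?A \<subseteq> ?H"
      using sq A(2) by (rule subset_trans)
    from cont[OF this] show ?thesis
      by (simp only: f_sq[OF A(2)] A(3))
  qed
  have "has_index (f ` ?A) (f ` cl (squares ?A)) ((2 ^ (2 ^ k m - 1)) ^ 2 ^ depth k 0 m)"
  proof (rule has_index_hom_image[OF A(1) clsq])
    show "inj_on f ?A"
      by (rule inj_on_subset[OF bij_betw_imp_inj_on[OF bij] A(2)])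
    show "f (x + y) = f x + f y" if "x \<in> ?A" "y \<in> ?A" for x y
      using hom subsetD[OF A(2)] that by blast
    show "has_index ?A (cl (squares ?A)) ((2 ^ (2 ^ k m - 1)) ^ 2 ^ depth k 0 m)"
      by (rule block_lengths.has_index_derived_squares[OF k(1)])
  qed
  then have "has_index ?A' (cl (squares ?A')) ((2 ^ (2 ^ k m - 1)) ^ 2 ^ depth k 0 m)"
    by (simp only: A(3) f_clsq)
  moreover have "has_index ?A' (cl (squares ?A')) ((2 ^ (2 ^ k' m - 1)) ^ 2 ^ depth k' 0 m)"
    by (rule block_lengths.has_index_derived_squares[OF k(2)])
  moreover have "is_subgroup (cl (squares ?A'))"
    by (intro is_subgroup_cl is_subgroup_squares)
  ultimately have "((2::nat) ^ (2 ^ k m - 1)) ^ 2 ^ depth k 0 m = (2 ^ (2 ^ k' m - 1)) ^ 2 ^ depth k' 0 m"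
    using has_index_unique by blast
  moreover have "depth k 0 m = depth k' 0 m"
    using m(2) by (intro depth_cong) simp
  ultimately have "((2::nat) ^ (2 ^ k m - 1)) = 2 ^ (2 ^ k' m - 1)"
    by (simp add: power_eq_iff_eq_base)
  then have "(2::nat) ^ k m - 1 = 2 ^ k' m - 1"
    by simp
  then have "k m = k' m"
    using block_lengths.k_cases[OF k(1), of m] block_lengths.k_cases[OF k(2), of m] by auto
  then show False
    using m(1) by simp
qed

section \<open>Realisation as automorphisms of the tree of binary words\<close>

text \<open>Cauchy's theorem, obtained as the Sylow theorem with exponent 1, gives a subgroup of
  order \<open>q\<close> for every prime divisor \<open>q\<close> of the order. A nontrivial element
  of it has order dividing both \<open>q\<close> and \<open>p ^ n\<close>, so
  \<open>q = p\<close>.\<close>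

lemma (in group) order_prime_power:
  assumes fin: "finite (carrier G)" and p: "prime p"
    and exp: "\<And>x. x \<in> carrier G \<Longrightarrow> x [^] (p ^ n :: nat) = \<one>"
  shows "\<exists>e. order G = p ^ e"
proof -
  have "order G \<noteq> 0"
    using fin order_gt_0_iff_finite by auto
  moreover have "q = p" if q: "prime q" "q dvd order G" for q
  proof -
    obtain m where "order G = q ^ 1 * m"
      using q(2) by (auto elim: dvdE)
    then obtain H where H: "subgroup H G" "card H = q"
      using sylow_thm[of q G 1 m] q(1) fin is_group by auto
    have "H \<noteq> {\<one>}"
      using H(2) q(1) by auto
    then obtain x where x: "x \<in> H" "x \<noteq> \<one>"
      using subgroup.one_closed[OF H(1)] by blast
    then have xG: "x \<in> carrier G"
      using subgroup.subset[OF H(1)] by blast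
    have "x [^] q = \<one>"
    proof -
      interpret H: group "G\<lparr>carrier := H\<rparr>"
        by (rule subgroup_imp_group[OF H(1)])
      have "x [^]\<^bsub>G\<lparr>carrier := H\<rparr>\<^esub> order (G\<lparr>carrier := H\<rparr>) = \<one>"
        using H.pow_order_eq_1[of x] x(1) by simp
      then show ?thesis
        using H(2) by (simp add: order_def nat_pow_consistent[symmetric])
    qed
    then have "ord x dvd q" "ord x dvd p ^ n"
      using exp[OF xG] pow_eq_id[OF xG] by auto
    moreover have "ord x \<noteq> 1"
      using ord_eq_1[OF xG] x(2) by simp
    ultimately have "q dvd p ^ n"
      using q(1) by (metis prime_nat_iff)
    then show "q = p"
      using p q(1) by (metis prime_dvd_power primes_dvd_imp_eq)
  qed
  moreover obtain m where m: "order G = p ^ multiplicity p (order G) * m" "\<not> p dvd m"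
  proof (rule multiplicity_decompose'[of "order G" p])
    show "order G \<noteq> 0" by fact
    show "\<not> is_unit p" using p by auto
  qed (rule that)
  ultimately have "m = 1"
    by (metis dvd_triv_right dvd_trans prime_factor_nat)
  then show ?thesis
    using m(1) by auto
qed

definition bits :: "nat set" where
  "bits = {0, 1}"

text \<open>Branch groups are defined over alphabets of natural numbers, while the coinductive trees
  act on boolean words; \<open>code\<close> and \<open>decode\<close> mediate.\<close>

definition code :: "bool list \<Rightarrow> nat list" where
  "code = map of_bool"

definition decode :: "nat list \<Rightarrow> bool list" where
  "decode = map (\<lambda>a. a = 1)"

lemma decode_code [simp]: "decode (code w) = w"
  by (induction w) (auto simp: code_def decode_def)

lemma length_code [simp]: "length (code w) = length w"
  by (simp add: code_def)

lemma code_eq_iff [simp]: "code u = code v \<longleftrightarrow> u = v"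
  by (metis decode_code)

lemma lists_bits [simp]: "lists bits = range code"
proof (intro equalityI subsetI)
  fix w :: "nat list" assume "w \<in> lists bits"
  then have "w = code (decode w)"
    by (induction w) (auto simp: code_def decode_def bits_def)
  then show "w \<in> range code"
    by blast
next
  fix w :: "nat list" assume "w \<in> range code"
  then show "w \<in> lists bits"
    by (auto simp: code_def bits_def)
qed

lemma level_eq_code: "level bits n = code ` {w. length w = n}"
  by (auto simp: level_def)

lemma prefix_code [simp]: "prefix (code u) (code v) \<longleftrightarrow> prefix u v"
  by (metis code_def decode_code decode_def map_mono_prefix)

lemma longest_common_prefix_code:
  "longest_common_prefix (code u) (code v) = code (longest_common_prefix u v)"
  by (induction u v rule: longest_common_prefix.induct) (auto simp: code_def)

lemma longest_common_prefix_act: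
  "longest_common_prefix (act g u) (act g v) = act g (longest_common_prefix u v)"
proof (induction u v arbitrary: g rule: longest_common_prefix.induct)
  case ("2_1" v)
  then show ?case by (cases v) auto
next
  case ("2_2" v)
  then show ?case by auto
qed auto

definition realize :: "aut \<Rightarrow> nat list \<Rightarrow> nat list" where
  "realize g = (\<lambda>w\<in>lists bits. code (act g (decode w)))"

lemma realize_code [simp]: "realize g (code w) = code (act g w)"
  by (simp add: realize_def)

lemma realize_eqI:
  assumes "f \<in> extensional (lists bits)" and "\<And>w. f (code w) = code (act g w)"
  shows "f = realize g"
proof (rule extensionalityI[OF assms(1)])
  show "realize g \<in> extensional (lists bits)"
    by (simp add: realize_def)
  show "f w = realize g w" if "w \<in> lists bits" for w
    using that assms(2) by auto
qed

lemma realize_eq_iff [simp]: "realize g = realize h \<longleftrightarrow> g = h"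
proof
  assume *: "realize g = realize h"
  have "code (act g w) = code (act h w)" for w
    using fun_cong[OF *, of "code w"] by simp
  then show "g = h"
    by (intro act_eqI) simp
qed simp

lemma realize_in_Bij [simp]: "realize g \<in> Bij (range code)"
proof -
  have "bij_betw (realize g) (range code) (range code)"
  proof (rule bij_betw_byWitness[where f' = "realize (- g)"])
  qed auto
  then show ?thesis
    by (simp add: Bij_def realize_def)
qed

lemma realize_in_tree_automorphisms: "realize g \<in> tree_automorphisms bits"
  unfolding tree_automorphisms_def
  by (simp add: realize_in_Bij longest_common_prefix_code longest_common_prefix_act)

primcorec of_action :: "(bool list \<Rightarrow> bool list) \<Rightarrow> aut" where
  "swap (of_action f) = hd (f [False])"
| "left (of_action f) = of_action (\<lambda>w. tl (f (False # w)))"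
| "right (of_action f) = of_action (\<lambda>w. tl (f (True # w)))"

lemma child_of_action: "child (of_action f) x = of_action (\<lambda>w. tl (f (x # w)))"
  by (simp add: child_def)

text \<open>Injectivity on the words of length one forces \<open>[True]\<close> and
  \<open>[False]\<close> to have different images, so the first letter moves as the swap prescribes.
  Prefix preservation fixes that letter for all longer words, and the tails are again maps of the
  same kind.\<close>

lemma act_of_action:
  assumes "\<And>w. length (f w) = length w" and "\<And>u v. prefix u v \<Longrightarrow> prefix (f u) (f v)" and "inj f"
  shows "act (of_action f) w = f w"
  using assms
proof (induction w arbitrary: f)
  case Nil
  then show ?case using Nil(1)[of "[]"] by (metis act.simps(1) length_0_conv)
next
  case (Cons x w f)
  have len1: "length (f [y]) = Suc 0" for y
    using Cons.prems(1)[of "[y]"] by simp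
  have fx: "f (y # v) = hd (f [y]) # tl (f (y # v))" for y v
  proof -
    have "prefix (f [y]) (f (y # v))"
      by (intro Cons.prems(2)) simp
    moreover obtain z where "f [y] = [z]"
      using len1[of y] by (auto simp: length_Suc_conv)
    ultimately show ?thesis
      by (cases "f (y # v)") auto
  qed
  have "hd (f [True]) \<noteq> hd (f [False])"
  proof
    assume *: "hd (f [True]) = hd (f [False])"
    have "f [True] = f [False]"
      using len1[of True] len1[of False] * by (auto simp: length_Suc_conv)
    then show False
      using Cons.prems(3) by (auto dest: injD)
  qed
  then have "(x \<noteq> hd (f [False])) = hd (f [x])"
    by (cases x) auto
  moreover have "act (of_action (\<lambda>w. tl (f (x # w)))) w = tl (f (x # w))"
  proof (rule Cons.IH)
    show "length (tl (f (x # w))) = length w" for w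
      using Cons.prems(1)[of "x # w"] by simp
    show "prefix (tl (f (x # u))) (tl (f (x # v)))" if "prefix u v" for u v
      using Cons.prems(2)[of "x # u" "x # v"] that fx[of x u] fx[of x v]
      by (metis Cons_prefix_Cons)
    show "inj (\<lambda>w. tl (f (x # w)))"
    proof (rule injI)
      fix u v assume "tl (f (x # u)) = tl (f (x # v))"
      then have "f (x # u) = f (x # v)"
        using fx by metis
      then show "u = v"
        using Cons.prems(3) by (auto dest: injD)
    qed
  qed
  ultimately show ?case
    using fx[of x w] by (simp add: child_of_action)
qed

text \<open>\<open>u\<close> is a prefix of \<open>v\<close> exactly when it is their longest common
  prefix, so tree automorphisms preserve prefixes. Hence every automorphism is the action of some
  coinductive tree.\<close>

lemma tree_automorphisms_eq: "tree_automorphisms bits = range realize"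
proof (intro equalityI subsetI)
  fix f :: "nat list \<Rightarrow> nat list" assume f: "f \<in> tree_automorphisms bits"
  then have bij: "bij_betw f (lists bits) (lists bits)" and ext: "f \<in> extensional (lists bits)"
    and len: "\<And>w. length (f (code w)) = length w"
    and lcp: "\<And>u v. longest_common_prefix (f (code u)) (f (code v)) = f (code (longest_common_prefix u v))"
    unfolding tree_automorphisms_def
    by (simp_all add: Bij_def longest_common_prefix_code)
  define F where "F w = decode (f (code w))" for w
  have F: "code (F w) = f (code w)" for w
  proof -
    have "f (code w) \<in> range code"
      using bij_betwE[OF bij] by simp
    then show ?thesis
      unfolding F_def by auto
  qed
  have "act (of_action F) w = F w" for w
  proof (rule act_of_action)
    show "length (F w) = length w" for w
      using len[of w] F[of w] by (metis length_code)
    show "prefix (F u) (F v)" if "prefix u v" for u v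
    proof -
      have "longest_common_prefix u v = u"
        using that by (simp add: longest_common_prefix_max_prefix longest_common_prefix_prefix1 prefix_order.antisym)
      then have "longest_common_prefix (F u) (F v) = F u"
        using lcp[of u v] by (simp add: longest_common_prefix_code flip: F)
      then show ?thesis
        by (metis longest_common_prefix_prefix2)
    qed
    show "inj F"
    proof (rule injI)
      fix u v assume "F u = F v"
      then have "f (code u) = f (code v)"
        using F by metis
      then show "u = v"
        using bij_betw_imp_inj_on[OF bij] by (auto dest: inj_onD)
    qed
  qed
  then have "f = realize (of_action F)"
    using ext F by (intro realize_eqI) simp_all
  then show "f \<in> range realize"
    by blast
qed (auto simp: realize_in_tree_automorphisms)

subsection \<open>The group structure\<close>

text \<open>For \<open>A = UNIV\<close> this is all of \<open>Aut_tree bits\<close>, so the ambient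
  group and its subgroups are handled by the same lemmas.\<close>

definition realization :: "aut set \<Rightarrow> (nat list \<Rightarrow> nat list) monoid" where
  "realization A = Aut_tree bits\<lparr>carrier := realize ` A\<rparr>"

lemma carrier_realization [simp]: "carrier (realization A) = realize ` A"
  by (simp add: realization_def)

lemma mult_realization [simp]:
  "realize g \<otimes>\<^bsub>realization A\<^esub> realize h = realize (g + h)"
  unfolding realization_def Aut_tree_def BijGroup_def
  by (auto simp: realize_in_Bij compose_def intro!: realize_eqI)

lemma one_realization [simp]: "\<one>\<^bsub>realization A\<^esub> = realize 0"
  unfolding realization_def Aut_tree_def BijGroup_def
  by (auto simp: intro!: realize_eqI)

lemma group_realization:
  assumes "is_subgroup A"
  shows "group (realization A)"
proof (rule groupI)
  fix x assume "x \<in> carrier (realization A)"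
  then obtain g where "g \<in> A" "x = realize g"
    by auto
  then show "\<exists>y\<in>carrier (realization A). y \<otimes>\<^bsub>realization A\<^esub> x = \<one>\<^bsub>realization A\<^esub>"
    using is_subgroupD(3)[OF assms] by (intro bexI[of _ "realize (- g)"]) auto
qed (auto simp: is_subgroupD[OF assms] add.assoc)

lemma inv_realization:
  assumes "is_subgroup A" "g \<in> A"
  shows "inv\<^bsub>realization A\<^esub> realize g = realize (- g)"
  using assms by (intro group.inv_equality[OF group_realization]) (auto simp: is_subgroupD)

lemma Aut_tree_eq: "Aut_tree bits = realization UNIV"
  unfolding realization_def by (simp add: Aut_tree_def tree_automorphisms_eq)

lemma is_subgroup_UNIV: "is_subgroup UNIV"
  by (simp add: is_subgroup_def)

lemma subgroup_realization:
  assumes A: "is_subgroup A" and N: "subgroup (realize ` M) (realization A)"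
  shows "is_subgroup M" "M \<subseteq> A"
proof -
  show sub: "M \<subseteq> A"
    using subgroup.subset[OF N] by auto
  show "is_subgroup M"
    unfolding is_subgroup_def
  proof (intro conjI ballI)
    show "0 \<in> M"
      using subgroup.one_closed[OF N] by auto
    fix x y assume x: "x \<in> M" and y: "y \<in> M"
    show "x + y \<in> M"
      using subgroup.m_closed[OF N, of "realize x" "realize y"] x y by auto
    show "- x \<in> M"
      using subgroup.m_inv_closed[OF N, of "realize x"] x sub inv_realization[OF A, of x] by auto
  qed
qed

lemma subgroup_realizationI:
  assumes "is_subgroup A" "is_subgroup M" "M \<subseteq> A"
  shows "subgroup (realize ` M) (realization A)"
proof
  show "inv\<^bsub>realization A\<^esub> x \<in> realize ` M" if "x \<in> realize ` M" for x
    using that assms by (auto simp: inv_realization is_subgroupD subset_iff)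
qed (use assms in \<open>auto simp: is_subgroupD\<close>)

lemma normal_realization:
  assumes A: "is_subgroup A" and N: "realize ` M \<lhd> realization A" and "g \<in> A" "x \<in> M"
  shows "g + x - g \<in> M"
proof -
  have "realize g \<otimes>\<^bsub>realization A\<^esub> realize x \<otimes>\<^bsub>realization A\<^esub> inv\<^bsub>realization A\<^esub> realize g \<in> realize ` M"
    using assms(3,4) by (intro normal.inv_op_closed2[OF N]) auto
  then show ?thesis
    using A assms(3) by (auto simp: inv_realization)
qed

lemma finite_rcosets_realization:
  assumes A: "is_subgroup A" and M: "is_subgroup M" and fin: "finite_index A M"
  shows "finite (rcosets\<^bsub>realization A\<^esub> (realize ` M))"
proof -
  obtain F where F: "finite F" "\<And>x. x \<in> A \<Longrightarrow> \<exists>f\<in>F. - f + x \<in> M"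
    using fin unfolding finite_index_def by auto
  have "rcosets\<^bsub>realization A\<^esub> (realize ` M) \<subseteq> (\<lambda>f. realize ` (\<lambda>m. m - f) ` M) ` F"
  proof
    fix C assume "C \<in> rcosets\<^bsub>realization A\<^esub> (realize ` M)"
    then obtain x where x: "x \<in> A" and C: "C = realize ` M #>\<^bsub>realization A\<^esub> realize x"
      by (auto simp: RCOSETS_def)
    have "C = realize ` (\<lambda>m. m + x) ` M"
      unfolding C r_coset_def by auto
    note x = x this
    \<comment> \<open>\<open>finite_index\<close> speaks of left cosets and \<open>rcosets\<close>
      of right ones. Inversion exchanges them, so the representative is chosen for
      \<open>- x\<close>.\<close>
    obtain f where f: "f \<in> F" "- f + - x \<in> M"
      using F(2)[OF is_subgroupD(3)[OF A x(1)]] by blast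
    have xf: "x + f \<in> M"
      using is_subgroupD(3)[OF M f(2)] by (simp add: minus_add)
    have "(\<lambda>m. m + x) ` M = (\<lambda>m. m - f) ` M"
    proof (intro equalityI subsetI)
      fix y assume "y \<in> (\<lambda>m. m + x) ` M"
      then obtain m where m: "m \<in> M" "y = m + x"
        by blast
      have "y = (m + (x + f)) - f"
        unfolding m(2) by (simp only: group_word_simps)
      then show "y \<in> (\<lambda>m. m - f) ` M"
        using is_subgroupD(2)[OF M m(1) xf] by blast
    next
      fix y assume "y \<in> (\<lambda>m. m - f) ` M"
      then obtain m where m: "m \<in> M" "y = m - f"
        by blast
      have "y = (m - (x + f)) + x"
        unfolding m(2) by (simp only: group_word_simps)
      then show "y \<in> (\<lambda>m. m + x) ` M"
        using is_subgroupD(4)[OF M m(1) xf] by blast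
    qed
    then show "C \<in> (\<lambda>f. realize ` (\<lambda>m. m - f) ` M) ` F"
      unfolding x(2) using f(1) by simp
  qed
  then show ?thesis
    using F(1) by (meson finite_imageI finite_subset)
qed

subsection \<open>The topology\<close>

lemma level_stabilizer_eq: "level_stabilizer bits n = realize ` {h. agree n h 0}"
  by (auto simp: level_stabilizer_def level_eq_code tree_automorphisms_eq agree_def)

lemma coset_level_stabilizer:
  "realize g <#\<^bsub>Aut_tree bits\<^esub> level_stabilizer bits n = realize ` {h. agree n g h}"
proof -
  have "agree n g (g + h)" if "agree n h 0" for h
    using agree_plus[OF agree_refl agree_sym[OF that], of g] by simp
  moreover have "\<exists>h'. agree n h' 0 \<and> h = g + h'" if "agree n g h" for h
  proof (intro exI conjI)
    show "agree n (- g + h) 0"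
      using agree_plus[OF agree_refl agree_sym[OF that], of "- g"] by simp
    show "h = g + (- g + h)"
      by (simp only: group_word_simps)
  qed
  ultimately show ?thesis
    unfolding Aut_tree_eq level_stabilizer_eq l_coset_def by auto
qed

text \<open>The cosets of level stabilisers are the balls of agreement on a level. Any point of a
  ball is a centre of it, and balls with a common centre are nested, so these sets form a
  base.\<close>

lemma openin_Aut_tree:
  "openin (Aut_tree_topology bits) U \<longleftrightarrow>
     U \<subseteq> range realize \<and> (\<forall>g. realize g \<in> U \<longrightarrow> (\<exists>n. \<forall>h. agree n g h \<longrightarrow> realize h \<in> U))"
    (is "_ \<longleftrightarrow> ?P U")
proof -
  let ?B = "{g <#\<^bsub>Aut_tree bits\<^esub> level_stabilizer bits n | g n. g \<in> tree_automorphisms bits}"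
  have B: "s \<in> ?B \<longleftrightarrow> (\<exists>g n. s = realize ` {h. agree n g h})" for s
    unfolding tree_automorphisms_eq by (auto simp flip: coset_level_stabilizer)
  have "?P U" if "generate_topology_on ?B U"
    using that
  proof (induction rule: generate_topology_on.induct)
    case (Int a b)
    show ?case
    proof (intro conjI allI impI)
      fix g assume g: "realize g \<in> a \<inter> b"
      obtain m where m: "\<And>h. agree m g h \<Longrightarrow> realize h \<in> a"
        using Int g by blast
      obtain n where n: "\<And>h. agree n g h \<Longrightarrow> realize h \<in> b"
        using Int g by blast
      have "agree m g h \<and> agree n g h" if "agree (max m n) g h" for h
        using agree_mono[OF that] by simp
      then show "\<exists>n. \<forall>h. agree n g h \<longrightarrow> realize h \<in> a \<inter> b"
        using m n by blast
    qed (use Int in blast)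
  next
    case (UN K)
    show ?case
    proof (intro conjI allI impI)
      fix g assume "realize g \<in> \<Union>K"
      then obtain a where "a \<in> K" "realize g \<in> a"
        by blast
      then show "\<exists>n. \<forall>h. agree n g h \<longrightarrow> realize h \<in> \<Union>K"
        using UN.IH[of a] by blast
    qed (use UN.IH in blast)
  next
    case (Basis s)
    then obtain f n where s: "s = realize ` {h. agree n f h}"
      unfolding B by blast
    show ?case
    proof (intro conjI allI impI)
      fix g assume "realize g \<in> s"
      then have "agree n f g"
        unfolding s by auto
      then have "\<forall>h. agree n g h \<longrightarrow> realize h \<in> s"
        unfolding s using agree_trans by blast
      then show "\<exists>n. \<forall>h. agree n g h \<longrightarrow> realize h \<in> s" ..
    qed (auto simp: s)
  qed simp
  moreover have "generate_topology_on ?B U" if U: "?P U"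
  proof -
    have "U = \<Union>{s \<in> ?B. s \<subseteq> U}"
    proof (intro equalityI subsetI)
      fix x assume x: "x \<in> U"
      then obtain g where g: "x = realize g"
        using U by blast
      then obtain n where "\<And>h. agree n g h \<Longrightarrow> realize h \<in> U"
        using U x by blast
      then have "realize ` {h. agree n g h} \<in> {s \<in> ?B. s \<subseteq> U}"
        using B by blast
      moreover have "x \<in> realize ` {h. agree n g h}"
        unfolding g by simp
      ultimately show "x \<in> \<Union>{s \<in> ?B. s \<subseteq> U}"
        by blast
    qed blast
    moreover have "generate_topology_on ?B (\<Union>{s \<in> ?B. s \<subseteq> U})"
      by (rule generate_topology_on.UN) (auto intro: generate_topology_on.Basis)
    ultimately show ?thesis
      by simp
  qed
  ultimately show ?thesis
    unfolding Aut_tree_topology_def openin_topology_generated_by_iff by blast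
qed

lemma topspace_Aut_tree [simp]: "topspace (Aut_tree_topology bits) = range realize"
proof
  show "topspace (Aut_tree_topology bits) \<subseteq> range realize"
    using openin_topspace[of "Aut_tree_topology bits"] unfolding openin_Aut_tree by blast
  have "openin (Aut_tree_topology bits) (range realize)"
    unfolding openin_Aut_tree by auto
  then show "range realize \<subseteq> topspace (Aut_tree_topology bits)"
    by (rule openin_subset)
qed

definition realization_topology :: "aut set \<Rightarrow> (nat list \<Rightarrow> nat list) topology" where
  "realization_topology A = subtopology (Aut_tree_topology bits) (realize ` A)"

lemma topspace_realization [simp]: "topspace (realization_topology A) = realize ` A"
  by (auto simp: realization_topology_def)

lemma openin_realization:
  "openin (realization_topology A) U \<longleftrightarrow>
     U \<subseteq> realize ` A \<and> (\<forall>g\<in>A. realize g \<in> U \<longrightarrow> (\<exists>n. \<forall>h\<in>A. agree n g h \<longrightarrow> realize h \<in> U))"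
    (is "?l \<longleftrightarrow> ?r")
proof
  assume ?l
  then obtain V where V: "openin (Aut_tree_topology bits) V" "U = V \<inter> realize ` A"
    unfolding realization_topology_def openin_subtopology by blast
  then show ?r
    unfolding openin_Aut_tree by blast
next
  assume U: ?r
  \<comment> \<open>The union of all balls centred at points of \<open>U\<close> whose trace on
    \<open>A\<close> stays inside \<open>U\<close>.\<close>
  define V where "V = realize ` {h. \<exists>g n. g \<in> A \<and> realize g \<in> U \<and> agree n g h \<and>
    (\<forall>h'\<in>A. agree n g h' \<longrightarrow> realize h' \<in> U)}"
  have "openin (Aut_tree_topology bits) V"
    unfolding openin_Aut_tree
  proof (intro conjI allI impI)
    fix h assume "realize h \<in> V"
    then obtain g n where g: "g \<in> A" "realize g \<in> U" "agree n g h"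
      "\<forall>h'\<in>A. agree n g h' \<longrightarrow> realize h' \<in> U"
      unfolding V_def by auto
    have "realize h' \<in> V" if "agree n h h'" for h'
      unfolding V_def using g agree_trans[OF g(3) that] by blast
    then show "\<exists>n. \<forall>h'. agree n h h' \<longrightarrow> realize h' \<in> V"
      by blast
  qed (auto simp: V_def)
  moreover have "U = V \<inter> realize ` A"
  proof (intro equalityI subsetI)
    fix x assume x: "x \<in> U"
    then obtain g where g: "g \<in> A" "x = realize g"
      using U by blast
    then obtain n where "\<forall>h\<in>A. agree n g h \<longrightarrow> realize h \<in> U"
      using U x by blast
    then have "x \<in> V"
      unfolding V_def g(2) using g x agree_refl[of n g] by blast
    then show "x \<in> V \<inter> realize ` A"
      using g by blast
  next
    fix x assume "x \<in> V \<inter> realize ` A"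
    then show "x \<in> U"
      unfolding V_def by auto
  qed
  ultimately show ?l
    unfolding realization_topology_def openin_subtopology by blast
qed

lemma openin_realization_ball: "openin (realization_topology A) (realize ` {h \<in> A. agree n f h})"
  unfolding openin_realization
proof (intro conjI ballI impI)
  fix g assume "g \<in> A" "realize g \<in> realize ` {h \<in> A. agree n f h}"
  then have "agree n f g"
    by auto
  then show "\<exists>m. \<forall>h\<in>A. agree m g h \<longrightarrow> realize h \<in> realize ` {h \<in> A. agree n f h}"
    using agree_trans by blast
qed auto

lemma openin_realization_ball_compl:
  "openin (realization_topology A) (realize ` {h \<in> A. \<not> agree n f h})"
  unfolding openin_realization
proof (intro conjI ballI impI)
  fix g assume "g \<in> A" "realize g \<in> realize ` {h \<in> A. \<not> agree n f h}"
  then have "\<not> agree n f g"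
    by auto
  then show "\<exists>m. \<forall>h\<in>A. agree m g h \<longrightarrow> realize h \<in> realize ` {h \<in> A. \<not> agree n f h}"
    using agree_trans agree_sym by blast
qed auto

lemma closedin_realize:
  assumes "cl A = A"
  shows "closedin (Aut_tree_topology bits) (realize ` A)"
  unfolding closedin_def openin_Aut_tree
proof (intro conjI allI impI)
  fix g assume "realize g \<in> topspace (Aut_tree_topology bits) - realize ` A"
  then have "g \<notin> cl A"
    using assms by auto
  then obtain n where n: "\<forall>s\<in>A. \<not> agree n g s"
    unfolding cl_def by blast
  then show "\<exists>n. \<forall>h. agree n g h \<longrightarrow> realize h \<in> topspace (Aut_tree_topology bits) - realize ` A"
    by (intro exI[of _ n]) auto
qed auto

lemma cl_eq_if_closedin:
  assumes "closedin (Aut_tree_topology bits) (realize ` M)"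
  shows "cl M = M"
proof (intro equalityI subsetI)
  fix g assume g: "g \<in> cl M"
  show "g \<in> M"
  proof (rule ccontr)
    assume "g \<notin> M"
    then have "realize g \<in> range realize - realize ` M"
      by auto
    moreover have "openin (Aut_tree_topology bits) (range realize - realize ` M)"
      using assms by (simp add: closedin_def)
    ultimately obtain n where n: "\<And>h. agree n g h \<Longrightarrow> realize h \<in> range realize - realize ` M"
      unfolding openin_Aut_tree by blast
    obtain s where "s \<in> M" "agree n g s"
      using g by (rule clE)
    then show False
      using n by blast
  qed
qed (use cl_incl in blast)

lemma closure_of_realize: "Aut_tree_topology bits closure_of (realize ` M) = realize ` cl M"
proof
  show "Aut_tree_topology bits closure_of (realize ` M) \<subseteq> realize ` cl M"
    by (intro closure_of_minimal closedin_realize image_mono cl_incl cl_cl)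
  show "realize ` cl M \<subseteq> Aut_tree_topology bits closure_of (realize ` M)"
  proof
    fix x assume "x \<in> realize ` cl M"
    then obtain g where g: "g \<in> cl M" "x = realize g"
      by blast
    have "\<exists>y. y \<in> realize ` M \<and> y \<in> V" if V: "x \<in> V" "openin (Aut_tree_topology bits) V" for V
    proof -
      obtain n where n: "\<And>h. agree n g h \<Longrightarrow> realize h \<in> V"
        using V unfolding openin_Aut_tree g(2) by blast
      obtain s where "s \<in> M" "agree n g s"
        using g(1) by (rule clE)
      then show ?thesis
        using n by blast
    qed
    then show "x \<in> Aut_tree_topology bits closure_of (realize ` M)"
      using g(2) by (auto simp: in_closure_of)
  qed
qed

lemma closure_of_realization:
  assumes "cl A = A" "M \<subseteq> A"
  shows "realization_topology A closure_of (realize ` M) = realize ` cl M"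
proof -
  have "realize ` A \<inter> realize ` M = realize ` M" "realize ` A \<inter> realize ` cl M = realize ` cl M"
    using assms cl_mono[OF assms(2)] by auto
  then show ?thesis
    by (simp only: realization_topology_def closure_of_subtopology closure_of_realize)
qed

section \<open>Compactness and profiniteness\<close>

primcorec of_portrait :: "(bool list \<Rightarrow> bool) \<Rightarrow> aut" where
  "swap (of_portrait p) = p []"
| "left (of_portrait p) = of_portrait (\<lambda>u. p (False # u))"
| "right (of_portrait p) = of_portrait (\<lambda>u. p (True # u))"

lemma of_portrait_surj: "g = of_portrait (\<lambda>u. swap (section_at g u))"
proof (coinduction arbitrary: g)
  case (Eq_aut g)
  then show ?case
    by (auto intro!: exI[of _ "left g"] exI[of _ "right g"])
qed

lemma agree_of_portrait: "(\<And>u. length u < n \<Longrightarrow> p u = q u) \<Longrightarrow> agree n (of_portrait p) (of_portrait q)"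
proof (induction n arbitrary: p q)
  case (Suc n)
  have "p [] = q []"
    by (rule Suc.prems) simp
  then show ?case
    unfolding agree_Suc using Suc.prems by (auto intro!: Suc.IH)
qed simp

text \<open>A portrait, that is the choice of a swap at every vertex, is a point of a product of
  two-point spaces. This product is compact by Tychonoff and maps continuously onto the automorphism
  group.\<close>

lemma compact_Aut_tree: "compact_space (Aut_tree_topology bits)"
proof -
  let ?P = "product_topology (\<lambda>_. discrete_topology (UNIV :: bool set)) (UNIV :: bool list set)"
  have "compact_space ?P"
    by (simp add: compact_space_product_topology compact_space_discrete_topology)
  moreover have "continuous_map ?P (Aut_tree_topology bits) (\<lambda>p. realize (of_portrait p))"
    unfolding continuous_map
  proof (intro conjI allI impI)
    fix U assume U: "openin (Aut_tree_topology bits) U"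
    show "openin ?P {p \<in> topspace ?P. realize (of_portrait p) \<in> U}"
    proof (subst openin_subopen, intro ballI)
      fix p assume "p \<in> {p \<in> topspace ?P. realize (of_portrait p) \<in> U}"
      then obtain n where n: "\<And>h. agree n (of_portrait p) h \<Longrightarrow> realize h \<in> U"
        using U unfolding openin_Aut_tree by blast
      \<comment> \<open>The action on level \<open>n\<close> depends only on the swaps at the
        finitely many vertices above it, so fixing those gives a basic open set inside the
        preimage.\<close>
      define C where "C u = (if length u < n then {p u} else UNIV)" for u :: "bool list"
      have "finite {u :: bool list. set u \<subseteq> UNIV \<and> length u \<le> n}"
        by (rule finite_lists_length_le) simp
      then have "finite {u. C u \<noteq> topspace (discrete_topology UNIV)}"
        by (rule rev_finite_subset) (auto simp: C_def)
      then have "openin ?P (\<Pi>\<^sub>E u\<in>UNIV. C u)"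
        by (intro product_topology_basis) simp_all
      moreover have "p \<in> (\<Pi>\<^sub>E u\<in>UNIV. C u)"
        by (simp add: PiE_iff C_def)
      moreover have "realize (of_portrait q) \<in> U" if "q \<in> (\<Pi>\<^sub>E u\<in>UNIV. C u)" for q
        using that by (intro n agree_of_portrait) (auto simp: PiE_iff C_def split: if_splits)
      ultimately show "\<exists>V. openin ?P V \<and> p \<in> V \<and> V \<subseteq> {p \<in> topspace ?P. realize (of_portrait p) \<in> U}"
        by (intro exI[of _ "\<Pi>\<^sub>E u\<in>UNIV. C u"]) auto
    qed
  qed auto
  ultimately have "compactin (Aut_tree_topology bits) ((\<lambda>p. realize (of_portrait p)) ` topspace ?P)"
    by (intro image_compactin) (simp_all add: compact_space_def)
  moreover have "(\<lambda>p. realize (of_portrait p)) ` topspace ?P = range realize"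
    using of_portrait_surj by (auto simp: image_iff) metis
  ultimately show ?thesis
    by (simp add: compact_space_def)
qed

lemma profinite_realization:
  assumes A: "is_subgroup A" "cl A = A"
  shows "profinite_group (realization A) (realization_topology A)"
  unfolding profinite_group_def topological_group_def
proof (intro conjI)
  let ?T = "realization_topology A"
  show "group (realization A)"
    by (rule group_realization[OF A(1)])
  show "continuous_map (prod_topology ?T ?T) ?T (\<lambda>(x, y). x \<otimes>\<^bsub>realization A\<^esub> y)"
    unfolding continuous_map
  proof (intro conjI allI impI)
    fix U assume U: "openin ?T U"
    show "openin (prod_topology ?T ?T)
        {z \<in> topspace (prod_topology ?T ?T). (case z of (x, y) \<Rightarrow> x \<otimes>\<^bsub>realization A\<^esub> y) \<in> U}"
      unfolding openin_prod_topology_alt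
    proof (intro allI impI)
      fix x y
      assume "(x, y) \<in> {z \<in> topspace (prod_topology ?T ?T).
        (case z of (x, y) \<Rightarrow> x \<otimes>\<^bsub>realization A\<^esub> y) \<in> U}"
      then obtain g h where gh: "g \<in> A" "h \<in> A" "x = realize g" "y = realize h" "realize (g + h) \<in> U"
        by auto
      obtain n where n: "\<And>f. f \<in> A \<Longrightarrow> agree n (g + h) f \<Longrightarrow> realize f \<in> U"
        using U gh(5) is_subgroupD(2)[OF A(1) gh(1,2)] unfolding openin_realization by blast
      define V where "V f = realize ` {f' \<in> A. agree n f f'}" for f
      have "openin ?T (V f)" for f
        unfolding V_def by (rule openin_realization_ball)
      moreover have "x \<in> V g" "y \<in> V h"
        using gh by (auto simp: V_def)
      moreover have "V g \<times> V h \<subseteq> {z \<in> topspace (prod_topology ?T ?T).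
        (case z of (x, y) \<Rightarrow> x \<otimes>\<^bsub>realization A\<^esub> y) \<in> U}"
        unfolding V_def by (auto intro!: n is_subgroupD(2)[OF A(1)] agree_plus)
      ultimately show "\<exists>V W. openin ?T V \<and> openin ?T W \<and> x \<in> V \<and> y \<in> W \<and>
        V \<times> W \<subseteq> {z \<in> topspace (prod_topology ?T ?T).
          (case z of (x, y) \<Rightarrow> x \<otimes>\<^bsub>realization A\<^esub> y) \<in> U}"
        by blast
    qed
  qed (auto intro: is_subgroupD(2)[OF A(1)])
  show "continuous_map ?T ?T (\<lambda>x. inv\<^bsub>realization A\<^esub> x)"
    unfolding continuous_map
  proof (intro conjI allI impI)
    show "(\<lambda>x. inv\<^bsub>realization A\<^esub> x) ` topspace ?T \<subseteq> topspace ?T"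
      using is_subgroupD(3)[OF A(1)] by (auto simp: inv_realization[OF A(1)])
    fix U assume U: "openin ?T U"
    have iff: "realize g \<in> {x \<in> topspace ?T. inv\<^bsub>realization A\<^esub> x \<in> U} \<longleftrightarrow> realize (- g) \<in> U"
      if "g \<in> A" for g
      using that by (simp add: inv_realization[OF A(1)])
    show "openin ?T {x \<in> topspace ?T. inv\<^bsub>realization A\<^esub> x \<in> U}"
      unfolding openin_realization
    proof (intro conjI ballI impI)
      fix g assume g: "g \<in> A" "realize g \<in> {x \<in> topspace ?T. inv\<^bsub>realization A\<^esub> x \<in> U}"
      then obtain n where n: "\<And>h. h \<in> A \<Longrightarrow> agree n (- g) h \<Longrightarrow> realize h \<in> U"
        using U is_subgroupD(3)[OF A(1)] unfolding iff[OF g(1)] openin_realization by blast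
      show "\<exists>n. \<forall>h\<in>A. agree n g h \<longrightarrow> realize h \<in> {x \<in> topspace ?T. inv\<^bsub>realization A\<^esub> x \<in> U}"
        using n is_subgroupD(3)[OF A(1)] agree_uminus iff by (intro exI[of _ n]) blast
    qed auto
  qed
  show "compact_space ?T"
    unfolding realization_topology_def
    by (intro compact_space_subtopology closedin_compact_space compact_Aut_tree closedin_realize A)
  show "totally_disconnected_space ?T"
    unfolding totally_disconnected_space_def
  proof (intro allI impI ballI)
    fix C x y assume C: "connectedin ?T C" and x: "x \<in> C" and y: "y \<in> C"
    have CA: "C \<subseteq> realize ` A"
      using connectedin_subset_topspace[OF C] by simp
    then obtain g h where gh: "g \<in> A" "x = realize g" "h \<in> A" "y = realize h"
      using x y by blast
    show "x = y"
    proof (rule ccontr)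
      assume "x \<noteq> y"
      then obtain n where n: "\<not> agree n g h"
        using agree_eqI gh by blast
      let ?U = "realize ` {f \<in> A. agree n g f}" and ?V = "realize ` {f \<in> A. \<not> agree n g f}"
      have "openin ?T ?U" "openin ?T ?V"
        by (rule openin_realization_ball openin_realization_ball_compl)+
      moreover have "C \<subseteq> ?U \<union> ?V" "?U \<inter> ?V \<inter> C = {}"
        using CA by auto
      moreover have "x \<in> ?U" "y \<in> ?V"
        using gh n by auto
      then have "?U \<inter> C \<noteq> {}" "?V \<inter> C \<noteq> {}"
        using x y by blast+
      ultimately show False
        using C unfolding connectedin by blast
    qed
  qed
qed simp

text \<open>Only finitely many actions on level \<open>n\<close> are possible; one representative in
  \<open>A\<close> is chosen for each that occurs there.\<close>

lemma finite_index_agree: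
  assumes A: "is_subgroup A" and M: "\<And>h. h \<in> A \<Longrightarrow> agree n 0 h \<Longrightarrow> h \<in> M"
  shows "finite_index A M"
proof -
  have "\<exists>F. finite F \<and> (\<forall>g. \<exists>f\<in>F. agree n g f)"
  proof (induction n)
    case 0
    show ?case by (intro exI[of _ "{0}"]) simp
  next
    case (Suc n)
    then obtain F where F: "finite F" "\<forall>g. \<exists>f\<in>F. agree n g f"
      by blast
    have "\<exists>f\<in>(\<lambda>(b, f, f'). Node b f f') ` (UNIV \<times> F \<times> F). agree (Suc n) g f" for g
    proof -
      obtain f f' where "f \<in> F" "agree n (left g) f" "f' \<in> F" "agree n (right g) f'"
        using F(2) by meson
      then show ?thesis
        by (intro bexI[of _ "Node (swap g) f f'"] image_eqI[of _ _ "(swap g, f, f')"])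
          (auto simp: agree_Suc)
    qed
    then show ?case
      using F(1) by (intro exI[of _ "(\<lambda>(b, f, f'). Node b f f') ` (UNIV \<times> F \<times> F)"]) simp
  qed
  then obtain F where F: "finite F" "\<And>g. \<exists>f\<in>F. agree n g f"
    by blast
  \<comment> \<open>The choice is meaningful for actions that occur in \<open>A\<close>; below,
    \<open>f\<close> always comes from some \<open>x\<close> in \<open>A\<close>.\<close>
  define r where "r f = (SOME a. a \<in> A \<and> agree n a f)" for f
  have "\<exists>f\<in>r ` F. - f + x \<in> M" if x: "x \<in> A" for x
  proof -
    obtain f where f: "f \<in> F" "agree n x f"
      using F(2) by blast
    have "r f \<in> A \<and> agree n (r f) f"
      unfolding r_def by (rule someI[of _ x]) (use x f in blast)
    then have rf: "r f \<in> A" "agree n (r f) f"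
      by auto
    have "agree n (r f) x"
      by (rule agree_trans[OF rf(2) agree_sym[OF f(2)]])
    then have "agree n (- r f + r f) (- r f + x)"
      by (rule agree_plus[OF agree_refl])
    then have "agree n 0 (- r f + x)"
      by simp
    moreover have "- r f + x \<in> A"
      by (rule is_subgroupD(2)[OF A is_subgroupD(3)[OF A rf(1)] x])
    ultimately show ?thesis
      using M f(1) by blast
  qed
  then show ?thesis
    unfolding finite_index_def using F(1) by (intro exI[of _ "r ` F"]) simp
qed

text \<open>Doubling removes the swap at the root, so \<open>g + g\<close> acts on the two halves
  separately and the induction continues there.\<close>

lemma agree_multiple: "agree n (multiple (2 ^ n) g) 0"
proof (induction n arbitrary: g)
  case (Suc n)
  have m: "multiple m h = Node False (multiple m (left h)) (multiple m (right h))" if "\<not> swap h" for m h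
    using that by (induction m) (auto intro: aut.expand)
  have "multiple (2 ^ Suc n) g = Node False (multiple (2 ^ n) (left (g + g))) (multiple (2 ^ n) (right (g + g)))"
    unfolding power_Suc multiple_double by (rule m) simp
  then show ?case
    using Suc by (simp only: agree_Suc aut.sel) simp
qed simp

text \<open>An open normal subgroup contains every element of \<open>A\<close> that is trivial on
  some level \<open>n\<close>. So the quotient is finite and is annihilated by \<open>2 ^ n\<close>,
  which makes its order a power of 2.\<close>

lemma pro_2_realization:
  assumes A: "is_subgroup A" "cl A = A"
  shows "pro_p_group 2 (realization A) (realization_topology A)"
  unfolding pro_p_group_def
proof (intro conjI allI impI)
  show "profinite_group (realization A) (realization_topology A)"
    by (rule profinite_realization[OF A])
  fix N assume N: "N \<lhd> realization A \<and> openin (realization_topology A) N"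
  define M where "M = realize -` N"
  have NM: "N = realize ` M"
    using N unfolding M_def openin_realization by auto
  have M: "is_subgroup M" "M \<subseteq> A"
    using subgroup_realization[OF A(1)] N normal_imp_subgroup unfolding NM by blast+
  have zero_N: "realize 0 \<in> N"
    using is_subgroupD(1)[OF M(1)] by (simp add: NM)
  moreover have "0 \<in> A"
    using is_subgroupD(1)[OF A(1)] .
  ultimately have "\<exists>n. \<forall>h\<in>A. agree n 0 h \<longrightarrow> realize h \<in> N"
    using conjunct2[OF N] unfolding openin_realization by simp
  then obtain n where n: "\<And>h. h \<in> A \<Longrightarrow> agree n 0 h \<Longrightarrow> h \<in> M"
    unfolding M_def by auto
  have "finite_index A M"
    by (rule finite_index_agree[OF A(1) n])
  then show fin: "finite (carrier (realization A Mod N))"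
    using finite_rcosets_realization[OF A(1) M(1)] by (simp add: FactGroup_def NM)
  interpret N: normal N "realization A"
    using N by blast
  interpret Q: group "realization A Mod N"
    by (rule N.factorgroup_is_group)
  show "\<exists>e. order (realization A Mod N) = 2 ^ e"
  proof (rule Q.order_prime_power[OF fin two_is_prime_nat, where n = n])
    fix C assume "C \<in> carrier (realization A Mod N)"
    then obtain g where g: "g \<in> A" "C = N #>\<^bsub>realization A\<^esub> realize g"
      by (auto simp: FactGroup_def RCOSETS_def)
    have mA: "multiple m g \<in> A" for m
      using g(1) is_subgroupD(1,2)[OF A(1)] by (induction m) auto
    have "C [^]\<^bsub>realization A Mod N\<^esub> m = N #>\<^bsub>realization A\<^esub> realize (multiple m g)" for m :: nat
    proof (induction m)
      case 0
      show ?case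
        using N.rcos_const[OF N.is_group zero_N] by (simp add: FactGroup_def)
    next
      case (Suc m)
      have "multiple m g + g = g + multiple m g"
        by (rule multiple_commute) simp
      then show ?case
        using Suc N.rcos_sum[of "realize (multiple m g)" "realize g"] g mA[of m]
        by (simp add: FactGroup_def nat_pow_def)
    qed
    moreover have "realize (multiple (2 ^ n) g) \<in> N"
      unfolding NM using n[OF mA] agree_sym[OF agree_multiple] by blast
    ultimately show "C [^]\<^bsub>realization A Mod N\<^esub> (2 ^ n :: nat) = \<one>\<^bsub>realization A Mod N\<^esub>"
      using N.rcos_const[OF N.is_group] by (simp add: FactGroup_def)
  qed
qed

section \<open>The main theorem\<close>

lemma topologically_isomorphic_refl: "topologically_isomorphic G T G T"
  unfolding topologically_isomorphic_def by (intro bexI[of _ id] homeomorphic_map_id) (auto simp: iso_def hom_def)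

context block_lengths
begin

definition Grp_closure :: "aut set" where
  "Grp_closure = cl (Grp k 0)"

lemma is_subgroup_Grp_closure: "is_subgroup Grp_closure"
  unfolding Grp_closure_def by (intro is_subgroup_cl is_subgroup_Grp)

lemma cl_Grp_closure: "cl Grp_closure = Grp_closure"
  by (simp add: Grp_closure_def)

lemma Grp_subset_Grp_closure: "Grp k 0 \<subseteq> Grp_closure"
  unfolding Grp_closure_def by (rule cl_incl)

lemma two_generated: "topologically_2_generated (realization Grp_closure) (realization_topology Grp_closure)"
proof -
  let ?G = "realization Grp_closure" and ?T = "realization_topology Grp_closure"
  let ?S = "{realize (rot (k 0)), realize (dir k 0)}"
  have gens_in: "rot (k 0) \<in> Grp_closure" "dir k 0 \<in> Grp_closure"
    using Grp_subset_Grp_closure rot_in_Grp dir_in_Grp by blast+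
  have "realize x \<in> generate ?G ?S" if "x \<in> gen {rot (k 0), dir k 0}" for x
    using that
  proof (induction rule: gen.induct)
    case gen_zero
    then show ?case
      using generate.one[of ?G ?S] by simp
  next
    case (gen_add s x)
    then have "realize s \<in> generate ?G ?S"
      by (intro generate.incl) auto
    then show ?case
      using generate.eng[of "realize s" ?G ?S "realize x"] gen_add by simp
  next
    case (gen_minus s x)
    then have "inv\<^bsub>?G\<^esub> realize s \<in> generate ?G ?S" "s \<in> Grp_closure"
      using gens_in by (auto intro!: generate.inv)
    then have "realize (- s) \<in> generate ?G ?S"
      by (simp add: inv_realization[OF is_subgroup_Grp_closure])
    then show ?case
      using generate.eng[of "realize (- s)" ?G ?S "realize x"] gen_minus by simp
  qed
  then have "realize ` Grp k 0 \<subseteq> generate ?G ?S"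
    unfolding Grp_def by blast
  then have "?T closure_of (realize ` Grp k 0) \<subseteq> ?T closure_of (generate ?G ?S)"
    by (rule closure_of_mono)
  moreover have "?T closure_of (realize ` Grp k 0) = realize ` Grp_closure"
    unfolding closure_of_realization[OF cl_Grp_closure Grp_subset_Grp_closure] by (simp add: Grp_closure_def)
  moreover have "?T closure_of (generate ?G ?S) \<subseteq> realize ` Grp_closure"
    using closure_of_subset_topspace[of ?T "generate ?G ?S"] by simp
  ultimately show ?thesis
    unfolding topologically_2_generated_def using gens_in by (intro bexI) auto
qed

lemma infinite_Grp_closure: "infinite Grp_closure"
proof
  assume fin: "finite Grp_closure"
  \<comment> \<open>A level at least as deep as the supposed cardinality: transitivity on its
    \<open>2 ^ d\<close> vertices would force \<open>2 ^ d\<close> to be at most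
    \<open>d\<close>.\<close>
  define d where "d = depth k 0 (card Grp_closure)"
  define u where "u = replicate d False"
  have "{w. length w = d} \<subseteq> (\<lambda>g. act g u) ` Grp_closure"
  proof
    fix w :: "bool list" assume "w \<in> {w. length w = d}"
    then obtain g where "g \<in> Grp k 0" "act g u = w"
      using Grp_transitive[of u 0 "card Grp_closure" w] by (auto simp: u_def d_def)
    then show "w \<in> (\<lambda>g. act g u) ` Grp_closure"
      using Grp_subset_Grp_closure by blast
  qed
  then have "card {w :: bool list. length w = d} \<le> card Grp_closure"
    using fin by (meson surj_card_le)
  moreover have "card {w :: bool list. length w = d} = 2 ^ d"
    using card_lists_length_eq[of "UNIV :: bool set" d] by simp
  moreover have "card Grp_closure \<le> d"
    unfolding d_def by (rule depth_ge)
  ultimately have "(2::nat) ^ d \<le> d"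
    by simp
  then show False
    using less_exp[of d] by simp
qed

lemma just_infinite_Grp_closure: "just_infinite (realization Grp_closure) (realization_topology Grp_closure)"
  unfolding just_infinite_def
proof (intro conjI allI impI)
  show "profinite_group (realization Grp_closure) (realization_topology Grp_closure)"
    by (rule profinite_realization[OF is_subgroup_Grp_closure cl_Grp_closure])
  show "infinite (carrier (realization Grp_closure))"
    using infinite_Grp_closure by (simp add: finite_image_iff inj_on_def)
  fix N assume N: "N \<lhd> realization Grp_closure \<and> closedin (realization_topology Grp_closure) N \<and>
    N \<noteq> {\<one>\<^bsub>realization Grp_closure\<^esub>}"
  define M where "M = realize -` N"
  have "N \<subseteq> realize ` Grp_closure"
    using closedin_subset[of "realization_topology Grp_closure" N] N by simp
  then have NM: "N = realize ` M"
    unfolding M_def by auto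
  have sub: "subgroup (realize ` M) (realization Grp_closure)" and nor: "realize ` M \<lhd> realization Grp_closure"
    using N normal_imp_subgroup unfolding NM by blast+
  note M = subgroup_realization[OF is_subgroup_Grp_closure sub]
  have "closedin (Aut_tree_topology bits) (realize ` M)"
    using N closedin_closed_subtopology[OF closedin_realize[OF cl_Grp_closure]]
    unfolding realization_topology_def NM by blast
  then have clM: "cl M = M"
    by (rule cl_eq_if_closedin)
  obtain g where g: "g \<in> M" "g \<noteq> 0"
  proof -
    have "M \<noteq> {0}"
      using N by (auto simp: NM)
    then show ?thesis
      using that is_subgroupD(1)[OF M(1)] by blast
  qed
  have "finite_index Grp_closure M"
    unfolding Grp_closure_def
  proof (rule finite_index_normal_subgroup[OF M(1) clM g])
    show "h + x - h \<in> M" if "h \<in> Grp k 0" "x \<in> M" for h x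
      by (rule normal_realization[OF is_subgroup_Grp_closure nor subsetD[OF Grp_subset_Grp_closure that(1)] that(2)])
  qed
  then show "finite (carrier (realization Grp_closure Mod N))"
    using finite_rcosets_realization[OF is_subgroup_Grp_closure M(1)] by (simp add: FactGroup_def NM)
qed

lemma branch_Grp_closure: "branch_subgroup bits (realize ` Grp_closure)"
  unfolding branch_subgroup_def
proof (intro conjI allI)
  show "subgroup (realize ` Grp_closure) (Aut_tree bits)"
    unfolding Aut_tree_eq by (intro subgroup_realizationI is_subgroup_UNIV is_subgroup_Grp_closure) simp
  have "\<exists>g\<in>Grp_closure. act g u = v" if uv: "length u = n" "length v = n" for u v n
  proof -
    \<comment> \<open>Padding reaches a level where a block begins, for which transitivity is known;
      the prefixes are then matched as well.\<close>
    let ?p = "replicate (depth k 0 n - n) False"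
    have "length (u @ ?p) = depth k 0 n" "length (v @ ?p) = depth k 0 n"
      using uv depth_ge[of n 0] by simp_all
    then obtain g where "g \<in> Grp k 0" "act g (u @ ?p) = v @ ?p"
      using Grp_transitive by blast
    then show ?thesis
      using uv Grp_subset_Grp_closure by (auto simp: act_append)
  qed
  then show "level_transitive bits (realize ` Grp_closure)"
    unfolding level_transitive_def level_eq_code by fastforce
  fix n
  define R where "R = realize -` Rist_level bits (realize ` Grp_closure) n"
  have grp: "group (realization UNIV)"
    by (rule group_realization[OF is_subgroup_UNIV])
  have "(\<Union>u\<in>level bits n. Rist bits (realize ` Grp_closure) u) \<subseteq> carrier (realization UNIV)"
    by (auto simp: Rist_def)
  then have sub: "subgroup (Rist_level bits (realize ` Grp_closure) n) (realization UNIV)"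
    unfolding Rist_level_def Aut_tree_eq by (rule group.generate_is_subgroup[OF grp])
  then have "Rist_level bits (realize ` Grp_closure) n \<subseteq> range realize"
    using subgroup.subset by fastforce
  then have RR: "Rist_level bits (realize ` Grp_closure) n = realize ` R"
    unfolding R_def by auto
  have R: "is_subgroup R"
    using subgroup_realization(1)[OF is_subgroup_UNIV] sub unfolding RR by blast
  have "implant u x \<in> R" if u: "length u = n" and x: "implant u x \<in> Grp_closure" for u x
  proof -
    have "realize (implant u x) \<in> Rist bits (realize ` Grp_closure) (code u)"
      using x by (auto simp: Rist_def act_implant_outside)
    then have "realize (implant u x) \<in> generate (Aut_tree bits) (\<Union>u\<in>level bits n. Rist bits (realize ` Grp_closure) u)"
      using u by (intro generate.incl) (auto simp: level_eq_code)
    then show ?thesis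
      by (simp add: R_def Rist_level_def)
  qed
  then have "finite_index Grp_closure R"
    unfolding Grp_closure_def using finite_index_rigid[OF R] by blast
  then have "finite (rcosets\<^bsub>realization Grp_closure\<^esub> (realize ` R))"
    by (rule finite_rcosets_realization[OF is_subgroup_Grp_closure R])
  then show "finite (rcosets\<^bsub>Aut_tree bits\<lparr>carrier := realize ` Grp_closure\<rparr>\<^esub> Rist_level bits (realize ` Grp_closure) n)"
    by (simp add: realization_def RR)
qed

lemma branch_profinite_Grp_closure: "branch_profinite_group (realization Grp_closure) (realization_topology Grp_closure)"
  unfolding branch_profinite_group_def
proof (intro conjI exI)
  show "profinite_group (realization Grp_closure) (realization_topology Grp_closure)"
    by (rule profinite_realization[OF is_subgroup_Grp_closure cl_Grp_closure])
  show "finite bits"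
    by (simp add: bits_def)
  show "branch_subgroup bits (realize ` Grp_closure)"
    by (rule branch_Grp_closure)
  show "closedin (Aut_tree_topology bits) (realize ` Grp_closure)"
    by (rule closedin_realize[OF cl_Grp_closure])
  show "topologically_isomorphic (realization Grp_closure) (realization_topology Grp_closure)
      (Aut_tree bits\<lparr>carrier := realize ` Grp_closure\<rparr>) (subtopology (Aut_tree_topology bits) (realize ` Grp_closure))"
    unfolding realization_def[symmetric] realization_topology_def[symmetric]
    by (rule topologically_isomorphic_refl)
qed

end

text \<open>\<open>realize\<close> is injective, so an isomorphism pulls back to a map
  \<open>phi\<close> of coinductive trees. Homeomorphisms commute with closures, which is the form
  of continuity that \<open>no_iso\<close> takes.\<close>

lemma not_topologically_isomorphic:
  assumes k: "block_lengths k" "block_lengths k'" "k \<noteq> k'"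
  shows "\<not> topologically_isomorphic
    (realization (block_lengths.Grp_closure k)) (realization_topology (block_lengths.Grp_closure k))
    (realization (block_lengths.Grp_closure k')) (realization_topology (block_lengths.Grp_closure k'))"
proof
  let ?A = "cl (Grp k 0)" and ?B = "cl (Grp k' 0)"
  assume "topologically_isomorphic
    (realization (block_lengths.Grp_closure k)) (realization_topology (block_lengths.Grp_closure k))
    (realization (block_lengths.Grp_closure k')) (realization_topology (block_lengths.Grp_closure k'))"
  then obtain f where iso: "f \<in> iso (realization ?A) (realization ?B)"
    and homeo: "homeomorphic_map (realization_topology ?A) (realization_topology ?B) f"
    unfolding topologically_isomorphic_def block_lengths.Grp_closure_def[OF k(1)] block_lengths.Grp_closure_def[OF k(2)]
    by blast
  have bij: "bij_betw f (realize ` ?A) (realize ` ?B)"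
    using iso by (simp add: iso_def)
  define phi where "phi g = inv_into UNIV realize (f (realize g))" for g
  have phi: "realize (phi g) = f (realize g)" if "g \<in> ?A" for g
    unfolding phi_def using bij_betwE[OF bij] that by (intro f_inv_into_f) auto
  have phi_image: "realize ` phi ` S = f ` realize ` S" if "S \<subseteq> ?A" for S
    unfolding image_image using phi that by (intro image_cong) auto
  have inj: "inj realize"
    by (simp add: inj_def)
  have "bij_betw phi ?A ?B"
    unfolding bij_betw_def
  proof
    show "inj_on phi ?A"
    proof (rule inj_onI)
      fix g h assume gh: "g \<in> ?A" "h \<in> ?A" "phi g = phi h"
      then have "f (realize g) = f (realize h)"
        using phi by metis
      then have "realize g = realize h"
        using bij_betw_imp_inj_on[OF bij] gh(1,2) by (auto dest: inj_onD)
      then show "g = h"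
        by simp
    qed
    have "realize ` phi ` ?A = realize ` ?B"
      using phi_image[of ?A] bij by (simp add: bij_betw_def)
    then show "phi ` ?A = ?B"
      using inj by (simp add: inj_image_eq_iff)
  qed
  moreover have "phi (x + y) = phi x + phi y" if xy: "x \<in> ?A" "y \<in> ?A" for x y
  proof -
    have "x + y \<in> ?A"
      using xy by (intro is_subgroupD(2) is_subgroup_cl is_subgroup_Grp)
    moreover have "f (realize x \<otimes>\<^bsub>realization ?A\<^esub> realize y) =
        f (realize x) \<otimes>\<^bsub>realization ?B\<^esub> f (realize y)"
      using iso xy by (intro hom_mult[of f "realization ?A" "realization ?B"]) (auto simp: iso_def)
    ultimately have "realize (phi (x + y)) = realize (phi x + phi y)"
      using xy by (simp add: phi flip: mult_realization[of ?B "phi x" "phi y"])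
    then show ?thesis
      by simp
  qed
  moreover have "phi ` cl S = cl (phi ` S)" if S: "S \<subseteq> ?A" for S
  proof -
    have clS: "cl S \<subseteq> ?A"
      by (rule cl_least[OF S cl_cl])
    have "phi ` S \<subseteq> ?B"
      using S \<open>bij_betw phi ?A ?B\<close> by (auto simp: bij_betw_def)
    then have "realize ` cl (phi ` S) = realization_topology ?B closure_of (realize ` phi ` S)"
      by (simp only: closure_of_realization[OF cl_cl])
    also have "\<dots> = realization_topology ?B closure_of (f ` realize ` S)"
      by (simp only: phi_image[OF S])
    also have "\<dots> = f ` (realization_topology ?A closure_of (realize ` S))"
      using S by (intro homeomorphic_map_closure_of[OF homeo]) auto
    also have "\<dots> = f ` realize ` cl S"
      by (simp only: closure_of_realization[OF cl_cl S])
    also have "\<dots> = realize ` phi ` cl S"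
      by (simp only: phi_image[OF clS])
    finally show ?thesis
      using inj by (simp add: inj_image_eq_iff)
  qed
  ultimately show False
    by (rule no_iso[OF k])
qed

theorem mainTheorem1:
  shows "\<exists>S :: ((nat list \<Rightarrow> nat list) monoid \<times> (nat list \<Rightarrow> nat list) topology) set.
    S \<approx> (UNIV :: nat set set) \<and>
    (\<forall>(G, T) \<in> S.
       pro_p_group 2 G T \<and> topologically_2_generated G T \<and>
       just_infinite G T \<and> branch_profinite_group G T) \<and>
    pairwise (\<lambda>(G, T) (H, U). \<not> topologically_isomorphic G T H U) S"
proof -
  \<comment> \<open>A set of natural numbers is encoded by the places where the block length is
    4.\<close>
  define len :: "nat set \<Rightarrow> nat \<Rightarrow> nat" where "len s n = (if n \<in> s then 4 else 3 :: nat)" for s n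
  define F where "F s = (realization (block_lengths.Grp_closure (len s)), realization_topology (block_lengths.Grp_closure (len s)))" for s
  have len: "block_lengths (len s)" for s
    by unfold_locales (simp add: len_def)
  have len_neq: "len s \<noteq> len t" if "s \<noteq> t" for s t
  proof -
    obtain n where "n \<in> s \<longleftrightarrow> n \<notin> t"
      using \<open>s \<noteq> t\<close> by blast
    then have "len s n \<noteq> len t n"
      by (auto simp: len_def)
    then show ?thesis
      by auto
  qed
  have not_iso: "\<not> topologically_isomorphic (fst (F s)) (snd (F s)) (fst (F t)) (snd (F t))" if "s \<noteq> t" for s t
    unfolding F_def fst_conv snd_conv
    by (rule not_topologically_isomorphic[OF len len len_neq[OF that]])
  \<comment> \<open>Equal pairs would be isomorphic by the identity, so non-isomorphism already
    yields injectivity and thereby the cardinality.\<close>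
  have "inj F"
  proof (rule injI, rule ccontr)
    fix s t assume "F s = F t" "s \<noteq> t"
    then show False
      using not_iso[of s t] by (simp add: topologically_isomorphic_refl)
  qed
  then have "range F \<approx> (UNIV :: nat set set)"
    by (rule inj_on_image_eqpoll_self)
  moreover have "\<forall>(G, T) \<in> range F. pro_p_group 2 G T \<and> topologically_2_generated G T \<and>
      just_infinite G T \<and> branch_profinite_group G T"
  proof (rule ballI, unfold case_prod_beta)
    fix z assume "z \<in> range F"
    then obtain s where s: "z = F s"
      by blast
    interpret block_lengths "len s"
      by (rule len)
    show "pro_p_group 2 (fst z) (snd z) \<and> topologically_2_generated (fst z) (snd z) \<and>
        just_infinite (fst z) (snd z) \<and> branch_profinite_group (fst z) (snd z)"
      unfolding s F_def fst_conv snd_conv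
      using pro_2_realization[OF is_subgroup_Grp_closure cl_Grp_closure] two_generated
        just_infinite_Grp_closure branch_profinite_Grp_closure by blast
  qed
  moreover have "pairwise (\<lambda>(G, T) (H, U). \<not> topologically_isomorphic G T H U) (range F)"
  proof (rule pairwiseI)
    fix x y assume xy: "x \<in> range F" "y \<in> range F" "x \<noteq> y"
    then obtain s t where "x = F s" "y = F t"
      by blast
    then show "(case x of (G, T) \<Rightarrow> \<lambda>(H, U). \<not> topologically_isomorphic G T H U) y"
      using not_iso[of s t] xy(3) by (auto simp: case_prod_beta)
  qed
  ultimately show ?thesis
    by (intro exI[of _ "range F"] conjI)
qed

end
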